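(* Let $z,g\in L^2(D)$, $\boldsymbol y\in\mathbb R^s$, and let $u_s^{\boldsymbol y},q_s^{\boldsymbol y}\in H_0^1(D)$ be the solutions of $$\int_Da_s^{\boldsymbol y}\nabla u_s^{\boldsymbol y}\cdot\nabla v\,dx=\int_Dzv\,dx,\qquad\int_Da_s^{\boldsymbol y}\nabla q_s^{\boldsymbol y}\cdot\nabla v\,dx=\int_D(u_s^{\boldsymbol y}-g)v\,dx\qquad\forall v\in H_0^1(D).$$ Then for every multi-index $\boldsymbol\nu\in\mathbb N_0^s$, $$\|\partial^{\boldsymbol\nu}u_s^{\boldsymbol y}\|_{H_0^1(D)}\le|\boldsymbol\nu|!\,\frac{\boldsymbol b^{\boldsymbol\nu}}{(\ln2)^{|\boldsymbol\nu|}}\,\frac{\|z\|_{H^{-1}(D)}}{a_{\min}^{\boldsymbol y}},$$ $$\|\partial^{\boldsymbol\nu}q_s^{\boldsymbol y}\|_{H_0^1(D)}\le(|\boldsymbol\nu|+1)!\,\frac{\boldsymbol b^{\boldsymbol\nu}}{(\ln2)^{|\boldsymbol\nu|}}\,\frac{C_q^{\boldsymbol y}}{a_{\min}^{\boldsymbol y}}\big(\|z\|_{H^{-1}(D)}+\|g\|_{H^{-1}(D)}\big).$$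
   Context: $D\subset\mathbb R^d$, $d\in\{1,2,3\}$, is a bounded Lipschitz domain. $\|v\|_{H_0^1(D)}:=\|\nabla v\|_{L^2(D)}$, $H^{-1}(D)$ is the dual of $H_0^1(D)$, and $c_1,c_2>0$ are embedding constants: $\|v\|_{H^{-1}(D)}\le c_1\|v\|_{L^2(D)}$, $\|v\|_{L^2(D)}\le c_2\|v\|_{H_0^1(D)}$. $a(x,\omega)=\exp(Z(x,\omega))$ with $Z$ a Gaussian random field with $Z(\cdot,\omega)\in C^\beta(\overline D)$ almost surely for some $\beta\in(0,1]$. On a uniform rectangular (circulant embedding) grid $\{x_i\}_{i=1}^m$ the covariance matrix of $(Z(x_i,\cdot))_i$ is factored as $BB^\top$, $B\in\mathbb R^{m\times s}$, $s\ge m$, and $\overline Z_i=\mathbb E[Z(x_i,\cdot)]$, so that the field on the grid is sampled as $B\boldsymbol Y+\overline{\boldsymbol Z}$ with $\boldsymbol Y\sim\mathcal N(0,I_s)$. For $\boldsymbol y\in\mathbb R^s$, $a_s^{\boldsymbol y}(x_i):=\exp(\sum_{j=1}^sB_{i,j}y_j+\overline Z_i)$, extended to $x\in D$ by multilinear interpolation $a_s^{\boldsymbol y}(x)=\sum_{k=1}^{2^d}w_{k,x}a_s^{\boldsymbol y}(x_{k,x})$ from the $2^d$ vertices $x_{k,x}$ of the grid cell containing $x$, with $w_{k,x}\in[0,1]$, $\sum_kw_{k,x}=1$. For a realization $\boldsymbol y=\boldsymbol Y(\omega)$, $a_{\min}^{\boldsymbol y}:=\min_{x\in\overline D}a(x,\omega)$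 and $a_{\max}^{\boldsymbol y}:=\max_{x\in\overline D}a(x,\omega)$, so that $0<a_{\min}^{\boldsymbol y}\le a_s^{\boldsymbol y}(x)\le a_{\max}^{\boldsymbol y}<\infty$ for all $x\in\overline D$. $\partial^{\boldsymbol\nu}$ is the $\boldsymbol\nu$-th partial derivative with respect to $\boldsymbol y$; $|\boldsymbol\nu|=\sum_j\nu_j$; $\boldsymbol b=(b_1,\dots,b_s)$ with $b_j:=\max_i|B_{i,j}|$; $\boldsymbol b^{\boldsymbol\nu}=\prod_jb_j^{\nu_j}$. $C_q^{\boldsymbol y}:=\max\big(1,\frac{c_1c_2}{a_{\min}^{\boldsymbol y}}\big)$. *)

theory Defs
  imports "HOL-Analysis.Analysis" "HOL-Probability.Probability"
begin

section \<open>Domains\<close>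

text \<open>Around each boundary point \<open>D\<close> is, in some direction \<open>e\<close>, the strict epigraph of a
  Lipschitz function of the orthogonal projection onto the hyperplane normal to \<open>e\<close>; this
  hyperplane plays the role of the first \<open>d - 1\<close> coordinates.\<close>

definition lipschitz_boundary :: "(real^'n) set \<Rightarrow> bool" where
  "lipschitz_boundary D \<longleftrightarrow>
     (\<forall>p\<in>frontier D. \<exists>r e \<gamma> L. 0 < r \<and> norm e = 1 \<and> L-lipschitz_on {v. v \<bullet> e = 0} \<gamma> \<and>
        D \<inter> ball p r = {x \<in> ball p r. \<gamma> (x - (x \<bullet> e) *\<^sub>R e) < x \<bullet> e})"

definition bounded_lipschitz_domain :: "(real^'n) set \<Rightarrow> bool" where
  "bounded_lipschitz_domain D \<longleftrightarrow>
     open D \<and> connected D \<and> D \<noteq> {} \<and> bounded D \<and> lipschitz_boundary D"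

section \<open>Function spaces\<close>

text \<open>Elements of the spaces below are represented by functions; only their almost everywhere
  classes on \<open>D\<close> matter.\<close>

definition L2_on :: "(real^'n) set \<Rightarrow> (real^'n \<Rightarrow> 'a::euclidean_space) set" where
  "L2_on D = {f. f \<in> borel_measurable (lebesgue_on D) \<and>
                 integrable (lebesgue_on D) (\<lambda>x. (norm (f x))\<^sup>2)}"

definition l2norm :: "(real^'n) set \<Rightarrow> (real^'n \<Rightarrow> 'a::euclidean_space) \<Rightarrow> real" where
  "l2norm D f = sqrt (LINT x|lebesgue_on D. (norm (f x))\<^sup>2)"

definition grad :: "(real^'n \<Rightarrow> real) \<Rightarrow> real^'n \<Rightarrow> real^'n" where
  "grad f x = (\<chi> i. frechet_derivative f (at x) (axis i 1))"

primrec C_k :: "nat \<Rightarrow> (real^'n \<Rightarrow> real) \<Rightarrow> bool" where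
  "C_k 0 f \<longleftrightarrow> continuous_on UNIV f"
| "C_k (Suc k) f \<longleftrightarrow> f differentiable_on UNIV \<and> (\<forall>i. C_k k (\<lambda>x. grad f x $ i))"

definition test_functions :: "(real^'n) set \<Rightarrow> (real^'n \<Rightarrow> real) set" where
  "test_functions D = {\<phi>. (\<forall>k. C_k k \<phi>) \<and> compact (closure {x. \<phi> x \<noteq> 0}) \<and>
                          closure {x. \<phi> x \<noteq> 0} \<subseteq> D}"

definition has_weak_gradient ::
    "(real^'n) set \<Rightarrow> (real^'n \<Rightarrow> real) \<Rightarrow> (real^'n \<Rightarrow> real^'n) \<Rightarrow> bool" where
  "has_weak_gradient D u G \<longleftrightarrow> u \<in> L2_on D \<and> G \<in> L2_on D \<and>
     (\<forall>\<phi>\<in>test_functions D.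
        (LINT x|lebesgue_on D. u x *\<^sub>R grad \<phi> x) = - (LINT x|lebesgue_on D. \<phi> x *\<^sub>R G x))"

text \<open>The weak gradient is unique up to almost everywhere equality on \<open>D\<close>.\<close>

definition wgrad :: "(real^'n) set \<Rightarrow> (real^'n \<Rightarrow> real) \<Rightarrow> real^'n \<Rightarrow> real^'n" where
  "wgrad D u = (SOME G. has_weak_gradient D u G)"

text \<open>The closure of the test functions in \<open>H\<^sup>1(D)\<close>.\<close>

definition H01 :: "(real^'n) set \<Rightarrow> (real^'n \<Rightarrow> real) set" where
  "H01 D = {u. \<exists>G. has_weak_gradient D u G \<and>
     (\<exists>\<phi>::nat \<Rightarrow> _. (\<forall>k. \<phi> k \<in> test_functions D) \<and>
        (\<lambda>k. l2norm D (\<lambda>x. \<phi> k x - u x)) \<longlonglongrightarrow> 0 \<and>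
        (\<lambda>k. l2norm D (\<lambda>x. grad (\<phi> k) x - G x)) \<longlonglongrightarrow> 0)}"

definition H01_norm :: "(real^'n) set \<Rightarrow> (real^'n \<Rightarrow> real) \<Rightarrow> real" where
  "H01_norm D u = l2norm D (wgrad D u)"

definition dual_norm :: "(real^'n) set \<Rightarrow> ((real^'n \<Rightarrow> real) \<Rightarrow> real) \<Rightarrow> real" where
  "dual_norm D F = (SUP v\<in>{v \<in> H01 D. H01_norm D v \<le> 1}. \<bar>F v\<bar>)"

text \<open>\<open>L\<^sup>2(D)\<close> is embedded into the dual of \<open>H\<^sub>0\<^sup>1(D)\<close> by the \<open>L\<^sup>2\<close> pairing.\<close>

definition Hm1_norm :: "(real^'n) set \<Rightarrow> (real^'n \<Rightarrow> real) \<Rightarrow> real" where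
  "Hm1_norm D z = dual_norm D (\<lambda>v. LINT x|lebesgue_on D. z x * v x)"

definition weak_solution ::
    "(real^'n) set \<Rightarrow> (real^'n \<Rightarrow> real) \<Rightarrow> (real^'n \<Rightarrow> real) \<Rightarrow> (real^'n \<Rightarrow> real) \<Rightarrow> bool" where
  "weak_solution D a f u \<longleftrightarrow> u \<in> H01 D \<and>
     (\<forall>v\<in>H01 D. (LINT x|lebesgue_on D. a x * (wgrad D u x \<bullet> wgrad D v x)) =
                 (LINT x|lebesgue_on D. f x * v x))"

section \<open>Partial derivatives of \<open>H\<^sub>0\<^sup>1(D)\<close>-valued functions of a parameter in \<open>\<real>\<^sup>s\<close>\<close>

definition has_H01_partial ::
    "(real^'n) set \<Rightarrow> 's::finite \<Rightarrow> (real^'s \<Rightarrow> real^'n \<Rightarrow> real) \<Rightarrow> (real^'n \<Rightarrow> real) \<Rightarrow> real^'s \<Rightarrow> bool"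
  where
  "has_H01_partial D j f f' y \<longleftrightarrow> f' \<in> H01 D \<and>
     ((\<lambda>t. H01_norm D (\<lambda>x. (f (y + t *\<^sub>R axis j 1) x - f y x) / t - f' x)) \<longlongrightarrow> 0) (at 0)"

text \<open>\<open>w \<nu>\<close> is the mixed partial derivative of order \<open>\<nu>\<close>, for all multi-indices \<open>\<nu>\<close> simultaneously
  and in whichever order the derivatives are taken.\<close>

definition H01_partials ::
    "(real^'n) set \<Rightarrow> (real^'s::finite \<Rightarrow> real^'n \<Rightarrow> real) \<Rightarrow>
     (('s \<Rightarrow> nat) \<Rightarrow> real^'s \<Rightarrow> real^'n \<Rightarrow> real) \<Rightarrow> bool" where
  "H01_partials D f w \<longleftrightarrow> w (\<lambda>_. 0) = f \<and> (\<forall>y. f y \<in> H01 D) \<and>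
     (\<forall>\<nu> j y. has_H01_partial D j (w \<nu>) (w (\<nu>(j := Suc (\<nu> j))) y) y)"

definition H01_smooth :: "(real^'n) set \<Rightarrow> (real^'s::finite \<Rightarrow> real^'n \<Rightarrow> real) \<Rightarrow> bool" where
  "H01_smooth D f \<longleftrightarrow> (\<exists>w. H01_partials D f w)"

text \<open>If \<open>H01_smooth D f\<close>, this is \<open>\<partial>\<^sup>\<nu>f\<close>, unique up to almost everywhere equality on \<open>D\<close>.\<close>

definition H01_pderiv ::
    "(real^'n) set \<Rightarrow> ('s::finite \<Rightarrow> nat) \<Rightarrow> (real^'s \<Rightarrow> real^'n \<Rightarrow> real) \<Rightarrow>
     real^'s \<Rightarrow> real^'n \<Rightarrow> real" where
  "H01_pderiv D \<nu> f = (SOME w. H01_partials D f w) \<nu>"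

section \<open>Gaussian random fields\<close>

definition gaussian_rv :: "'w measure \<Rightarrow> ('w \<Rightarrow> real) \<Rightarrow> bool" where
  "gaussian_rv M X \<longleftrightarrow> X \<in> borel_measurable M \<and>
     ((\<exists>\<mu>. AE \<omega> in M. X \<omega> = \<mu>) \<or>
      (\<exists>\<mu> \<sigma>. 0 < \<sigma> \<and> distributed M lborel X (normal_density \<mu> \<sigma>)))"

definition gaussian_field :: "'w measure \<Rightarrow> 'i set \<Rightarrow> ('i \<Rightarrow> 'w \<Rightarrow> real) \<Rightarrow> bool" where
  "gaussian_field M T Z \<longleftrightarrow>
     (\<forall>F c. finite F \<and> F \<subseteq> T \<longrightarrow> gaussian_rv M (\<lambda>\<omega>. \<Sum>t\<in>F. c t * Z t \<omega>))"

definition holder_on :: "real \<Rightarrow> (real^'n) set \<Rightarrow> (real^'n \<Rightarrow> real) \<Rightarrow> bool" where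
  "holder_on \<beta> S f \<longleftrightarrow> (\<exists>C. \<forall>x\<in>S. \<forall>x'\<in>S. \<bar>f x - f x'\<bar> \<le> C * dist x x' powr \<beta>)"

definition std_normal_vec :: "'w measure \<Rightarrow> ('w \<Rightarrow> real^'s) \<Rightarrow> bool" where
  "std_normal_vec M Y \<longleftrightarrow>
     distributed M lborel Y (\<lambda>y. \<Prod>j\<in>UNIV. std_normal_density (y $ j))"

definition a_min :: "(real^'n) set \<Rightarrow> (real^'n \<Rightarrow> 'w \<Rightarrow> real) \<Rightarrow> 'w \<Rightarrow> real" where
  "a_min D Z \<omega> = (INF x\<in>closure D. exp (Z x \<omega>))"

definition a_max :: "(real^'n) set \<Rightarrow> (real^'n \<Rightarrow> 'w \<Rightarrow> real) \<Rightarrow> 'w \<Rightarrow> real" where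
  "a_max D Z \<omega> = (SUP x\<in>closure D. exp (Z x \<omega>))"

section \<open>Sampling on a uniform rectangular grid and multilinear interpolation\<close>

text \<open>The grid has corner \<open>p0\<close>, mesh widths \<open>h $ l\<close> and \<open>N l\<close> cells in direction \<open>l\<close>; its points
  are enumerated by \<open>pts\<close>, whose index type has as many elements as there are grid points.\<close>

definition grid_node :: "real^'n \<Rightarrow> real^'n \<Rightarrow> ('n \<Rightarrow> nat) \<Rightarrow> real^'n" where
  "grid_node p0 h k = (\<chi> l. p0 $ l + real (k l) * h $ l)"

definition uniform_grid ::
    "real^'n \<Rightarrow> real^'n \<Rightarrow> ('n \<Rightarrow> nat) \<Rightarrow> ('m::finite \<Rightarrow> real^'n) \<Rightarrow> bool" where
  "uniform_grid p0 h N pts \<longleftrightarrow> (\<forall>l. 0 < h $ l \<and> 1 \<le> N l) \<and>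
     bij_betw pts UNIV (grid_node p0 h ` {k. \<forall>l. k l \<le> N l})"

definition grid_box :: "real^'n \<Rightarrow> real^'n \<Rightarrow> ('n \<Rightarrow> nat) \<Rightarrow> (real^'n) set" where
  "grid_box p0 h N = cbox p0 (grid_node p0 h N)"

definition cell_index :: "real^'n \<Rightarrow> real^'n \<Rightarrow> ('n \<Rightarrow> nat) \<Rightarrow> real^'n \<Rightarrow> 'n \<Rightarrow> nat" where
  "cell_index p0 h N x l = min (nat \<lfloor>(x $ l - p0 $ l) / h $ l\<rfloor>) (N l - 1)"

text \<open>The \<open>2\<^sup>d\<close> vertices of a cell are indexed by sets \<open>e\<close> of coordinate directions: \<open>l \<in> e\<close> selects
  the upper end of the cell in direction \<open>l\<close>.\<close>

definition cell_vertex ::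
    "real^'n \<Rightarrow> real^'n \<Rightarrow> ('n \<Rightarrow> nat) \<Rightarrow> real^'n \<Rightarrow> 'n set \<Rightarrow> real^'n" where
  "cell_vertex p0 h N x e =
     grid_node p0 h (\<lambda>l. cell_index p0 h N x l + (if l \<in> e then 1 else 0))"

definition cell_weight ::
    "real^'n \<Rightarrow> real^'n \<Rightarrow> ('n \<Rightarrow> nat) \<Rightarrow> real^'n \<Rightarrow> 'n set \<Rightarrow> real" where
  "cell_weight p0 h N x e =
     (\<Prod>l\<in>UNIV. let t = (x $ l - p0 $ l) / h $ l - real (cell_index p0 h N x l)
               in if l \<in> e then t else 1 - t)"

definition multilinear_interp ::
    "real^'n \<Rightarrow> real^'n \<Rightarrow> ('n \<Rightarrow> nat) \<Rightarrow> ('m::finite \<Rightarrow> real^'n) \<Rightarrow> ('m \<Rightarrow> real) \<Rightarrow>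
     real^'n \<Rightarrow> real" where
  "multilinear_interp p0 h N pts f x =
     (\<Sum>e\<in>UNIV. cell_weight p0 h N x e * f (inv pts (cell_vertex p0 h N x e)))"

definition a_s ::
    "real^'n \<Rightarrow> real^'n \<Rightarrow> ('n \<Rightarrow> nat) \<Rightarrow> ('m::finite \<Rightarrow> real^'n) \<Rightarrow>
     real^'s^'m \<Rightarrow> real^'m \<Rightarrow> real^'s \<Rightarrow> real^'n \<Rightarrow> real" where
  "a_s p0 h N pts B Zbar y =
     multilinear_interp p0 h N pts (\<lambda>i. exp ((\<Sum>j\<in>UNIV. B $ i $ j * y $ j) + Zbar $ i))"

lemma cell_coord:
  assumes "uniform_grid p0 h N pts" "x \<in> grid_box p0 h N"
  shows "real (cell_index p0 h N x l) \<le> (x $ l - p0 $ l) / h $ l"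
    and "(x $ l - p0 $ l) / h $ l \<le> real (cell_index p0 h N x l) + 1"
    and "cell_index p0 h N x l + 1 \<le> N l"
proof -
  define X where "X = (x $ l - p0 $ l) / h $ l"
  have h: "0 < h $ l" and N: "1 \<le> N l" using assms(1) by (auto simp: uniform_grid_def)
  have "p0 $ l \<le> x $ l" "x $ l \<le> p0 $ l + real (N l) * h $ l"
    using assms(2) by (auto simp: grid_box_def grid_node_def mem_box_cart)
  then have X: "0 \<le> X" "X \<le> real (N l)" using h by (auto simp: X_def field_simps)
  have k: "cell_index p0 h N x l = min (nat \<lfloor>X\<rfloor>) (N l - 1)"
    by (simp add: cell_index_def X_def)
  have fl: "real (nat \<lfloor>X\<rfloor>) \<le> X" "X < real (nat \<lfloor>X\<rfloor>) + 1" using X by linarith+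
  show "real (cell_index p0 h N x l) \<le> (x $ l - p0 $ l) / h $ l"
    unfolding X_def[symmetric] k using fl by (auto simp: min_def)
  show "(x $ l - p0 $ l) / h $ l \<le> real (cell_index p0 h N x l) + 1"
    unfolding X_def[symmetric] k using fl X N by (auto simp: min_def of_nat_diff)
  show "cell_index p0 h N x l + 1 \<le> N l" unfolding k using N by auto
qed

lemma cell_weight_bounds:
  assumes "uniform_grid p0 h N pts" "x \<in> grid_box p0 h N"
  shows "0 \<le> cell_weight p0 h N x e" "cell_weight p0 h N x e \<le> 1"
proof -
  have "0 \<le> cell_weight p0 h N x e \<and> cell_weight p0 h N x e \<le> 1"
    unfolding cell_weight_def Let_def
    using cell_coord[OF assms] by (auto intro!: prod_nonneg prod_le_1 simp: algebra_simps)
  then show "0 \<le> cell_weight p0 h N x e" "cell_weight p0 h N x e \<le> 1" by auto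
qed

lemma cell_weight_sum: "(\<Sum>e\<in>UNIV. cell_weight p0 h N x e) = 1"
proof -
  define t where "t l = (x $ l - p0 $ l) / h $ l - real (cell_index p0 h N x l)" for l
  have "cell_weight p0 h N x e = prod t e * prod (\<lambda>l. 1 - t l) (UNIV - e)" for e
  proof -
    have "cell_weight p0 h N x e = (\<Prod>l\<in>UNIV. if l \<in> e then t l else 1 - t l)"
      unfolding cell_weight_def t_def Let_def ..
    also have "\<dots> = prod t e * prod (\<lambda>l. 1 - t l) (UNIV - e)"
      by (subst prod.If_cases) (auto simp: Compl_eq_Diff_UNIV)
    finally show ?thesis .
  qed
  then have "(\<Sum>e\<in>UNIV. cell_weight p0 h N x e)
      = (\<Sum>e\<in>Pow UNIV. prod t e * prod (\<lambda>l. 1 - t l) (UNIV - e))" by simp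
  also have "\<dots> = (\<Prod>l\<in>UNIV. t l + (1 - t l))" by (rule prod_add[symmetric]) simp
  finally show ?thesis by simp
qed

lemma cell_vertex_in_range:
  assumes "uniform_grid p0 h N pts" "x \<in> grid_box p0 h N"
  shows "cell_vertex p0 h N x e \<in> range pts"
proof -
  have "cell_vertex p0 h N x e \<in> grid_node p0 h ` {k. \<forall>l. k l \<le> N l}"
    unfolding cell_vertex_def using cell_coord(3)[OF assms]
    by (intro imageI) (auto simp: Suc_leD)
  then show ?thesis using assms(1) by (auto simp: uniform_grid_def bij_betw_def)
qed

text \<open>The values of the interpolated coefficient lie between the extrema of the random field
  whenever the vertices of the cell lie in \<open>closure D\<close>. For cells that meet the boundary
  of a general \<open>D\<close> this need not be the case, so there the bounds are a separate assumption.\<close>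

lemma a_s_bounds:
  assumes grid: "uniform_grid p0 h N pts" and x: "x \<in> grid_box p0 h N"
    and D: "bounded D"
    and cont: "continuous_on (closure D) (\<lambda>x. Z x \<omega>)"
    and real: "\<forall>i. Z (pts i) \<omega> = (B *v y + Zbar) $ i"
    and vert: "\<forall>e. cell_vertex p0 h N x e \<in> closure D"
  shows "a_min D Z \<omega> \<le> a_s p0 h N pts B Zbar y x"
    and "a_s p0 h N pts B Zbar y x \<le> a_max D Z \<omega>"
proof -
  let ?w = "cell_weight p0 h N x" and ?v = "cell_vertex p0 h N x"
  have "compact ((\<lambda>x. exp (Z x \<omega>)) ` closure D)"
    using D by (intro compact_continuous_image continuous_intros cont) (simp add: compact_closure)
  then have bdd: "bdd_below ((\<lambda>x. exp (Z x \<omega>)) ` closure D)" "bdd_above ((\<lambda>x. exp (Z x \<omega>)) ` closure D)"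
    by (auto intro: bounded_imp_bdd_below bounded_imp_bdd_above compact_imp_bounded)
  have mm: "a_min D Z \<omega> \<le> exp (Z (?v e) \<omega>)" "exp (Z (?v e) \<omega>) \<le> a_max D Z \<omega>" for e
    unfolding a_min_def a_max_def using vert bdd by (auto intro: cINF_lower cSUP_upper)
  have pt: "pts (inv pts (?v e)) = ?v e" for e
    by (rule f_inv_into_f[OF cell_vertex_in_range[OF grid x]])
  have node: "exp ((\<Sum>j\<in>UNIV. B $ i $ j * y $ j) + Zbar $ i) = exp (Z (pts i) \<omega>)" for i
    using real by (simp add: matrix_vector_mult_def)
  have as: "a_s p0 h N pts B Zbar y x = (\<Sum>e\<in>UNIV. ?w e * exp (Z (?v e) \<omega>))"
    unfolding a_s_def multilinear_interp_def node pt ..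
  have "a_min D Z \<omega> = (\<Sum>e\<in>UNIV. ?w e * a_min D Z \<omega>)"
    unfolding sum_distrib_right[symmetric] cell_weight_sum by simp
  also have "\<dots> \<le> (\<Sum>e\<in>UNIV. ?w e * exp (Z (?v e) \<omega>))"
    by (intro sum_mono mult_left_mono mm cell_weight_bounds[OF grid x])
  finally show "a_min D Z \<omega> \<le> a_s p0 h N pts B Zbar y x" unfolding as .
  have "(\<Sum>e\<in>UNIV. ?w e * exp (Z (?v e) \<omega>)) \<le> (\<Sum>e\<in>UNIV. ?w e * a_max D Z \<omega>)"
    by (intro sum_mono mult_left_mono mm cell_weight_bounds[OF grid x])
  also have "\<dots> = a_max D Z \<omega>"
    unfolding sum_distrib_right[symmetric] cell_weight_sum by simp
  finally show "a_s p0 h N pts B Zbar y x \<le> a_max D Z \<omega>" unfolding as .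
qed

definition covariance_matrix ::
    "'w measure \<Rightarrow> ('m::finite \<Rightarrow> real^'n) \<Rightarrow> (real^'n \<Rightarrow> 'w \<Rightarrow> real) \<Rightarrow> real^'m^'m" where
  "covariance_matrix M pts Z =
     (\<chi> i k. \<integral>\<omega>. (Z (pts i) \<omega> - (\<integral>\<omega>'. Z (pts i) \<omega>' \<partial>M)) *
                  (Z (pts k) \<omega> - (\<integral>\<omega>'. Z (pts k) \<omega>' \<partial>M)) \<partial>M)"

definition b_vec :: "real^'s^'m::finite \<Rightarrow> 's::finite \<Rightarrow> real" where
  "b_vec B j = Max (range (\<lambda>i. \<bar>B $ i $ j\<bar>))"

definition C_q :: "real \<Rightarrow> real \<Rightarrow> real \<Rightarrow> real" where
  "C_q c1 c2 amin = max 1 (c1 * c2 / amin)"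

end

theory Submission
  imports Defs "HOL-Library.Function_Algebras"
begin

text \<open>
  The interpolated coefficient is a finite sum of node weights times exponentials of affine functions
  of \<open>y\<close>, so that the problem is governed by finitely many positive semidefinite
  forms on \<open>H\<^sub>0\<^sup>1(D)\<close> with log-affine weights. The solution map is differentiated
  implicitly: the \<open>\<nu>\<close>-th derivative solves the same elliptic problem with the lower order terms
  of the Leibniz rule on the right-hand side. Since \<open>\<partial>\<^sup>\<mu>a\<close> is
  dominated pointwise by \<open>b\<^sup>\<mu> a\<close>, testing with the derivative itself gives in the energy norm
  \<open>\<parallel>\<partial>\<^sup>\<nu>u\<parallel> \<le> \<Sum>\<^bsub>\<mu> < \<nu>\<^esub> (\<nu> choose \<mu>) b\<^bsup>\<nu>-\<mu>\<^esup> \<parallel>\<partial>\<^sup>\<mu>u\<parallel>\<close>, a recursion for the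
  ordered Bell numbers, which are at most \<open>n! / (ln 2)\<^sup>n\<close> because \<open>exp (ln 2) - 1 = 1\<close>.
  The adjoint state satisfies the same recursion with the derivative of the state as an extra source.
\<close>

section \<open>Weighted energy forms\<close>

text \<open>Elements of \<open>H01 D\<close> are functions, not almost everywhere classes, so the
  energy norm is only a seminorm: solutions, limits and derivatives are determined up to seminorm
  zero. Existence and uniqueness are therefore kept apart. One family of derivatives is built
  recursively from the Leibniz equations and estimated; since \<open>H01_pderiv\<close> is an
  arbitrary choice among all admissible families, the estimate is transferred to it by showing that
  any two families have equal norms.

  The lower bound \<open>a_min D Z \<omega>\<close> is known only at the single parameter
  \<open>y\<close>. Differentiability at every parameter rests instead on the positivity of the
  finitely many nodal exponentials. Working in the energy norm keeps any ratio of upper to lower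
  coefficient bounds out of the recursion: the reciprocal of \<open>am\<close> comes from two
  factors \<open>1 / sqrt am\<close>, one when the source is measured in the energy norm, one when
  the energy norm is converted back to the gradient norm.\<close>

lemma quadratic_nonneg_imp_square_le:
  fixes a b c :: real
  assumes q: "\<And>t. 0 \<le> a - 2 * t * b + t\<^sup>2 * c" and c: "0 \<le> c"
  shows "b\<^sup>2 \<le> a * c"
\<comment> \<open>\<open>c = 0\<close> is a genuine case, as the forms are only semidefinite. The
  polynomial is then affine, and a point where it takes the value \<open>- 1\<close> would exist
  unless its slope vanishes.\<close>
proof (cases "c = 0")
  case True
  have "b = 0"
  proof (rule ccontr)
    assume "b \<noteq> 0"
    have "0 \<le> a - 2 * ((a + 1) / (2 * b)) * b" using q[of "(a + 1) / (2 * b)"] True by simp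
    also have "\<dots> = - 1" using \<open>b \<noteq> 0\<close> by (simp add: field_simps)
    finally show False by simp
  qed
  then show ?thesis using True by simp
next
  case False
  then have "0 < c" using c by simp
  have "0 \<le> (a - 2 * (b / c) * b + (b / c)\<^sup>2 * c) * c"
    using q[of "b / c"] \<open>0 < c\<close> by (intro mult_nonneg_nonneg) auto
  also have "\<dots> = a * c - b\<^sup>2"
    using False by (simp add: field_simps power2_eq_square)
  finally show ?thesis by simp
qed

text \<open>This yields the Euler equation of a minimiser: for small \<open>t\<close> of the right
  sign a nonzero linear term would win. Since \<open>b\<close> has no prescribed sign, the test
  value \<open>- a / c\<close> uses \<open>c = \<bar>b\<bar> + 1\<close>, which is positive and at
  least \<open>b\<close>.\<close>

lemma linear_le_quadratic_imp_zero:
  fixes a b :: real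
  assumes "\<And>t. 0 \<le> 2 * t * a + t\<^sup>2 * b"
  shows "a = 0"
proof (rule ccontr)
  assume a: "a \<noteq> 0"
  define c where "c = \<bar>b\<bar> + 1"
  have "0 \<le> 2 * (- a / c) * a + (- a / c)\<^sup>2 * b" by (rule assms)
  also have "\<dots> \<le> 2 * (- a / c) * a + (- a / c)\<^sup>2 * c"
    unfolding c_def by (intro add_left_mono mult_left_mono) auto
  also have "\<dots> = - (a\<^sup>2 / c)" 
  proof -
    have "0 < c" by (simp add: c_def)
    then show ?thesis by (simp add: power2_eq_square field_simps)
  qed
  also have "\<dots> < 0" using a c_def by simp
  finally show False by simp
qed

text \<open>Stated outside the locale because the completeness axiom of \<open>energy_space\<close>
  already refers to it.\<close>

definition energy_norm :: "('m::finite \<Rightarrow> 'v \<Rightarrow> 'v \<Rightarrow> real) \<Rightarrow> 'v \<Rightarrow> real" where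
  "energy_norm E v = sqrt (\<Sum>i\<in>UNIV. E i v v)"

text \<open>There is one form per grid node, and coefficients are supplied separately, so that
  varying the parameter changes finitely many numbers and not the space. The forms are only
  semidefinite: each may degenerate where its nodal weight vanishes, and functions equal almost
  everywhere are at distance zero. All axioms are restricted to the carrier
  \<open>V\<close>.\<close>

locale energy_space =
  fixes V :: "'v::real_vector set" and E :: "'m::finite \<Rightarrow> 'v \<Rightarrow> 'v \<Rightarrow> real"
  assumes subspace: "subspace V"
    and E_add: "\<lbrakk>u \<in> V; v \<in> V; w \<in> V\<rbrakk> \<Longrightarrow> E i (u + v) w = E i u w + E i v w"
    and E_scale: "\<lbrakk>u \<in> V; w \<in> V\<rbrakk> \<Longrightarrow> E i (c *\<^sub>R u) w = c * E i u w"
    and E_sym: "\<lbrakk>u \<in> V; v \<in> V\<rbrakk> \<Longrightarrow> E i u v = E i v u"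
    and E_nonneg: "u \<in> V \<Longrightarrow> 0 \<le> E i u u"
    and complete: "\<lbrakk>\<And>k. f k \<in> V;
        \<And>e. 0 < e \<Longrightarrow> \<exists>K. \<forall>m\<ge>K. \<forall>n\<ge>K. energy_norm E (f m - f n) < e\<rbrakk>
      \<Longrightarrow> \<exists>l\<in>V. (\<lambda>k. energy_norm E (f k - l)) \<longlonglongrightarrow> 0"
begin

abbreviation nrm :: "'v \<Rightarrow> real" where "nrm \<equiv> energy_norm E"

definition wform :: "('m \<Rightarrow> real) \<Rightarrow> 'v \<Rightarrow> 'v \<Rightarrow> real" where
  "wform e u v = (\<Sum>i\<in>UNIV. e i * E i u v)"

definition wnorm :: "('m \<Rightarrow> real) \<Rightarrow> 'v \<Rightarrow> real" where
  "wnorm e v = sqrt (wform e v v)"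

lemmas V_closed = subspace_add[OF subspace] subspace_diff[OF subspace] subspace_scale[OF subspace]
  subspace_0[OF subspace] subspace_sum[OF subspace]

lemma E_diff: "\<lbrakk>u \<in> V; v \<in> V; w \<in> V\<rbrakk> \<Longrightarrow> E i (u - v) w = E i u w - E i v w"
  using E_add[of "u - v" v w i] by (simp add: V_closed)

lemma E_add': "\<lbrakk>u \<in> V; v \<in> V; w \<in> V\<rbrakk> \<Longrightarrow> E i w (u + v) = E i w u + E i w v"
  by (simp add: E_sym[of w] V_closed E_add)

lemma E_diff': "\<lbrakk>u \<in> V; v \<in> V; w \<in> V\<rbrakk> \<Longrightarrow> E i w (u - v) = E i w u - E i w v"
  by (simp add: E_sym[of w] V_closed E_diff)

lemma E_scale': "\<lbrakk>u \<in> V; w \<in> V\<rbrakk> \<Longrightarrow> E i w (c *\<^sub>R u) = c * E i w u"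
  by (simp add: E_sym[of w] V_closed E_scale)

lemmas E_bilin = E_add E_diff E_scale E_add' E_diff' E_scale'

lemma wform_additive:
  assumes "u \<in> V" "v \<in> V" "w \<in> V"
  shows "wform e (u + v) w = wform e u w + wform e v w"
    "wform e (u - v) w = wform e u w - wform e v w"
    "wform e w (u + v) = wform e w u + wform e w v"
    "wform e w (u - v) = wform e w u - wform e w v"
  using assms by (simp_all add: wform_def E_bilin distrib_left right_diff_distrib sum.distrib
      sum_subtractf)

lemma wform_scale:
  assumes "u \<in> V" "w \<in> V"
  shows "wform e (c *\<^sub>R u) w = c * wform e u w" "wform e w (c *\<^sub>R u) = c * wform e w u"
  using assms by (simp_all add: wform_def E_bilin sum_distrib_left mult.left_commute)

lemmas wform_bilin = wform_additive wform_scale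

lemma wform_sym: "\<lbrakk>u \<in> V; v \<in> V\<rbrakk> \<Longrightarrow> wform e u v = wform e v u"
  by (simp add: wform_def E_sym)

lemma wform_nonneg: "\<lbrakk>\<And>i. 0 \<le> e i; u \<in> V\<rbrakk> \<Longrightarrow> 0 \<le> wform e u u"
  unfolding wform_def by (intro sum_nonneg mult_nonneg_nonneg E_nonneg)

lemma nrm_eq: "nrm v = wnorm (\<lambda>_. 1) v"
  by (simp add: energy_norm_def wnorm_def wform_def)

lemma wnorm_nonneg: "\<lbrakk>\<And>i. 0 \<le> e i; u \<in> V\<rbrakk> \<Longrightarrow> 0 \<le> wnorm e u"
  by (simp add: wnorm_def wform_nonneg)

lemma nrm_nonneg: "u \<in> V \<Longrightarrow> 0 \<le> nrm u"
  by (simp add: nrm_eq wnorm_nonneg)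

lemma wnorm_square: "\<lbrakk>\<And>i. 0 \<le> e i; u \<in> V\<rbrakk> \<Longrightarrow> (wnorm e u)\<^sup>2 = wform e u u"
  by (simp add: wnorm_def wform_nonneg)

lemma E_Cauchy_Schwarz:
  assumes u: "u \<in> V" and v: "v \<in> V"
  shows "\<bar>E i u v\<bar> \<le> sqrt (E i u u) * sqrt (E i v v)"
proof -
  define a b c where "a = E i u u" and "b = E i u v" and "c = E i v v"
  have q: "0 \<le> a - 2 * t * b + t\<^sup>2 * c" for t
  proof -
    have "0 \<le> E i (u - t *\<^sub>R v) (u - t *\<^sub>R v)"
      using u v by (intro E_nonneg V_closed)
    also have "\<dots> = a - 2 * t * b + t\<^sup>2 * c"
      using u v by (simp add: E_bilin V_closed E_sym[OF v u] a_def b_def c_def algebra_simps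
          power2_eq_square)
    finally show ?thesis .
  qed
  have a0: "0 \<le> a" "0 \<le> c" by (simp_all add: a_def c_def E_nonneg u v)
  have "b\<^sup>2 \<le> a * c"
    by (rule quadratic_nonneg_imp_square_le[OF q a0(2)])
  then have "sqrt (b\<^sup>2) \<le> sqrt (a * c)" by (rule real_sqrt_le_mono)
  then show ?thesis by (simp add: real_sqrt_mult a_def b_def c_def)
qed

text \<open>Cauchy-Schwarz for each form, then for the sum over \<open>i\<close>. The factors
  \<open>c i\<close> may have any sign and are pulled out by their common bound, while the weights
  \<open>e i\<close> stay inside both norms; a coefficient derivative thus costs the factor
  \<open>C\<close> without any comparison of the largest and smallest weight.\<close>

lemma wform_bound:
  assumes e: "\<And>i. 0 \<le> e i" and c: "\<And>i. \<bar>c i\<bar> \<le> C" and u: "u \<in> V" and v: "v \<in> V"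
  shows "\<bar>\<Sum>i\<in>UNIV. c i * (e i * E i u v)\<bar> \<le> C * (wnorm e u * wnorm e v)"
proof -
  have C: "0 \<le> C" using c[of undefined] by linarith
  have "\<bar>\<Sum>i\<in>UNIV. c i * (e i * E i u v)\<bar> \<le> (\<Sum>i\<in>UNIV. \<bar>c i * (e i * E i u v)\<bar>)"
    by (rule sum_abs)
  also have "\<dots> \<le> (\<Sum>i\<in>UNIV. C * (\<bar>sqrt (e i * E i u u)\<bar> * \<bar>sqrt (e i * E i v v)\<bar>))"
  proof (rule sum_mono)
    fix i
    have "\<bar>c i * (e i * E i u v)\<bar> = \<bar>c i\<bar> * (e i * \<bar>E i u v\<bar>)"
      by (simp add: abs_mult e)
    also have "\<dots> \<le> C * (e i * (sqrt (E i u u) * sqrt (E i v v)))"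
      by (intro mult_mono c mult_left_mono E_Cauchy_Schwarz u v e C mult_nonneg_nonneg) auto
    also have "e i * (sqrt (E i u u) * sqrt (E i v v)) = sqrt (e i * E i u u) * sqrt (e i * E i v v)"
      using e[of i] by (simp add: real_sqrt_mult)
    finally show "\<bar>c i * (e i * E i u v)\<bar> \<le> C * (\<bar>sqrt (e i * E i u u)\<bar> * \<bar>sqrt (e i * E i v v)\<bar>)"
      using E_nonneg[OF u, of i] E_nonneg[OF v, of i] e[of i] by simp
  qed
  also have "\<dots> = C * (\<Sum>i\<in>UNIV. \<bar>sqrt (e i * E i u u)\<bar> * \<bar>sqrt (e i * E i v v)\<bar>)"
    by (simp add: sum_distrib_left)
  also have "\<dots> \<le> C * (L2_set (\<lambda>i. sqrt (e i * E i u u)) UNIV * L2_set (\<lambda>i. sqrt (e i * E i v v)) UNIV)"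
    by (intro mult_left_mono L2_set_mult_ineq C)
  also have "\<dots> = C * (wnorm e u * wnorm e v)"
    using E_nonneg[OF u] E_nonneg[OF v] e by (simp add: L2_set_def wnorm_def wform_def)
  finally show ?thesis .
qed

lemma wform_Cauchy_Schwarz:
  assumes "\<And>i. 0 \<le> e i" "u \<in> V" "v \<in> V"
  shows "\<bar>wform e u v\<bar> \<le> wnorm e u * wnorm e v"
  using wform_bound[where c = "\<lambda>_. 1" and C = 1, of e u v] assms by (simp add: wform_def)

lemma E_le_nrm:
  assumes "u \<in> V" "v \<in> V"
  shows "\<bar>E i u v\<bar> \<le> nrm u * nrm v"
proof -
  have "E i w w \<le> (\<Sum>i\<in>UNIV. E i w w)" if "w \<in> V" for w
    using that by (intro member_le_sum E_nonneg) auto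
  then have *: "sqrt (E i w w) \<le> nrm w" if "w \<in> V" for w
    using that by (simp add: energy_norm_def)
  have "\<bar>E i u v\<bar> \<le> sqrt (E i u u) * sqrt (E i v v)" by (rule E_Cauchy_Schwarz[OF assms])
  also have "\<dots> \<le> nrm u * nrm v"
    using assms by (intro mult_mono * nrm_nonneg) (auto simp: E_nonneg)
  finally show ?thesis .
qed

lemma nrm_scale: "v \<in> V \<Longrightarrow> nrm (c *\<^sub>R v) = \<bar>c\<bar> * nrm v"
  by (simp add: nrm_eq wnorm_def wform_bilin V_closed real_sqrt_mult flip: mult.assoc power2_eq_square)

lemma nrm_triangle:
  assumes "u \<in> V" "v \<in> V"
  shows "nrm (u + v) \<le> nrm u + nrm v"
proof -
  let ?e = "\<lambda>_. 1 :: real"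
  have "(nrm (u + v))\<^sup>2 = (nrm u)\<^sup>2 + 2 * wform ?e u v + (nrm v)\<^sup>2"
    using assms by (simp add: nrm_eq wnorm_square V_closed wform_bilin wform_sym[of v u])
  also have "\<dots> \<le> (nrm u)\<^sup>2 + 2 * (nrm u * nrm v) + (nrm v)\<^sup>2"
    using wform_Cauchy_Schwarz[of ?e u v] assms by (simp add: nrm_eq)
  also have "\<dots> = (nrm u + nrm v)\<^sup>2" by (simp add: power2_sum)
  finally show ?thesis
    using assms by (rule_tac power2_le_imp_le) (auto simp: nrm_nonneg)
qed

lemma nrm_triangle_diff:
  assumes "u \<in> V" "v \<in> V"
  shows "nrm (u - v) \<le> nrm u + nrm v"
  using nrm_triangle[of u "(-1) *\<^sub>R v"] nrm_scale[of v "-1"] assms V_closed(3)[of v "-1"] by simp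

lemma coercive:
  assumes "\<And>i. \<alpha> \<le> e i" "v \<in> V"
  shows "\<alpha> * (nrm v)\<^sup>2 \<le> wform e v v"
proof -
  have "\<alpha> * (nrm v)\<^sup>2 = (\<Sum>i\<in>UNIV. \<alpha> * E i v v)"
    using assms by (simp add: energy_norm_def sum_nonneg E_nonneg sum_distrib_left)
  also have "\<dots> \<le> wform e v v"
    unfolding wform_def using assms by (intro sum_mono mult_right_mono E_nonneg)
  finally show ?thesis .
qed

section \<open>Bounded functionals and the weighted variational problem\<close>

definition bounded_functional :: "('v \<Rightarrow> real) \<Rightarrow> bool" where
  "bounded_functional F \<longleftrightarrow> (\<forall>u\<in>V. \<forall>v\<in>V. F (u + v) = F u + F v) \<and> (\<forall>u\<in>V. \<forall>c. F (c *\<^sub>R u) = c * F u) \<and>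
     (\<exists>K\<ge>0. \<forall>v\<in>V. \<bar>F v\<bar> \<le> K * nrm v)"

lemma bounded_functionalI:
  assumes "\<And>u v. \<lbrakk>u \<in> V; v \<in> V\<rbrakk> \<Longrightarrow> F (u + v) = F u + F v"
    and "\<And>u c. u \<in> V \<Longrightarrow> F (c *\<^sub>R u) = c * F u"
    and K: "\<And>v. v \<in> V \<Longrightarrow> \<bar>F v\<bar> \<le> K * nrm v"
  shows "bounded_functional F"
proof -
  have "\<bar>F v\<bar> \<le> \<bar>K\<bar> * nrm v" if "v \<in> V" for v
    using K[OF that] mult_right_mono[OF abs_ge_self[of K] nrm_nonneg[OF that]] by linarith
  then show ?thesis unfolding bounded_functional_def using assms(1,2) by (meson abs_ge_zero)
qed

lemma bounded_functional_E: "u \<in> V \<Longrightarrow> bounded_functional (\<lambda>v. E i u v)"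
  by (rule bounded_functionalI[where K = "nrm u"]) (auto simp: E_bilin E_le_nrm)

lemma bounded_functional_0: "bounded_functional (\<lambda>v. 0)"
  by (rule bounded_functionalI[where K = 0]) auto

lemma bounded_functional_add:
  assumes "bounded_functional F" "bounded_functional G"
  shows "bounded_functional (\<lambda>v. F v + G v)"
proof -
  obtain K L where K: "\<forall>v\<in>V. \<bar>F v\<bar> \<le> K * nrm v" and L: "\<forall>v\<in>V. \<bar>G v\<bar> \<le> L * nrm v"
    using assms unfolding bounded_functional_def by blast
  show ?thesis
  proof (rule bounded_functionalI[where K = "K + L"])
    fix v assume "v \<in> V"
    then show "\<bar>F v + G v\<bar> \<le> (K + L) * nrm v"
      using K L abs_triangle_ineq[of "F v" "G v"] by (fastforce simp: distrib_right)
  qed (use assms in \<open>auto simp: bounded_functional_def algebra_simps\<close>)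
qed

lemma bounded_functional_cmult:
  assumes "bounded_functional F"
  shows "bounded_functional (\<lambda>v. c * F v)"
proof -
  obtain K where K: "\<forall>v\<in>V. \<bar>F v\<bar> \<le> K * nrm v"
    using assms unfolding bounded_functional_def by blast
  show ?thesis
  proof (rule bounded_functionalI[where K = "\<bar>c\<bar> * K"])
    fix v assume "v \<in> V"
    then show "\<bar>c * F v\<bar> \<le> \<bar>c\<bar> * K * nrm v"
      using K by (simp add: abs_mult mult.assoc mult_left_mono)
  qed (use assms in \<open>auto simp: bounded_functional_def algebra_simps\<close>)
qed

lemma bounded_functional_diff:
  assumes "bounded_functional F" "bounded_functional G"
  shows "bounded_functional (\<lambda>v. F v - G v)"
  using bounded_functional_add[OF assms(1) bounded_functional_cmult[OF assms(2), of "-1"]] by simp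

lemma bounded_functional_sum:
  assumes "finite I" "\<And>i. i \<in> I \<Longrightarrow> bounded_functional (F i)"
  shows "bounded_functional (\<lambda>v. \<Sum>i\<in>I. F i v)"
  using assms by (induction I) (auto intro: bounded_functional_0 bounded_functional_add)

lemma nrm_convergence_bounded_functional:
  assumes F: "bounded_functional F" and f: "\<And>k. f k \<in> V" "l \<in> V" and lim: "(\<lambda>k. nrm (f k - l)) \<longlonglongrightarrow> 0"
  shows "(\<lambda>k. F (f k)) \<longlonglongrightarrow> F l"
proof -
  obtain K where K: "\<forall>v\<in>V. \<bar>F v\<bar> \<le> K * nrm v" using F unfolding bounded_functional_def by blast
  have "\<bar>F (f k) - F l\<bar> \<le> K * nrm (f k - l)" for k
  proof -
    have "F (f k) = F (f k - l) + F l"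
      using F f V_closed(2)[OF f(1) f(2)] unfolding bounded_functional_def by (metis diff_add_cancel)
    then show ?thesis using K f V_closed(2)[OF f(1) f(2)] by auto
  qed
  moreover have "(\<lambda>k. K * nrm (f k - l)) \<longlonglongrightarrow> 0" using tendsto_mult_right_zero[OF lim] .
  ultimately have "(\<lambda>k. F (f k) - F l) \<longlonglongrightarrow> 0"
    by (rule_tac Lim_null_comparison[where g = "\<lambda>k. K * nrm (f k - l)"]) auto
  then show ?thesis by (simp add: LIM_zero_cancel)
qed

text \<open>Riesz representation: the minimiser of \<open>wform e v v - 2 F v\<close>; minimising sequences are
  Cauchy by the parallelogram law.\<close>

lemma solve_exists:
  assumes e: "\<And>i. 0 < e i" and F: "bounded_functional F"
  shows "\<exists>x\<in>V. \<forall>v\<in>V. wform e x v = F v"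
proof -
  define \<alpha> where "\<alpha> = Min (range e)"
  have \<alpha>: "0 < \<alpha>" "\<And>i. \<alpha> \<le> e i" using e by (auto simp: \<alpha>_def)
  obtain K where K: "\<And>v. v \<in> V \<Longrightarrow> \<bar>F v\<bar> \<le> K * nrm v" using F unfolding bounded_functional_def by blast
  have Fadd: "\<And>u v. \<lbrakk>u \<in> V; v \<in> V\<rbrakk> \<Longrightarrow> F (u + v) = F u + F v"
    and Fscale: "\<And>u c. u \<in> V \<Longrightarrow> F (c *\<^sub>R u) = c * F u"
    using F unfolding bounded_functional_def by auto
  define J where "J v = wform e v v - 2 * F v" for v
  have bdd: "bdd_below (J ` V)"
  proof (rule bdd_belowI2)
    fix v assume v: "v \<in> V"
    \<comment> \<open>Completing the square in \<open>nrm v\<close> bounds \<open>J\<close> from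
      below.\<close>
    have "0 \<le> (\<alpha> * nrm v - K)\<^sup>2" by simp
    then have "- (K\<^sup>2 / \<alpha>) \<le> \<alpha> * (nrm v)\<^sup>2 - 2 * (K * nrm v)"
      using \<alpha> by (simp add: power2_diff field_simps power2_eq_square)
    also have "\<dots> \<le> J v" unfolding J_def using coercive[of \<alpha> e, OF \<alpha>(2) v] K[OF v] by linarith
    finally show "- (K\<^sup>2 / \<alpha>) \<le> J v" .
  qed
  define I where "I = (INF v\<in>V. J v)"
  have I: "I \<le> J v" if "v \<in> V" for v unfolding I_def using bdd that by (rule cINF_lower)
  have "\<exists>v\<in>V. J v < I + 1 / Suc k" for k
    using cINF_less_iff[OF _ bdd, of "I + 1 / Suc k"] V_closed(4) unfolding I_def by auto
  then obtain f where f: "\<And>k. f k \<in> V" "\<And>k. J (f k) < I + 1 / Suc k" by metis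
  have par: "\<alpha> * (nrm (f m - f n))\<^sup>2 \<le> 2 / Suc m + 2 / Suc n" for m n
  proof -
    let ?h = "(1/2) *\<^sub>R (f m + f n)"
    have "\<alpha> * (nrm (f m - f n))\<^sup>2 \<le> wform e (f m - f n) (f m - f n)"
      by (intro coercive \<alpha> V_closed f)
    \<comment> \<open>Parallelogram identity at the midpoint \<open>?h\<close>: the linear part of
      \<open>J\<close> cancels, and \<open>I\<close> bounds \<open>J ?h\<close> from below.\<close>
    also have "\<dots> = 2 * J (f m) + 2 * J (f n) - 4 * J ?h"
    proof -
      have "J ?h = (wform e (f m) (f m) + wform e (f m) (f n) + wform e (f n) (f m) + wform e (f n) (f n)) / 4
          - (F (f m) + F (f n))"
        unfolding J_def using f(1)
        by (simp add: wform_bilin V_closed Fadd Fscale add_divide_distrib del: scaleR_add_right)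
      moreover have "wform e (f m - f n) (f m - f n)
          = wform e (f m) (f m) - wform e (f m) (f n) - wform e (f n) (f m) + wform e (f n) (f n)"
        using f(1) by (simp add: wform_bilin V_closed)
      ultimately show ?thesis unfolding J_def by argo
    qed
    also have "\<dots> \<le> 2 * (I + 1 / Suc m) + 2 * (I + 1 / Suc n) - 4 * I"
      using f(2)[of m] f(2)[of n] I[of ?h] f(1) by (simp add: V_closed)
    finally show ?thesis by simp
  qed
  have "\<exists>l\<in>V. (\<lambda>k. nrm (f k - l)) \<longlonglongrightarrow> 0"
  proof (rule complete[OF f(1)])
    fix \<epsilon> :: real assume "0 < \<epsilon>"
    obtain N :: nat where N1: "4 / (\<alpha> * \<epsilon>\<^sup>2) < real N" using reals_Archimedean2 by blast
    have "0 < 4 / (\<alpha> * \<epsilon>\<^sup>2)" using \<alpha> \<open>0 < \<epsilon>\<close> by simp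
    then have "0 < real N" using N1 by (rule less_trans)
    then have N: "4 / (\<alpha> * \<epsilon>\<^sup>2) < real N" "N \<noteq> 0" using N1 by auto
    show "\<exists>K. \<forall>m\<ge>K. \<forall>n\<ge>K. nrm (f m - f n) < \<epsilon>"
    proof (intro exI allI impI)
      fix m n assume mn: "N \<le> m" "N \<le> n"
      have "2 / real (Suc m) \<le> 2 / N" "2 / real (Suc n) \<le> 2 / N"
        using mn N(2) by (auto intro!: divide_left_mono)
      then have "\<alpha> * (nrm (f m - f n))\<^sup>2 \<le> 4 / N" using par[of m n] by linarith
      also have "\<dots> < \<alpha> * \<epsilon>\<^sup>2" using N \<alpha> \<open>0 < \<epsilon>\<close> by (simp add: field_simps)
      finally have "(nrm (f m - f n))\<^sup>2 < \<epsilon>\<^sup>2" using \<alpha> by simp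
      then show "nrm (f m - f n) < \<epsilon>" using \<open>0 < \<epsilon>\<close> by (simp add: power2_less_imp_less)
    qed
  qed
  then obtain l where l: "l \<in> V" "(\<lambda>k. nrm (f k - l)) \<longlonglongrightarrow> 0" by blast
  have "wform e l v = F v" if v: "v \<in> V" for v
  proof -
    have lim: "(\<lambda>k. wform e (f k) v) \<longlonglongrightarrow> wform e l v"
    proof -
      have "bounded_functional (\<lambda>u. \<Sum>i\<in>UNIV. e i * E i v u)"
        using v by (intro bounded_functional_sum bounded_functional_cmult bounded_functional_E) auto
      from nrm_convergence_bounded_functional[OF this f(1) l]
      show ?thesis using f(1) l(1) v by (simp add: wform_sym[of _ v] flip: wform_def)
    qed
    \<comment> \<open>Near-minimality of \<open>f k\<close> gives this inequality up to an error
      \<open>1 / Suc k\<close>; convergence of \<open>wform e (f k) v\<close> removes the error in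
      the limit.\<close>
    have "0 \<le> 2 * t * (wform e l v - F v) + t\<^sup>2 * wform e v v" for t
    proof (rule LIMSEQ_le[OF _ _ exI[of _ 0]])
      show "(\<lambda>k. - (1 / real (Suc k))) \<longlonglongrightarrow> 0"
        using tendsto_minus[OF LIMSEQ_Suc[OF lim_1_over_n]] by simp
      show "(\<lambda>k. 2 * t * (wform e (f k) v - F v) + t\<^sup>2 * wform e v v) \<longlonglongrightarrow>
            2 * t * (wform e l v - F v) + t\<^sup>2 * wform e v v"
        by (intro tendsto_intros lim)
      show "\<forall>k\<ge>0. - (1 / real (Suc k)) \<le> 2 * t * (wform e (f k) v - F v) + t\<^sup>2 * wform e v v"
      proof (intro allI impI)
        fix k :: nat
        have "I \<le> J (f k + t *\<^sub>R v)" using f v by (intro I V_closed)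
        also have "\<dots> = J (f k) + (2 * t * (wform e (f k) v - F v) + t\<^sup>2 * wform e v v)"
          using f(1) v by (simp add: J_def wform_bilin V_closed Fadd Fscale wform_sym[OF v f(1)]
              distrib_left right_diff_distrib power2_eq_square)
        finally show "- (1 / real (Suc k)) \<le> 2 * t * (wform e (f k) v - F v) + t\<^sup>2 * wform e v v"
          using f(2)[of k] by linarith
      qed
    qed
    then have "wform e l v - F v = 0" by (rule linear_le_quadratic_imp_zero)
    then show ?thesis by simp
  qed
  then show ?thesis using l(1) by blast
qed


subsection \<open>Differentiation along a line\<close>

text \<open>The base point is fixed at \<open>0\<close>; partial derivatives at \<open>y\<close>
  come from the line \<open>y + t *\<^sub>R axis j 1\<close>. Convergence is in the seminorm, so
  \<open>x'\<close> need not be unique.\<close>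

definition has_vderiv :: "(real \<Rightarrow> 'v) \<Rightarrow> 'v \<Rightarrow> bool" where
  "has_vderiv x x' \<longleftrightarrow> ((\<lambda>t. nrm ((1 / t) *\<^sub>R (x t - x 0) - x')) \<longlongrightarrow> 0) (at 0)"

text \<open>Differentiability at \<open>0\<close> with respect to the dual norm.\<close>

definition has_dderiv :: "(real \<Rightarrow> 'v \<Rightarrow> real) \<Rightarrow> ('v \<Rightarrow> real) \<Rightarrow> bool" where
  "has_dderiv \<Phi> \<Phi>' \<longleftrightarrow> (\<exists>\<rho>. (\<rho> \<longlongrightarrow> 0) (at 0) \<and>
     (\<forall>t v. t \<noteq> 0 \<longrightarrow> v \<in> V \<longrightarrow> \<bar>(\<Phi> t v - \<Phi> 0 v) / t - \<Phi>' v\<bar> \<le> \<rho> t * nrm v))"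

lemma has_dderiv_const: "has_dderiv (\<lambda>t. F) (\<lambda>v. 0)"
  unfolding has_dderiv_def by (intro exI[of _ "\<lambda>_. 0"]) auto

lemma has_dderiv_transform:
  assumes "has_dderiv F F'" "\<And>t v. v \<in> V \<Longrightarrow> F t v = G t v" "\<And>v. v \<in> V \<Longrightarrow> F' v = G' v"
  shows "has_dderiv G G'"
  using assms unfolding has_dderiv_def by simp

lemma has_dderiv_add:
  assumes "has_dderiv F F'" "has_dderiv G G'"
  shows "has_dderiv (\<lambda>t v. F t v + G t v) (\<lambda>v. F' v + G' v)"
proof -
  obtain \<rho> \<sigma> where r: "(\<rho> \<longlongrightarrow> 0) (at 0)" "(\<sigma> \<longlongrightarrow> 0) (at 0)"
    "\<And>t v. \<lbrakk>t \<noteq> 0; v \<in> V\<rbrakk> \<Longrightarrow> \<bar>(F t v - F 0 v) / t - F' v\<bar> \<le> \<rho> t * nrm v"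
    "\<And>t v. \<lbrakk>t \<noteq> 0; v \<in> V\<rbrakk> \<Longrightarrow> \<bar>(G t v - G 0 v) / t - G' v\<bar> \<le> \<sigma> t * nrm v"
    using assms unfolding has_dderiv_def by blast
  show ?thesis unfolding has_dderiv_def
  proof (intro exI[of _ "\<lambda>t. \<rho> t + \<sigma> t"] conjI allI impI)
    show "((\<lambda>t. \<rho> t + \<sigma> t) \<longlongrightarrow> 0) (at 0)" using tendsto_add[OF r(1,2)] by simp
    fix t :: real and v assume "t \<noteq> 0" "v \<in> V"
    have "(F t v + G t v - (F 0 v + G 0 v)) / t - (F' v + G' v)
        = ((F t v - F 0 v) / t - F' v) + ((G t v - G 0 v) / t - G' v)"
      by (simp add: add_divide_distrib diff_divide_distrib)
    then show "\<bar>(F t v + G t v - (F 0 v + G 0 v)) / t - (F' v + G' v)\<bar> \<le> (\<rho> t + \<sigma> t) * nrm v"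
      using r(3,4)[OF \<open>t \<noteq> 0\<close> \<open>v \<in> V\<close>] unfolding distrib_right by linarith
  qed
qed

lemma has_dderiv_cmult:
  assumes "has_dderiv F F'"
  shows "has_dderiv (\<lambda>t v. c * F t v) (\<lambda>v. c * F' v)"
proof -
  obtain \<rho> where r: "(\<rho> \<longlongrightarrow> 0) (at 0)"
    "\<And>t v. \<lbrakk>t \<noteq> 0; v \<in> V\<rbrakk> \<Longrightarrow> \<bar>(F t v - F 0 v) / t - F' v\<bar> \<le> \<rho> t * nrm v"
    using assms unfolding has_dderiv_def by blast
  show ?thesis unfolding has_dderiv_def
  proof (intro exI[of _ "\<lambda>t. \<bar>c\<bar> * \<rho> t"] conjI allI impI)
    show "((\<lambda>t. \<bar>c\<bar> * \<rho> t) \<longlongrightarrow> 0) (at 0)" using tendsto_mult_right_zero[OF r(1)] .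
    fix t :: real and v assume "t \<noteq> 0" "v \<in> V"
    have "(c * F t v - c * F 0 v) / t - c * F' v = c * ((F t v - F 0 v) / t - F' v)"
      by (simp add: right_diff_distrib diff_divide_distrib)
    then have "\<bar>(c * F t v - c * F 0 v) / t - c * F' v\<bar> = \<bar>c\<bar> * \<bar>(F t v - F 0 v) / t - F' v\<bar>"
      by (simp only: abs_mult)
    also have "\<dots> \<le> \<bar>c\<bar> * (\<rho> t * nrm v)"
      using r(2)[OF \<open>t \<noteq> 0\<close> \<open>v \<in> V\<close>] by (rule mult_left_mono) simp
    finally show "\<bar>(c * F t v - c * F 0 v) / t - c * F' v\<bar> \<le> \<bar>c\<bar> * \<rho> t * nrm v"
      by (simp only: mult.assoc)
  qed
qed

lemma has_dderiv_diff:
  assumes "has_dderiv F F'" "has_dderiv G G'"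
  shows "has_dderiv (\<lambda>t v. F t v - G t v) (\<lambda>v. F' v - G' v)"
  using has_dderiv_add[OF assms(1) has_dderiv_cmult[OF assms(2), of "-1"]] by simp

lemma has_dderiv_sum:
  assumes "finite I" "\<And>i. i \<in> I \<Longrightarrow> has_dderiv (F i) (F' i)"
  shows "has_dderiv (\<lambda>t v. \<Sum>i\<in>I. F i t v) (\<lambda>v. \<Sum>i\<in>I. F' i v)"
  using assms by (induction I) (auto intro: has_dderiv_const has_dderiv_add)

text \<open>Product rule with an error uniform in \<open>v\<close>. Inserting
  \<open>x t = x 0 + t *\<^sub>R (r t + x')\<close> splits the error into the remainder of
  \<open>e\<close>, the remainder \<open>r t\<close> weighted by \<open>e t\<close>, and the
  increment of \<open>e\<close> paired with \<open>x'\<close>.\<close>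

lemma has_dderiv_E:
  assumes e: "(e has_field_derivative e') (at 0)" and x: "has_vderiv x x'"
    and V: "\<And>t. x t \<in> V" "x' \<in> V"
  shows "has_dderiv (\<lambda>t v. e t * E i (x t) v) (\<lambda>v. e' * E i (x 0) v + e 0 * E i x' v)"
proof -
  define r where "r t = (1 / t) *\<^sub>R (x t - x 0) - x'" for t
  have rV: "r t \<in> V" for t unfolding r_def by (intro V_closed V)
  define \<rho> where "\<rho> t = \<bar>(e t - e 0) / t - e'\<bar> * nrm (x 0) + \<bar>e t\<bar> * nrm (r t) + \<bar>e t - e 0\<bar> * nrm x'" for t
  show ?thesis unfolding has_dderiv_def
  proof (intro exI[of _ \<rho>] conjI allI impI)
    have "((\<lambda>t. (e t - e 0) / t) \<longlongrightarrow> e') (at 0)" using e by (simp add: has_field_derivative_iff)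
    then have 1: "((\<lambda>t. \<bar>(e t - e 0) / t - e'\<bar>) \<longlongrightarrow> 0) (at 0)"
      using LIM_zero tendsto_rabs_zero by blast
    have 2: "(e \<longlongrightarrow> e 0) (at 0)" using e by (metis DERIV_isCont isCont_def)
    have 3: "((\<lambda>t. \<bar>e t - e 0\<bar>) \<longlongrightarrow> 0) (at 0)"
      using 2 LIM_zero tendsto_rabs_zero by blast
    have 4: "((\<lambda>t. nrm (r t)) \<longlongrightarrow> 0) (at 0)" using x by (simp add: has_vderiv_def r_def)
    have "(\<rho> \<longlongrightarrow> 0 * nrm (x 0) + \<bar>e 0\<bar> * 0 + 0 * nrm x') (at 0)"
      unfolding \<rho>_def by (intro tendsto_intros 1 2 3 4)
    then show "(\<rho> \<longlongrightarrow> 0) (at 0)" by simp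
  next
    fix t :: real and v assume t: "t \<noteq> 0" and v: "v \<in> V"
    have "x t = x 0 + t *\<^sub>R (r t + x')" using t by (simp add: r_def)
    then have "E i (x t) v = E i (x 0) v + t * (E i (r t) v + E i x' v)"
      using V v rV by (simp add: E_bilin V_closed del: scaleR_add_right)
    moreover have "(a * (X + t * (R + P)) - b * X) / t - (e' * X + b * P)
      = ((a - b) / t - e') * X + a * R + (a - b) * P" for a b X R P :: real
      using t by (simp add: divide_simps) (simp add: algebra_simps)
    ultimately have "(e t * E i (x t) v - e 0 * E i (x 0) v) / t - (e' * E i (x 0) v + e 0 * E i x' v)
      = ((e t - e 0) / t - e') * E i (x 0) v + e t * E i (r t) v + (e t - e 0) * E i x' v"
      by simp
    also have "\<bar>\<dots>\<bar> \<le> \<bar>(e t - e 0) / t - e'\<bar> * \<bar>E i (x 0) v\<bar> + \<bar>e t\<bar> * \<bar>E i (r t) v\<bar> + \<bar>e t - e 0\<bar> * \<bar>E i x' v\<bar>"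
      by (intro order_trans[OF abs_triangle_ineq] add_mono) (auto simp: abs_mult)
    also have "\<dots> \<le> \<bar>(e t - e 0) / t - e'\<bar> * (nrm (x 0) * nrm v) + \<bar>e t\<bar> * (nrm (r t) * nrm v)
        + \<bar>e t - e 0\<bar> * (nrm x' * nrm v)"
      by (intro add_mono mult_left_mono E_le_nrm V v rV) auto
    also have "\<dots> = \<rho> t * nrm v" by (simp add: \<rho>_def algebra_simps)
    finally show "\<bar>(e t * E i (x t) v - e 0 * E i (x 0) v) / t - (e' * E i (x 0) v + e 0 * E i x' v)\<bar>
      \<le> \<rho> t * nrm v" .
  qed
qed

lemma has_vderiv_const: "has_vderiv (\<lambda>t. x) 0"
proof -
  have "nrm 0 = 0" using nrm_scale[of 0 0] V_closed(4) by simp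
  then show ?thesis by (simp add: has_vderiv_def)
qed

text \<open>Implicit differentiation without prior continuity of \<open>x\<close>: the remainder
  \<open>r t\<close> of the difference quotient itself solves the problem with coefficient
  \<open>e t\<close>, and its source is small in the dual norm. Coercivity, uniform for small
  \<open>t\<close>, turns this into smallness of \<open>r t\<close>.\<close>

lemma has_vderiv_solution:
  assumes e: "\<And>i. ((\<lambda>t. e t i) has_field_derivative e' i) (at 0)" and pos: "\<And>i. 0 < e 0 i"
    and G: "has_dderiv G G'" and V: "\<And>t. x t \<in> V" "x' \<in> V"
    and sol: "\<And>t v. v \<in> V \<Longrightarrow> wform (e t) (x t) v = G t v"
    and sol': "\<And>v. v \<in> V \<Longrightarrow> wform (e 0) x' v = G' v - wform e' (x 0) v"
  shows "has_vderiv x x'"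
proof -
  define r where "r t = (1 / t) *\<^sub>R (x t - x 0) - x'" for t
  have rV: "r t \<in> V" for t unfolding r_def by (intro V_closed V)
  \<comment> \<open>The solution is frozen at \<open>x 0\<close>, so that only the coefficient is
    differentiated.\<close>
  have "has_dderiv (\<lambda>t v. \<Sum>i\<in>UNIV. e t i * E i (x 0) v) (\<lambda>v. \<Sum>i\<in>UNIV. e' i * E i (x 0) v + e 0 i * E i 0 v)"
    by (intro has_dderiv_sum has_dderiv_E e has_vderiv_const) (auto intro: V V_closed)
  moreover have "E i 0 v = 0" if "v \<in> V" for i v
    using E_scale[of 0 v i 0] that V_closed(4) by simp
  ultimately have H: "has_dderiv (\<lambda>t v. wform (e t) (x 0) v) (wform e' (x 0))"
    by (elim has_dderiv_transform) (simp_all add: wform_def)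
  define \<sigma> where "\<sigma> t = (\<Sum>i\<in>UNIV. \<bar>e t i - e 0 i\<bar>) * nrm x'" for t
  obtain \<rho> where \<rho>: "(\<rho> \<longlongrightarrow> 0) (at 0)"
    "\<And>t v. \<lbrakk>t \<noteq> 0; v \<in> V\<rbrakk> \<Longrightarrow> \<bar>((G t v - wform (e t) (x 0) v) - (G 0 v - wform (e 0) (x 0) v)) / t
        - (G' v - wform e' (x 0) v)\<bar> \<le> \<rho> t * nrm v"
    using has_dderiv_diff[OF G H] unfolding has_dderiv_def by blast
  have et: "((\<lambda>t. e t i) \<longlongrightarrow> e 0 i) (at 0)" for i
    using e[of i] by (metis DERIV_isCont isCont_def)
  have bound: "wform (e t) (r t) v \<le> (\<rho> t + \<sigma> t) * nrm v" if t: "t \<noteq> 0" and v: "v \<in> V" for t v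
  proof -
    have "wform (e t) (r t) v = (G t v - wform (e t) (x 0) v) / t - wform (e t) x' v"
      unfolding r_def using V v by (simp add: wform_bilin V_closed sol diff_divide_distrib)
    \<comment> \<open>The equation at \<open>t = 0\<close> makes the subtracted value vanish, and
      \<open>sol'\<close> identifies the derivative of the source with
      \<open>wform (e 0) x'\<close>. What remains is a difference of two errors, bounded by
      \<open>\<rho>\<close> and \<open>\<sigma>\<close>.\<close>
    also have "\<dots> = (((G t v - wform (e t) (x 0) v) - (G 0 v - wform (e 0) (x 0) v)) / t
        - (G' v - wform e' (x 0) v)) - (wform (e t) x' v - wform (e 0) x' v)"
      using sol[OF v, of 0] sol'[OF v] by simp
    also have "\<dots> \<le> \<rho> t * nrm v + \<sigma> t * nrm v"
    proof -
      have "\<bar>wform (e t) x' v - wform (e 0) x' v\<bar> = \<bar>\<Sum>i\<in>UNIV. (e t i - e 0 i) * E i x' v\<bar>"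
        by (simp add: wform_def sum_subtractf left_diff_distrib)
      also have "\<dots> \<le> (\<Sum>i\<in>UNIV. \<bar>e t i - e 0 i\<bar> * (nrm x' * nrm v))"
        by (intro order_trans[OF sum_abs] sum_mono) (auto simp: abs_mult intro!: mult_left_mono E_le_nrm V v)
      also have "\<dots> = \<sigma> t * nrm v" by (simp add: \<sigma>_def sum_distrib_right mult.assoc)
      finally show ?thesis using \<rho>(2)[OF t v] by linarith
    qed
    finally show ?thesis by (simp add: distrib_right)
  qed
  \<comment> \<open>Half the minimum leaves the coefficients room to move: every
    \<open>e t i\<close> stays above \<open>\<alpha>\<close> for \<open>t\<close> near
    \<open>0\<close>.\<close>
  define \<alpha> where "\<alpha> = Min (range (e 0)) / 2"
  have \<alpha>: "0 < \<alpha>" "\<And>i. \<alpha> < e 0 i"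
  proof -
    have "0 < Min (range (e 0))" using pos by (auto simp: Min_gr_iff)
    then show "0 < \<alpha>" by (simp add: \<alpha>_def)
    have "Min (range (e 0)) \<le> e 0 i" for i by (rule Min_le) auto
    then show "\<alpha> < e 0 i" for i using \<open>0 < \<alpha>\<close> unfolding \<alpha>_def by (smt (verit) field_sum_of_halves)
  qed
  have ev: "\<forall>\<^sub>F t in at 0. \<forall>i. \<alpha> < e t i"
    using order_tendstoD(1)[OF et \<alpha>(2)] by (simp add: eventually_all_finite)
  have "\<forall>\<^sub>F t in at 0. nrm (r t) \<le> \<bar>\<rho> t + \<sigma> t\<bar> / \<alpha>"
    using ev eventually_neq_at_within[of 0]
  proof eventually_elim
    case (elim t)
    have "\<alpha> * (nrm (r t))\<^sup>2 \<le> wform (e t) (r t) (r t)"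
      using elim by (intro coercive rV) (auto intro: less_imp_le)
    also have "\<dots> \<le> (\<rho> t + \<sigma> t) * nrm (r t)" using bound[OF _ rV] elim by simp
    finally have *: "\<alpha> * nrm (r t) * nrm (r t) \<le> (\<rho> t + \<sigma> t) * nrm (r t)" by (simp add: power2_eq_square mult.assoc)
    show ?case
    proof (cases "nrm (r t) = 0")
      case False
      then have "0 < nrm (r t)" using nrm_nonneg[OF rV, of t] by simp
      from mult_right_le_imp_le[OF * this]
      have "\<alpha> * nrm (r t) \<le> \<bar>\<rho> t + \<sigma> t\<bar>" by linarith
      then show ?thesis using \<alpha>(1) by (simp add: pos_le_divide_eq mult.commute)
    qed (use \<alpha>(1) in simp)
  qed
  moreover have "((\<lambda>t. \<bar>\<rho> t + \<sigma> t\<bar> / \<alpha>) \<longlongrightarrow> 0) (at 0)"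
  proof -
    have "((\<lambda>t. \<bar>\<rho> t + \<sigma> t\<bar> / \<alpha>) \<longlongrightarrow> \<bar>0 + (\<Sum>i\<in>UNIV. \<bar>e 0 i - e 0 i\<bar>) * nrm x'\<bar> / \<alpha>) (at 0)"
      unfolding \<sigma>_def using \<alpha>(1) by (intro tendsto_intros \<rho> et) auto
    then show ?thesis by simp
  qed
  ultimately show ?thesis
    unfolding has_vderiv_def r_def[symmetric]
    by (rule_tac Lim_null_comparison[where g = "\<lambda>t. \<bar>\<rho> t + \<sigma> t\<bar> / \<alpha>"]) (auto simp: nrm_nonneg rV)
qed

end

section \<open>Multi-indices as sets of slots\<close>

text \<open>A multi-index \<open>\<nu>\<close> is represented by the set \<open>slots \<nu>\<close> with \<open>\<nu> j\<close> copies of each \<open>j\<close>. Sums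
  over subsets of \<open>slots \<nu>\<close> count each \<open>\<mu> \<le> \<nu>\<close> with its multi-binomial coefficient.\<close>

definition slots :: "('s \<Rightarrow> nat) \<Rightarrow> ('s \<times> nat) set" where
  "slots \<nu> = (SIGMA j:UNIV. {..<\<nu> j})"

definition slot_mult :: "('s \<times> nat) set \<Rightarrow> 's \<Rightarrow> nat" where
  "slot_mult T = (\<lambda>j. card {k. (j, k) \<in> T})"

text \<open>With \<open>b = B i\<close> this is the factor that repeated differentiation produces
  from the exponential of node \<open>i\<close>.\<close>

definition slot_prod :: "('s \<Rightarrow> real) \<Rightarrow> ('s \<times> nat) set \<Rightarrow> real" where
  "slot_prod b T = (\<Prod>p\<in>T. b (fst p))"

lemma finite_slots [simp]: "finite (slots (\<nu> :: 's::finite \<Rightarrow> nat))"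
  by (simp add: slots_def)

lemma finite_fibre: "finite T \<Longrightarrow> finite {k. (j, k) \<in> T}"
  by (rule finite_subset[of _ "snd ` T"]) force+

lemma slot_mult_slots [simp]: "slot_mult (slots \<nu>) = \<nu>"
  by (simp add: slot_mult_def slots_def)

lemma card_eq_sum_slot_mult:
  fixes T :: "('s::finite \<times> nat) set"
  assumes "finite T"
  shows "card T = (\<Sum>j\<in>UNIV. slot_mult T j)"
proof -
  have "T = (SIGMA j:UNIV. {k. (j, k) \<in> T})" by auto
  then have "card T = card (SIGMA j:UNIV. {k. (j, k) \<in> T})" by simp
  also have "\<dots> = (\<Sum>j\<in>UNIV. slot_mult T j)"
    unfolding slot_mult_def using assms by (intro card_SigmaI) (auto intro: finite_fibre)
  finally show ?thesis .
qed

lemma slot_prod_eq: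
  fixes T :: "('s::finite \<times> nat) set"
  assumes "finite T"
  shows "slot_prod b T = (\<Prod>j\<in>UNIV. b j ^ slot_mult T j)"
proof -
  have "T = (SIGMA j:UNIV. {k. (j, k) \<in> T})" by auto
  then have "slot_prod b T = slot_prod b (SIGMA j:UNIV. {k. (j, k) \<in> T})" by simp
  also have "\<dots> = (\<Prod>j\<in>UNIV. \<Prod>k\<in>{k. (j, k) \<in> T}. b j)"
    unfolding slot_prod_def
    by (subst prod.Sigma) (auto simp: finite_fibre assms case_prod_beta)
  also have "\<dots> = (\<Prod>j\<in>UNIV. b j ^ slot_mult T j)" by (simp add: slot_mult_def)
  finally show ?thesis .
qed

lemma slots_upd: "slots (\<nu>(j := Suc (\<nu> j))) = insert (j, \<nu> j) (slots \<nu>)"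
  by (auto simp: slots_def split: if_splits)

lemma slots_new: "(j, \<nu> j) \<notin> slots \<nu>"
  by (simp add: slots_def)

lemma slot_mult_insert:
  assumes "finite T" "(j, k) \<notin> T"
  shows "slot_mult (insert (j, k) T) = (slot_mult T)(j := Suc (slot_mult T j))"
proof
  fix i
  have "{k'. (i, k') \<in> insert (j, k) T} = (if i = j then insert k {k'. (j, k') \<in> T} else {k'. (i, k') \<in> T})"
    by auto
  then show "slot_mult (insert (j, k) T) i = ((slot_mult T)(j := Suc (slot_mult T j))) i"
    using assms finite_fibre[OF assms(1)] by (simp add: slot_mult_def)
qed

lemma sum_Pow_split: "finite S \<Longrightarrow> (\<Sum>T\<in>Pow S. f T) = f S + (\<Sum>T\<in>Pow S - {S}. f T)"
  by (rule sum.remove) auto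

text \<open>Takes the place of Pascal's rule for multi-binomial coefficients: the slot
  \<open>p\<close> of an added derivative acts either on the coefficient or on the solution.\<close>

lemma sum_Pow_insert:
  assumes "finite S" "p \<notin> S"
  shows "(\<Sum>T\<in>Pow (insert p S). f T) = (\<Sum>T\<in>Pow S. f T) + (\<Sum>T\<in>Pow S. f (insert p T))"
proof -
  have "(\<Sum>T\<in>Pow (insert p S). f T) = (\<Sum>T\<in>Pow S. f T) + (\<Sum>T\<in>insert p ` Pow S. f T)"
    unfolding Pow_insert using assms by (intro sum.union_disjoint) auto
  also have "(\<Sum>T\<in>insert p ` Pow S. f T) = (\<Sum>T\<in>Pow S. f (insert p T))"
    using assms by (intro sum.reindex_cong[of "insert p"]) (auto simp: inj_on_def)
  finally show ?thesis .
qed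

text \<open>Grouping by size leaves binomials in the total order alone, which makes the recursion
  one-dimensional.\<close>

lemma sum_psubsets_card:
  fixes f :: "nat \<Rightarrow> real"
  assumes "finite S"
  shows "(\<Sum>T\<in>Pow S - {S}. f (card T)) = (\<Sum>l<card S. real (card S choose l) * f l)"
proof -
  have "card T < card S" if "T \<in> Pow S - {S}" for T
    using that assms by (auto intro: psubset_card_mono)
  then have "(\<Sum>T\<in>Pow S - {S}. f (card T))
      = (\<Sum>l<card S. \<Sum>T\<in>{T \<in> Pow S - {S}. card T = l}. f (card T))"
    using assms by (intro sum.group[symmetric]) auto
  also have "\<dots> = (\<Sum>l<card S. real (card S choose l) * f l)"
  proof (rule sum.cong[OF refl])
    fix l assume "l \<in> {..<card S}"
    then have "{T \<in> Pow S - {S}. card T = l} = {T. T \<subseteq> S \<and> card T = l}" by auto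
    then show "(\<Sum>T\<in>{T \<in> Pow S - {S}. card T = l}. f (card T)) = real (card S choose l) * f l"
      using n_subsets[OF assms, of l] by simp
  qed
  finally show ?thesis .
qed

lemma card_slot_mult_less: "T \<in> Pow (slots \<nu>) - {slots \<nu>} \<Longrightarrow> card (slots (slot_mult T)) < card (slots (\<nu> :: 's::finite \<Rightarrow> nat))"
proof -
  assume T: "T \<in> Pow (slots \<nu>) - {slots \<nu>}"
  then have fin: "finite T" using finite_subset[of T "slots \<nu>"] by simp
  have "card (slots (slot_mult T)) = card T" by (simp add: card_eq_sum_slot_mult fin)
  also have "\<dots> < card (slots \<nu>)" using T by (intro psubset_card_mono) auto
  finally show ?thesis .
qed

section \<open>Recursions over multi-indices and factorial bounds\<close>

lemma slot_prod_nonneg: "(\<And>j. 0 \<le> b j) \<Longrightarrow> 0 \<le> slot_prod b T"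
  by (simp add: slot_prod_def prod_nonneg)

lemma slot_prod_mult: "\<lbrakk>finite S; T \<subseteq> S\<rbrakk> \<Longrightarrow> slot_prod b (S - T) * slot_prod b T = slot_prod b S"
  unfolding slot_prod_def by (simp add: prod.subset_diff)

text \<open>The products over \<open>slots \<nu> - T\<close> and over \<open>T\<close> recombine to
  the product over \<open>slots \<nu>\<close>, so the powers of \<open>b\<close> factor out of every
  term. It then suffices that \<open>\<theta>\<close> dominates a scalar recursion in the total
  order with source \<open>\<kappa>\<close>.\<close>

lemma multi_index_recursion_bound:
  fixes N :: "('s::finite \<Rightarrow> nat) \<Rightarrow> real"
  assumes b: "\<And>j. 0 \<le> b j"
    and rec: "\<And>\<nu>. N \<nu> \<le> (\<Sum>T\<in>Pow (slots \<nu>) - {slots \<nu>}. slot_prod b (slots \<nu> - T) * N (slot_mult T))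
                   + \<kappa> (card (slots \<nu>)) * slot_prod b (slots \<nu>)"
    and lam: "\<And>n. (\<Sum>l<n. real (n choose l) * \<theta> l) + \<kappa> n \<le> \<theta> n"
  shows "N \<nu> \<le> \<theta> (card (slots \<nu>)) * slot_prod b (slots \<nu>)"
proof (induction "card (slots \<nu>)" arbitrary: \<nu> rule: less_induct)
  case less
  let ?S = "slots \<nu>"
  have "N \<nu> \<le> (\<Sum>T\<in>Pow ?S - {?S}. slot_prod b (?S - T) * N (slot_mult T)) + \<kappa> (card ?S) * slot_prod b ?S"
    by (rule rec)
  also have "(\<Sum>T\<in>Pow ?S - {?S}. slot_prod b (?S - T) * N (slot_mult T))
      \<le> (\<Sum>T\<in>Pow ?S - {?S}. slot_prod b ?S * \<theta> (card T))"
  proof (rule sum_mono)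
    fix T assume T: "T \<in> Pow ?S - {?S}"
    then have fin: "finite T" using finite_subset[of T ?S] by simp
    have c: "card (slots (slot_mult T)) = card T"
      by (simp add: card_eq_sum_slot_mult fin)
    have "card T < card ?S" using T by (intro psubset_card_mono) auto
    then have "N (slot_mult T) \<le> \<theta> (card T) * slot_prod b T"
      using less[of "slot_mult T"] by (simp add: c slot_prod_eq fin)
    then have "slot_prod b (?S - T) * N (slot_mult T) \<le> slot_prod b (?S - T) * (\<theta> (card T) * slot_prod b T)"
      by (intro mult_left_mono slot_prod_nonneg b)
    also have "\<dots> = slot_prod b ?S * \<theta> (card T)"
      using slot_prod_mult[of ?S T b] T by simp
    finally show "slot_prod b (?S - T) * N (slot_mult T) \<le> slot_prod b ?S * \<theta> (card T)" .
  qed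
  also have "(\<Sum>T\<in>Pow ?S - {?S}. slot_prod b ?S * \<theta> (card T)) + \<kappa> (card ?S) * slot_prod b ?S
      = ((\<Sum>l<card ?S. real (card ?S choose l) * \<theta> l) + \<kappa> (card ?S)) * slot_prod b ?S"
    unfolding sum_distrib_left[symmetric] sum_psubsets_card[OF finite_slots] by (simp add: algebra_simps)
  also have "\<dots> \<le> \<theta> (card ?S) * slot_prod b ?S"
    by (intro mult_right_mono lam slot_prod_nonneg b)
  finally show ?case by simp
qed

text \<open>Since \<open>real (n choose l) * fact l\<close> equals
  \<open>fact n / fact (n - l)\<close>, the substitution \<open>k = n - l\<close> turns the sum into
  a partial sum of the exponential series at \<open>ln 2\<close>, without its constant term.\<close>

lemma ordered_Bell_bound:
  "(\<Sum>l<n. real (n choose l) * (fact l / ln 2 ^ l)) \<le> fact n / ln 2 ^ n"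
proof -
  define c :: real where "c = ln 2"
  have c: "0 < c" by (simp add: c_def)
  have "(\<Sum>l<n. real (n choose l) * (fact l / c ^ l)) = (\<Sum>l<n. fact n / c ^ n * (c ^ (n - l) / fact (n - l)))"
  proof (rule sum.cong[OF refl])
    fix l assume "l \<in> {..<n}"
    then have l: "l < n" by simp
    then have "c ^ n = c ^ l * c ^ (n - l)" by (simp flip: power_add)
    then show "real (n choose l) * (fact l / c ^ l) = fact n / c ^ n * (c ^ (n - l) / fact (n - l))"
      using l c by (simp add: binomial_fact)
  qed
  also have "\<dots> = fact n / c ^ n * (\<Sum>l<n. c ^ (n - l) / fact (n - l))"
    by (simp add: sum_distrib_left)
  also have "\<dots> \<le> fact n / c ^ n"
  proof -
    have "(\<Sum>l<n. c ^ (n - l) / fact (n - l)) = (\<Sum>k\<in>{1..n}. c ^ k / fact k)"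
      by (rule sum.reindex_bij_witness[of _ "\<lambda>k. n - k" "\<lambda>l. n - l"]) auto
    also have "\<dots> \<le> 1"
    proof -
      have "(\<Sum>k\<in>{0..n}. c ^ k / fact k) \<le> (\<Sum>k. c ^ k / fact k)"
        using summable_exp[of c] c by (intro sum_le_suminf) (auto simp: field_simps)
      also have "\<dots> = exp c" by (simp add: exp_def field_simps)
      also have "\<dots> = 2" by (simp add: c_def)
      \<comment> \<open>The term \<open>k = 0\<close> contributes 1 to a total of at most 2.\<close>
      finally show ?thesis by (simp add: sum.atLeast_Suc_atMost)
    qed
    finally show ?thesis using c by (intro mult_left_le) auto
  qed
  finally show ?thesis by (simp add: c_def)
qed

text \<open>For \<open>l < n\<close> the extra factor \<open>l + 1\<close> is at most
  \<open>n\<close>, so the sum is at most \<open>n\<close> times the unshifted bound. The additional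
  source supplies the one further copy that makes \<open>n + 1\<close>; this is the origin of the
  larger factorial in the adjoint estimate.\<close>

lemma shifted_ordered_Bell_bound:
  "(\<Sum>l<n. real (n choose l) * (fact (l + 1) / ln 2 ^ l)) + fact n / ln 2 ^ n \<le> fact (n + 1) / ln 2 ^ n"
proof -
  have "(\<Sum>l<n. real (n choose l) * (fact (l + 1) / ln 2 ^ l))
      \<le> (\<Sum>l<n. real n * (real (n choose l) * (fact l / ln 2 ^ l)))"
  proof (rule sum_mono)
    fix l assume "l \<in> {..<n}"
    then have "real (l + 1) \<le> real n" by simp
    then have "real (l + 1) * (real (n choose l) * (fact l / ln 2 ^ l)) \<le> real n * (real (n choose l) * (fact l / ln 2 ^ l))"
      by (rule mult_right_mono) simp
    then show "real (n choose l) * (fact (l + 1) / ln 2 ^ l) \<le> real n * (real (n choose l) * (fact l / ln 2 ^ l))"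
      by (simp add: algebra_simps)
  qed
  also have "\<dots> \<le> real n * (fact n / ln 2 ^ n)"
    unfolding sum_distrib_left[symmetric] by (intro mult_left_mono ordered_Bell_bound) simp
  finally show ?thesis by (simp add: algebra_simps add_divide_distrib)
qed

lemma multi_index_cases:
  fixes \<nu> :: "'s \<Rightarrow> nat"
  obtains "\<nu> = (\<lambda>_. 0)" | \<mu> j where "\<nu> = \<mu>(j := Suc (\<mu> j))"
proof (cases "\<nu> = (\<lambda>_. 0)")
  case False
  then obtain j where "\<nu> j \<noteq> 0" by auto
  then have "\<nu> = (\<nu>(j := \<nu> j - 1))(j := Suc ((\<nu>(j := \<nu> j - 1)) j))" by auto
  then show ?thesis using that(2) by blast
qed (use that in blast)

section \<open>Elliptic problems with log-affine coefficients\<close>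

locale affine_exponential = energy_space V E
  for V :: "'v::real_vector set" and E :: "'m::finite \<Rightarrow> 'v \<Rightarrow> 'v \<Rightarrow> real" +
  fixes B :: "'m \<Rightarrow> 's::finite \<Rightarrow> real" and z0 :: "'m \<Rightarrow> real"
begin

definition ex :: "real^'s \<Rightarrow> 'm \<Rightarrow> real" where
  "ex y i = exp ((\<Sum>j\<in>UNIV. B i j * y $ j) + z0 i)"

definition partial :: "'s \<Rightarrow> (real^'s \<Rightarrow> 'v) \<Rightarrow> (real^'s \<Rightarrow> 'v) \<Rightarrow> bool" where
  "partial j f f' \<longleftrightarrow> (\<forall>y. f' y \<in> V \<and> has_vderiv (\<lambda>t. f (y + t *\<^sub>R axis j 1)) (f' y))"

lemma ex_pos: "0 < ex y i"
  by (simp add: ex_def)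

lemma ex_shift: "ex (y + t *\<^sub>R axis j 1) i = exp (t * B i j) * ex y i"
proof -
  have "(\<Sum>k\<in>UNIV. B i k * (y + t *\<^sub>R axis j 1) $ k) = (\<Sum>k\<in>UNIV. B i k * y $ k) + t * B i j"
    by (simp add: distrib_left sum.distrib axis_def if_distrib[of "\<lambda>x. _ * x"] cong: if_cong)
  then show ?thesis by (simp add: ex_def flip: exp_add)
qed

lemma ex_deriv: "((\<lambda>t. ex (y + t *\<^sub>R axis j 1) i) has_field_derivative B i j * ex y i) (at 0)"
  unfolding ex_shift by (auto intro!: derivative_eq_intros)

text \<open>One summand of \<open>\<partial>\<^sup>\<nu>\<close> applied to \<open>wform (ex y) (u y) v\<close>: the slots in \<open>T\<close> differentiate \<open>u\<close>,
  the others the coefficient.\<close>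

definition leibniz_term ::
    "(('s \<Rightarrow> nat) \<Rightarrow> real^'s \<Rightarrow> 'v) \<Rightarrow> ('s \<times> nat) set \<Rightarrow> ('s \<times> nat) set \<Rightarrow> real^'s \<Rightarrow> 'v \<Rightarrow> real" where
  "leibniz_term w S T y v = (\<Sum>i\<in>UNIV. slot_prod (B i) (S - T) * (ex y i * E i (w (slot_mult T) y) v))"

definition leibniz_eq ::
    "(('s \<Rightarrow> nat) \<Rightarrow> real^'s \<Rightarrow> 'v) \<Rightarrow> (('s \<Rightarrow> nat) \<Rightarrow> real^'s \<Rightarrow> 'v \<Rightarrow> real) \<Rightarrow> bool" where
  "leibniz_eq w F \<longleftrightarrow> (\<forall>\<nu> y. \<forall>v\<in>V. (\<Sum>T\<in>Pow (slots \<nu>). leibniz_term w (slots \<nu>) T y v) = F \<nu> y v)"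

text \<open>Records a right-hand side together with all its parameter derivatives. This covers both
  the constant source of the state and the adjoint source, which varies with the state.\<close>

definition functional_family :: "(('s \<Rightarrow> nat) \<Rightarrow> real^'s \<Rightarrow> 'v \<Rightarrow> real) \<Rightarrow> bool" where
  "functional_family F \<longleftrightarrow> (\<forall>\<nu> y. bounded_functional (F \<nu> y)) \<and>
     (\<forall>\<nu> j y. has_dderiv (\<lambda>t. F \<nu> (y + t *\<^sub>R axis j 1)) (F (\<nu>(j := Suc (\<nu> j))) y))"

lemma leibniz_term_self: "leibniz_term w (slots \<nu>) (slots \<nu>) y v = wform (ex y) (w \<nu> y) v"
  by (simp add: leibniz_term_def slot_prod_def wform_def)

text \<open>Order zero returns the given solution itself, because a family of partial derivatives
  must equal the function there; a newly chosen solution would agree with it only up to seminorm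
  zero.\<close>

definition leibniz_step ::
    "(('s \<Rightarrow> nat) \<Rightarrow> real^'s \<Rightarrow> 'v \<Rightarrow> real) \<Rightarrow> (real^'s \<Rightarrow> 'v) \<Rightarrow>
     (('s \<Rightarrow> nat) \<Rightarrow> real^'s \<Rightarrow> 'v) \<Rightarrow> ('s \<Rightarrow> nat) \<Rightarrow> real^'s \<Rightarrow> 'v" where
  "leibniz_step F u w \<nu> y = (if \<nu> = (\<lambda>_. 0) then u y else SOME x. x \<in> V \<and> (\<forall>v\<in>V. wform (ex y) x v
     = F \<nu> y v - (\<Sum>T\<in>Pow (slots \<nu>) - {slots \<nu>}. leibniz_term w (slots \<nu>) T y v)))"

definition leibniz_solution ::
    "(('s \<Rightarrow> nat) \<Rightarrow> real^'s \<Rightarrow> 'v \<Rightarrow> real) \<Rightarrow> (real^'s \<Rightarrow> 'v) \<Rightarrow> ('s \<Rightarrow> nat) \<Rightarrow> real^'s \<Rightarrow> 'v" where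
  "leibniz_solution F u = wfrec (inv_image less_than (\<lambda>\<nu>. card (slots \<nu>))) (leibniz_step F u)"

text \<open>A proper subset \<open>T\<close> has a multiplicity vector of smaller total order, so
  the truncation by \<open>cut\<close> is never visible to the recursion step.\<close>

lemma leibniz_solution_unfold: "leibniz_solution F u \<nu> = leibniz_step F u (leibniz_solution F u) \<nu>"
proof -
  let ?R = "inv_image less_than (\<lambda>\<nu> :: 's \<Rightarrow> nat. card (slots \<nu>))"
  have "leibniz_term (cut w ?R \<nu>) (slots \<nu>) T = leibniz_term w (slots \<nu>) T"
    if "T \<in> Pow (slots \<nu>) - {slots \<nu>}" for T w
    using card_slot_mult_less[OF that] by (intro ext) (simp add: leibniz_term_def cut_apply)
  then have "leibniz_step F u (cut w ?R \<nu>) \<nu> = leibniz_step F u w \<nu>" for w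
    by (intro ext) (simp add: leibniz_step_def cong: sum.cong_simp)
  then show ?thesis
    unfolding leibniz_solution_def by (subst wfrec) (simp_all add: wf_inv_image)
qed

lemma leibniz_solution_0: "leibniz_solution F u (\<lambda>_. 0) = u"
  by (rule ext) (simp add: leibniz_solution_unfold leibniz_step_def)

text \<open>Lower order solutions in \<open>V\<close> make the right-hand side a bounded functional,
  and \<open>solve_exists\<close> supplies the next one. Everything happens at fixed
  \<open>y\<close>; differentiability in \<open>y\<close> is a separate matter.\<close>

lemma leibniz_solution_solves:
  assumes F: "functional_family F" and u: "\<And>y. u y \<in> V"
    and sol: "\<And>y v. v \<in> V \<Longrightarrow> wform (ex y) (u y) v = F (\<lambda>_. 0) y v"
  defines "w \<equiv> leibniz_solution F u"
  shows "w \<nu> y \<in> V" "leibniz_eq w F"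
proof -
  have *: "w \<nu> y \<in> V \<and> (\<forall>v\<in>V. wform (ex y) (w \<nu> y) v
      = F \<nu> y v - (\<Sum>T\<in>Pow (slots \<nu>) - {slots \<nu>}. leibniz_term w (slots \<nu>) T y v))" for \<nu> y
  proof (induction "card (slots \<nu>)" arbitrary: \<nu> rule: less_induct)
    case less
    show ?case
    proof (cases "\<nu> = (\<lambda>_. 0)")
      case True
      have "slots (\<lambda>_::'s. 0) = {}" by (simp add: slots_def)
      then show ?thesis using u sol True by (simp add: w_def leibniz_solution_0)
    next
      case False
      let ?R = "\<lambda>v. F \<nu> y v - (\<Sum>T\<in>Pow (slots \<nu>) - {slots \<nu>}. leibniz_term w (slots \<nu>) T y v)"
      have "bounded_functional ?R"
      proof (intro bounded_functional_diff bounded_functional_sum)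
        show "bounded_functional (F \<nu> y)" using F by (simp add: functional_family_def)
        fix T assume "T \<in> Pow (slots \<nu>) - {slots \<nu>}"
        then have "w (slot_mult T) y \<in> V" using less card_slot_mult_less by blast
        then show "bounded_functional (leibniz_term w (slots \<nu>) T y)"
          unfolding leibniz_term_def[abs_def]
          by (intro bounded_functional_sum bounded_functional_cmult bounded_functional_E) auto
      qed auto
      then have ex: "\<exists>x. x \<in> V \<and> (\<forall>v\<in>V. wform (ex y) x v = ?R v)"
        using solve_exists[of "ex y" ?R] ex_pos by auto
      have "w \<nu> y = (SOME x. x \<in> V \<and> (\<forall>v\<in>V. wform (ex y) x v = ?R v))"
        using False unfolding w_def by (subst leibniz_solution_unfold) (simp add: leibniz_step_def)
      then show ?thesis using someI_ex[OF ex] by simp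
    qed
  qed
  show "w \<nu> y \<in> V" using * by blast
  show "leibniz_eq w F"
    unfolding leibniz_eq_def using * by (simp add: sum_Pow_split leibniz_term_self)
qed

text \<open>Induction on the total order. Once all lower derivatives are known to be differentiable,
  the equation for \<open>\<nu>\<close> has a differentiable source and
  \<open>has_vderiv_solution\<close> applies, provided that the equation for the raised index is the
  differentiated one. That is a rearrangement of its sum over subsets.\<close>

lemma leibniz_eq_partial:
  assumes F: "functional_family F" and eq: "leibniz_eq w F" and V: "\<And>\<nu> y. w \<nu> y \<in> V"
  shows "partial j (w \<nu>) (w (\<nu>(j := Suc (\<nu> j))))"
proof (induction "card (slots \<nu>)" arbitrary: \<nu> j rule: less_induct)
  case less
  define \<nu>' where "\<nu>' = \<nu>(j := Suc (\<nu> j))"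
  define p where "p = (j, \<nu> j)"
  let ?S = "slots \<nu>"
  have S': "slots \<nu>' = insert p ?S" "p \<notin> ?S"
    unfolding \<nu>'_def p_def by (simp_all add: slots_upd slots_new)
  let ?P = "Pow ?S - {?S}"
  have "has_vderiv (\<lambda>t. w \<nu> (y + t *\<^sub>R axis j 1)) (w \<nu>' y)" for y
  proof -
    define Y where "Y t = y + t *\<^sub>R axis j 1" for t
    have Y0: "Y 0 = y" by (simp add: Y_def)
    define G where "G t v = F \<nu> (Y t) v - (\<Sum>T\<in>?P. leibniz_term w ?S T (Y t) v)" for t v
    \<comment> \<open>Product rule for one summand: differentiating the exponential yields
      \<open>B i j\<close>, differentiating the solution raises its index.\<close>
    define L' where "L' T v = (\<Sum>i\<in>UNIV. slot_prod (B i) (?S - T) *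
        ((B i j * ex y i) * E i (w (slot_mult T) (Y 0)) v + ex (Y 0) i * E i (w ((slot_mult T)(j := Suc (slot_mult T j))) y) v))"
      for T v
    define G' where "G' v = F \<nu>' y v - (\<Sum>T\<in>?P. L' T v)" for v
    have G: "has_dderiv G G'"
      unfolding G_def[abs_def] G'_def[abs_def]
    proof (intro has_dderiv_diff has_dderiv_sum)
      show "has_dderiv (\<lambda>t. F \<nu> (Y t)) (F \<nu>' y)"
        using F by (simp add: functional_family_def Y_def \<nu>'_def)
      fix T assume T: "T \<in> ?P"
      have "partial j (w (slot_mult T)) (w ((slot_mult T)(j := Suc (slot_mult T j))))"
        by (rule less) (rule card_slot_mult_less[OF T])
      then have "has_vderiv (\<lambda>t. w (slot_mult T) (Y t)) (w ((slot_mult T)(j := Suc (slot_mult T j))) y)"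
        by (simp add: partial_def Y_def)
      then show "has_dderiv (\<lambda>t. leibniz_term w ?S T (Y t)) (L' T)"
        unfolding leibniz_term_def[abs_def] L'_def[abs_def]
        by (intro has_dderiv_sum has_dderiv_cmult has_dderiv_E V)
          (auto simp: Y_def intro: ex_deriv)
    qed auto
    have "has_vderiv (\<lambda>t. w \<nu> (Y t)) (w \<nu>' y)"
    proof (rule has_vderiv_solution[where e = "\<lambda>t. ex (Y t)" and e' = "\<lambda>i. B i j * ex y i", OF _ _ G])
      show "((\<lambda>t. ex (Y t) i) has_real_derivative B i j * ex y i) (at 0)" for i
        unfolding Y_def by (rule ex_deriv)
      fix t v assume v: "v \<in> V"
      show "wform (ex (Y t)) (w \<nu> (Y t)) v = G t v"
        using eq v by (simp add: leibniz_eq_def sum_Pow_split leibniz_term_self G_def eq_diff_eq)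
    next
      fix v assume v: "v \<in> V"
      \<comment> \<open>If \<open>p\<close> is absent from \<open>T\<close>, the new derivative
        falls on the coefficient; otherwise it falls on the solution.\<close>
      have "F \<nu>' y v = (\<Sum>T\<in>Pow ?S. leibniz_term w (slots \<nu>') T y v)
          + (\<Sum>T\<in>Pow ?S. leibniz_term w (slots \<nu>') (insert p T) y v)"
      proof -
        have "F \<nu>' y v = (\<Sum>T\<in>Pow (insert p ?S). leibniz_term w (slots \<nu>') T y v)"
          using eq v unfolding leibniz_eq_def S'(1)[symmetric] by simp
        then show ?thesis using S'(2) by (simp add: sum_Pow_insert)
      qed
      also have "\<dots> = leibniz_term w (slots \<nu>') ?S y v + leibniz_term w (slots \<nu>') (slots \<nu>') y v
          + (\<Sum>T\<in>?P. leibniz_term w (slots \<nu>') T y v + leibniz_term w (slots \<nu>') (insert p T) y v)"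
        by (simp add: sum_Pow_split sum.distrib S'(1))
      \<comment> \<open>The old full set, with the new slot on the coefficient, is the term
        \<open>wform e' (x 0)\<close> of implicit differentiation.\<close>
      also have "leibniz_term w (slots \<nu>') ?S y v = wform (\<lambda>i. B i j * ex y i) (w \<nu> y) v"
      proof -
        have "slots \<nu>' - ?S = {p}" using S' by auto
        then show ?thesis by (simp add: leibniz_term_def slot_prod_def wform_def p_def mult.assoc)
      qed
      also have "leibniz_term w (slots \<nu>') (slots \<nu>') y v = wform (ex y) (w \<nu>' y) v"
        by (rule leibniz_term_self)
      \<comment> \<open>The remaining subsets, with and without \<open>p\<close>, pair up into the
        product rule for each lower order term.\<close>
      also have "(\<Sum>T\<in>?P. leibniz_term w (slots \<nu>') T y v + leibniz_term w (slots \<nu>') (insert p T) y v)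
          = (\<Sum>T\<in>?P. L' T v)"
      proof (rule sum.cong[OF refl])
        fix T assume T: "T \<in> ?P"
        then have fin: "finite T" "p \<notin> T" using finite_subset[of T ?S] S'(2) by auto
        have "slots \<nu>' - T = insert p (?S - T)" "slots \<nu>' - insert p T = ?S - T"
          using S' T fin by auto
        moreover have "slot_prod (B i) (insert p (?S - T)) = B i j * slot_prod (B i) (?S - T)" for i
          using S'(2) by (simp add: slot_prod_def p_def)
        moreover have "slot_mult (insert p T) = (slot_mult T)(j := Suc (slot_mult T j))"
          using fin unfolding p_def by (rule slot_mult_insert)
        ultimately show "leibniz_term w (slots \<nu>') T y v + leibniz_term w (slots \<nu>') (insert p T) y v = L' T v"
          by (simp add: leibniz_term_def L'_def Y0 algebra_simps sum.distrib)
      qed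
      finally show "wform (ex (Y 0)) (w \<nu>' y) v = G' v - wform (\<lambda>i. B i j * ex y i) (w \<nu> (Y 0)) v"
        by (simp add: G'_def Y0)
    qed (use V ex_pos in auto)
    then show ?thesis by (simp add: Y_def)
  qed
  then show ?case using V by (simp add: partial_def \<nu>'_def)
qed

section \<open>Energy estimate from the Leibniz equations\<close>

lemma functional_family_const:
  assumes "bounded_functional f"
  shows "functional_family (\<lambda>\<nu> y. if \<nu> = (\<lambda>_. 0) then f else (\<lambda>v. 0))"
proof -
  have "\<nu>(j := Suc (\<nu> j)) \<noteq> (\<lambda>_. 0)" for \<nu> :: "'s \<Rightarrow> nat" and j
    by (metis fun_upd_same nat.distinct(1))
  then show ?thesis
    using assms by (simp add: functional_family_def bounded_functional_0 has_dderiv_const)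
qed

lemma nrm_le_wnorm:
  assumes am: "0 < am" "\<And>v. v \<in> V \<Longrightarrow> am * (nrm v)\<^sup>2 \<le> wform (ex y) v v" and v: "v \<in> V"
  shows "nrm v \<le> wnorm (ex y) v / sqrt am"
proof -
  have "sqrt (am * (nrm v)\<^sup>2) \<le> sqrt (wform (ex y) v v)" by (intro real_sqrt_le_mono am v)
  then show ?thesis using am(1) v by (simp add: real_sqrt_mult nrm_nonneg wnorm_def field_simps)
qed

text \<open>Only the source is measured in \<open>nrm\<close>, so only there does coercivity at
  \<open>y\<close> cost a factor \<open>1 / sqrt am\<close>; the lower order terms are compared in
  the energy norm at the same \<open>y\<close>. One factor \<open>wnorm (ex y) (w \<nu> y)\<close>
  is then cancelled.\<close>

lemma leibniz_recursion_bound: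
  assumes eq: "leibniz_eq w F" and V: "\<And>\<nu> y. w \<nu> y \<in> V"
    and b: "\<And>i j. \<bar>B i j\<bar> \<le> b j" and am: "0 < am" "\<And>v. v \<in> V \<Longrightarrow> am * (nrm v)\<^sup>2 \<le> wform (ex y) v v"
    and K: "\<And>v. v \<in> V \<Longrightarrow> F \<nu> y v \<le> K * nrm v" "0 \<le> K"
  shows "wnorm (ex y) (w \<nu> y) \<le> (\<Sum>T\<in>Pow (slots \<nu>) - {slots \<nu>}. slot_prod b (slots \<nu> - T) * wnorm (ex y) (w (slot_mult T) y))
      + K / sqrt am"
proof -
  let ?S = "slots \<nu>" and ?x = "w \<nu> y" and ?n = "wnorm (ex y)"
  have pos: "\<And>i. 0 \<le> ex y i" using ex_pos by (simp add: less_imp_le)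
  have n0: "0 \<le> ?n v" if "v \<in> V" for v using that pos by (rule wnorm_nonneg[rotated])
  have bT: "\<bar>slot_prod (B i) T\<bar> \<le> slot_prod b T" for i T
    unfolding slot_prod_def abs_prod by (intro prod_mono) (auto intro: b)
  have b0: "0 \<le> slot_prod b T" for T using bT[of undefined T] by linarith
  have nn: "nrm ?x \<le> ?n ?x / sqrt am"
    using am V by (rule nrm_le_wnorm)
  have "(?n ?x)\<^sup>2 = F \<nu> y ?x - (\<Sum>T\<in>Pow ?S - {?S}. leibniz_term w ?S T y ?x)"
    using eq V pos by (simp add: wnorm_square leibniz_eq_def sum_Pow_split leibniz_term_self eq_diff_eq)
  also have "\<dots> \<le> K * (?n ?x / sqrt am) + (\<Sum>T\<in>Pow ?S - {?S}. slot_prod b (?S - T) * (?n (w (slot_mult T) y) * ?n ?x))"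
  proof -
    have "- (\<Sum>T\<in>Pow ?S - {?S}. leibniz_term w ?S T y ?x)
        \<le> (\<Sum>T\<in>Pow ?S - {?S}. slot_prod b (?S - T) * (?n (w (slot_mult T) y) * ?n ?x))"
      unfolding sum_negf[symmetric]
    proof (rule sum_mono)
      fix T
      \<comment> \<open>The sign-changing factors are \<open>slot_prod (B i) (?S - T)\<close>; their
        common bound is the same product formed with \<open>b\<close>.\<close>
      have "\<bar>leibniz_term w ?S T y ?x\<bar> \<le> slot_prod b (?S - T) * (?n (w (slot_mult T) y) * ?n ?x)"
        unfolding leibniz_term_def by (rule wform_bound) (auto intro: bT V pos)
      then show "- leibniz_term w ?S T y ?x \<le> slot_prod b (?S - T) * (?n (w (slot_mult T) y) * ?n ?x)" by linarith
    qed
    moreover have "F \<nu> y ?x \<le> K * (?n ?x / sqrt am)"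
      using K(1)[OF V] mult_left_mono[OF nn K(2)] by (rule order_trans)
    ultimately show ?thesis by linarith
  qed
  also have "\<dots> = ((\<Sum>T\<in>Pow ?S - {?S}. slot_prod b (?S - T) * ?n (w (slot_mult T) y)) + K / sqrt am) * ?n ?x"
    by (simp add: distrib_right sum_distrib_right mult.assoc)
  finally have *: "?n ?x * ?n ?x \<le> ((\<Sum>T\<in>Pow ?S - {?S}. slot_prod b (?S - T) * ?n (w (slot_mult T) y)) + K / sqrt am) * ?n ?x"
    by (simp add: power2_eq_square)
  show ?thesis
  \<comment> \<open>A vanishing energy norm cannot be cancelled, but then nonnegativity of the
    right-hand side suffices.\<close>
  proof (cases "?n ?x = 0")
    case True
    have "0 \<le> (\<Sum>T\<in>Pow ?S - {?S}. slot_prod b (?S - T) * ?n (w (slot_mult T) y)) + K / sqrt am"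
      using am K(2) by (intro add_nonneg_nonneg sum_nonneg mult_nonneg_nonneg b0 n0 V) auto
    then show ?thesis using True by simp
  next
    case False
    then have "0 < ?n ?x" using n0[OF V, of \<nu> y] by simp
    from mult_right_le_imp_le[OF * this] show ?thesis .
  qed
qed

section \<open>Uniqueness of mixed partial derivatives up to seminorm zero\<close>

definition partials :: "(real^'s \<Rightarrow> 'v) \<Rightarrow> (('s \<Rightarrow> nat) \<Rightarrow> real^'s \<Rightarrow> 'v) \<Rightarrow> bool" where
  "partials f w \<longleftrightarrow> w (\<lambda>_. 0) = f \<and> (\<forall>y. f y \<in> V) \<and> (\<forall>\<nu> j. partial j (w \<nu>) (w (\<nu>(j := Suc (\<nu> j)))))"

lemma partials_in_V:
  assumes "partials f w"
  shows "w \<nu> y \<in> V"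
  by (cases \<nu> rule: multi_index_cases) (use assms in \<open>auto simp: partials_def partial_def\<close>)

text \<open>The two difference quotients differ by an element of seminorm zero, so
  \<open>f' y - g' y\<close> is bounded by the sum of two remainders that tend to zero.\<close>

lemma partial_unique:
  assumes f: "partial j f f'" and g: "partial j g g'" and V: "\<And>y. f y \<in> V" "\<And>y. g y \<in> V"
    and eq: "\<And>y. nrm (f y - g y) = 0"
  shows "nrm (f' y - g' y) = 0"
proof -
  define qt where "qt h h' t = (1 / t) *\<^sub>R (h (y + t *\<^sub>R axis j 1) - h (y + 0 *\<^sub>R axis j 1)) - h' y"
    for h h' :: "real^'s \<Rightarrow> 'v" and t
  have lim: "((\<lambda>t. nrm (qt f f' t)) \<longlongrightarrow> 0) (at 0)" "((\<lambda>t. nrm (qt g g' t)) \<longlongrightarrow> 0) (at 0)"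
    and V': "f' y \<in> V" "g' y \<in> V"
    using f g unfolding partial_def has_vderiv_def qt_def by blast+
  have qV: "qt f f' t \<in> V" "qt g g' t \<in> V" for t unfolding qt_def by (intro V_closed V V')+
  have "nrm (f' y - g' y) \<le> nrm (qt g g' t) + nrm (qt f f' t)" for t
  proof -
    let ?D = "\<lambda>x. f x - g x"
    let ?d = "(1 / t) *\<^sub>R (?D (y + t *\<^sub>R axis j 1) - ?D (y + 0 *\<^sub>R axis j 1))"
    have DV: "?D x \<in> V" for x by (intro V_closed V)
    have "nrm (?D (y + t *\<^sub>R axis j 1) - ?D (y + 0 *\<^sub>R axis j 1)) \<le> 0"
      using nrm_triangle_diff[OF DV DV, of "y + t *\<^sub>R axis j 1" "y + 0 *\<^sub>R axis j 1"] eq by simp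
    then have "nrm (?D (y + t *\<^sub>R axis j 1) - ?D (y + 0 *\<^sub>R axis j 1)) = 0"
      by (intro order_antisym nrm_nonneg V_closed V)
    then have "nrm ?d = 0"
      by (subst nrm_scale) (auto intro!: V_closed V)
    moreover have "f' y - g' y = (qt g g' t - qt f f' t) + ?d"
      unfolding qt_def by (simp only: scaleR_diff_right) simp
    moreover have "?d \<in> V" by (intro V_closed V)
    ultimately have "nrm (f' y - g' y) \<le> nrm (qt g g' t - qt f f' t)"
      using nrm_triangle[of "qt g g' t - qt f f' t" ?d] qV by (simp add: V_closed)
    also have "\<dots> \<le> nrm (qt g g' t) + nrm (qt f f' t)" by (rule nrm_triangle_diff[OF qV(2) qV(1)])
    finally show ?thesis .
  qed
  then have "nrm (f' y - g' y) \<le> 0"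
    using tendsto_add[OF lim(2) lim(1)]
    by (intro tendsto_lowerbound[where F = "at (0::real)"]) auto
  then show ?thesis by (intro order_antisym nrm_nonneg V_closed V')
qed

text \<open>Makes norm estimates independent of the choice behind \<open>H01_pderiv\<close>. Two
  families agree at order zero, and each higher index arises from one of smaller total order by a
  single derivative.\<close>

lemma partials_unique:
  assumes w: "partials f w" and w': "partials f w'"
  shows "nrm (w \<nu> y) = nrm (w' \<nu> y)"
proof -
  have V: "\<And>\<nu> y. w \<nu> y \<in> V" "\<And>\<nu> y. w' \<nu> y \<in> V" using w w' by (auto intro: partials_in_V)
  have z: "nrm (w \<nu> y - w' \<nu> y) = 0" for y
  proof (induction "card (slots \<nu>)" arbitrary: \<nu> y rule: less_induct)
    case less
    show ?case
    proof (cases \<nu> rule: multi_index_cases)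
      case 1
      have "nrm 0 = 0" using nrm_scale[of 0 0] V_closed(4) by simp
      then show ?thesis using 1 w w' by (simp add: partials_def)
    next
      case (2 \<mu> j)
      have "card (slots \<mu>) < card (slots \<nu>)"
        unfolding 2 by (simp add: slots_upd slots_new)
      then have "nrm (w \<mu> y - w' \<mu> y) = 0" for y by (rule less)
      moreover have "partial j (w \<mu>) (w \<nu>)" "partial j (w' \<mu>) (w' \<nu>)"
        using w w' by (simp_all add: partials_def 2)
      ultimately show ?thesis using partial_unique[of j "w \<mu>" "w \<nu>" "w' \<mu>" "w' \<nu>" y] V by blast
    qed
  qed
  have "nrm (w \<nu> y) \<le> nrm (w' \<nu> y)"
    using nrm_triangle[of "w' \<nu> y" "w \<nu> y - w' \<nu> y"] z V by (simp add: V_closed)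
  moreover have "nrm (w' \<nu> y) \<le> nrm (w \<nu> y)"
    using nrm_triangle_diff[of "w \<nu> y" "w \<nu> y - w' \<nu> y"] z V by (simp add: V_closed)
  ultimately show ?thesis by simp
qed

section \<open>Existence and bounds for the derivatives of state and adjoint\<close>

lemma partials_exist:
  assumes F: "functional_family F" and u: "\<And>y. u y \<in> V"
    and sol: "\<And>y v. v \<in> V \<Longrightarrow> wform (ex y) (u y) v = F (\<lambda>_. 0) y v"
  shows "\<exists>w. partials u w \<and> leibniz_eq w F"
proof (intro exI conjI)
  let ?w = "leibniz_solution F u"
  show eq: "leibniz_eq ?w F" by (rule leibniz_solution_solves[OF F u sol])
  show "partials u ?w"
    unfolding partials_def using leibniz_solution_0 u
    by (auto intro!: leibniz_eq_partial[OF F eq] leibniz_solution_solves[OF F u sol])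
qed

text \<open>The estimate is proved for a family that satisfies the Leibniz equations and then
  carried over to \<open>w\<close>. Coercivity with constant \<open>am\<close> is asked at the one
  \<open>y\<close> of the estimate, while existence rests on positivity of the exponentials.\<close>

theorem state_partials:
  assumes f: "bounded_functional f" and K: "\<And>v. v \<in> V \<Longrightarrow> \<bar>f v\<bar> \<le> K * nrm v" "0 \<le> K"
    and u: "\<And>y. u y \<in> V" and sol: "\<And>y v. v \<in> V \<Longrightarrow> wform (ex y) (u y) v = f v"
    and b: "\<And>i j. \<bar>B i j\<bar> \<le> b j"
  shows "\<exists>w. partials u w"
    and "\<lbrakk>partials u w; 0 < am; \<And>v. v \<in> V \<Longrightarrow> am * (nrm v)\<^sup>2 \<le> wform (ex y) v v\<rbrakk>
      \<Longrightarrow> nrm (w \<nu> y) \<le> fact (card (slots \<nu>)) / ln 2 ^ card (slots \<nu>) * slot_prod b (slots \<nu>) * (K / am)"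
proof -
  let ?F = "\<lambda>\<nu> :: 's \<Rightarrow> nat. \<lambda>y :: real^'s. if \<nu> = (\<lambda>_. 0) then f else (\<lambda>v. 0)"
  obtain w0 where w0: "partials u w0" "leibniz_eq w0 ?F"
    using partials_exist[OF functional_family_const[OF f], of u] u sol by auto
  then show "\<exists>w. partials u w" by blast
  have V: "\<And>\<nu> y. w0 \<nu> y \<in> V" using w0(1) by (rule partials_in_V)
  assume w: "partials u w" and am: "0 < am" "\<And>v. v \<in> V \<Longrightarrow> am * (nrm v)\<^sup>2 \<le> wform (ex y) v v"
  have b0: "0 \<le> b j" for j using b[of undefined j] by linarith
  \<comment> \<open>The source does not depend on the parameter, so it contributes only at order
    zero.\<close>
  define \<kappa> where "\<kappa> n = (if n = 0 then K / sqrt am else 0)" for n :: nat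
  define \<theta> where "\<theta> n = K / sqrt am * (fact n / ln 2 ^ n)" for n :: nat
  have card0: "card (slots \<nu>) = 0 \<longleftrightarrow> \<nu> = (\<lambda>_. 0)" for \<nu> :: "'s \<Rightarrow> nat"
    by (auto simp: card_eq_sum_slot_mult)
  have "wnorm (ex y) (w0 \<nu> y) \<le> \<theta> (card (slots \<nu>)) * slot_prod b (slots \<nu>)"
  proof (rule multi_index_recursion_bound[OF b0, where \<kappa> = \<kappa>])
    fix \<nu> :: "'s \<Rightarrow> nat"
    have eq: "\<kappa> (card (slots \<nu>)) * slot_prod b (slots \<nu>) = (if \<nu> = (\<lambda>_. 0) then K else 0) / sqrt am"
    proof (cases "\<nu> = (\<lambda>_. 0)")
      case True
      then have "slots \<nu> = {}" by (simp add: slots_def)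
      then show ?thesis using True by (simp add: \<kappa>_def slot_prod_def)
    qed (simp add: \<kappa>_def card0)
    show "wnorm (ex y) (w0 \<nu> y) \<le> (\<Sum>T\<in>Pow (slots \<nu>) - {slots \<nu>}. slot_prod b (slots \<nu> - T) * wnorm (ex y) (w0 (slot_mult T) y))
        + \<kappa> (card (slots \<nu>)) * slot_prod b (slots \<nu>)"
      unfolding eq
      by (rule leibniz_recursion_bound[OF w0(2) V b am])
        (use K in \<open>auto intro: order_trans[OF abs_ge_self]\<close>)
  next
    fix n
    show "(\<Sum>l<n. real (n choose l) * \<theta> l) + \<kappa> n \<le> \<theta> n"
    proof (cases "n = 0")
      case False
      have "(\<Sum>l<n. real (n choose l) * \<theta> l) = K / sqrt am * (\<Sum>l<n. real (n choose l) * (fact l / ln 2 ^ l))"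
        by (simp add: \<theta>_def sum_distrib_left algebra_simps)
      also have "\<dots> \<le> \<theta> n"
        unfolding \<theta>_def using K(2) am(1) by (intro mult_left_mono ordered_Bell_bound) auto
      finally show ?thesis using False by (simp add: \<kappa>_def)
    qed (simp add: \<theta>_def \<kappa>_def)
  qed
  \<comment> \<open>Returning to \<open>nrm\<close> costs the second factor
    \<open>1 / sqrt am\<close>.\<close>
  then have "wnorm (ex y) (w0 \<nu> y) / sqrt am \<le> \<theta> (card (slots \<nu>)) * slot_prod b (slots \<nu>) / sqrt am"
    using am(1) by (intro divide_right_mono) auto
  with nrm_le_wnorm[of am y, OF am V[of \<nu> y]]
  have "nrm (w0 \<nu> y) \<le> \<theta> (card (slots \<nu>)) * slot_prod b (slots \<nu>) / sqrt am" by linarith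
  also have "\<dots> = fact (card (slots \<nu>)) / ln 2 ^ card (slots \<nu>) * slot_prod b (slots \<nu>) * (K / (sqrt am * sqrt am))"
    unfolding \<theta>_def by (simp only: divide_inverse inverse_mult_distrib mult_ac)
  also have "sqrt am * sqrt am = am" using am(1) by simp
  finally show "nrm (w \<nu> y) \<le> fact (card (slots \<nu>)) / ln 2 ^ card (slots \<nu>) * slot_prod b (slots \<nu>) * (K / am)"
    using partials_unique[OF w w0(1)] by simp
qed

text \<open>\<open>P\<close> is linear in its first argument, so the error of the pairing is
  \<open>P\<close> applied to the remainder of \<open>x\<close>.\<close>

lemma has_dderiv_pairing:
  assumes x: "has_vderiv x x'" and V: "\<And>t. x t \<in> V" "x' \<in> V"
    and P: "\<And>v. v \<in> V \<Longrightarrow> bounded_functional (\<lambda>u. P u v)"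
      "\<And>u v. \<lbrakk>u \<in> V; v \<in> V\<rbrakk> \<Longrightarrow> \<bar>P u v\<bar> \<le> \<kappa> * nrm u * nrm v"
  shows "has_dderiv (\<lambda>t. P (x t)) (P x')"
  unfolding has_dderiv_def
proof (intro exI[of _ "\<lambda>t. \<kappa> * nrm ((1 / t) *\<^sub>R (x t - x 0) - x')"] conjI allI impI)
  show "((\<lambda>t. \<kappa> * nrm ((1 / t) *\<^sub>R (x t - x 0) - x')) \<longlongrightarrow> 0) (at 0)"
    using x unfolding has_vderiv_def by (rule tendsto_mult_right_zero)
  fix t :: real and v assume t: "t \<noteq> 0" and v: "v \<in> V"
  define r where "r = (1 / t) *\<^sub>R (x t - x 0) - x'"
  have rV: "r \<in> V" unfolding r_def by (intro V_closed V)
  have add: "P (a + c) v = P a v + P c v" and scale: "P (k *\<^sub>R a) v = k * P a v" if "a \<in> V" "c \<in> V" for a c k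
    using P(1)[OF v] that by (auto simp: bounded_functional_def)
  have "x t = x 0 + t *\<^sub>R (r + x')" using t by (simp add: r_def)
  then have "P (x t) v = P (x 0) v + t * (P r v + P x' v)"
    using V rV by (simp add: add scale[where c = 0] V_closed del: scaleR_add_right)
  then have "(P (x t) v - P (x 0) v) / t - P x' v = P r v" using t by simp
  then show "\<bar>(P (x t) v - P (x 0) v) / t - P x' v\<bar> \<le> \<kappa> * nrm ((1 / t) *\<^sub>R (x t - x 0) - x') * nrm v"
    using P(2)[OF rV v] by (simp add: r_def)
qed

text \<open>The scheme is that of the state, but the source \<open>P (wu \<nu> y)\<close> is present
  at every order. By the state bound it grows like \<open>fact n / ln 2 ^ n\<close>, which is the
  source term that \<open>shifted_ordered_Bell_bound\<close> absorbs.\<close>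

theorem adjoint_partials:
  assumes f: "bounded_functional f" and K: "\<And>v. v \<in> V \<Longrightarrow> \<bar>f v\<bar> \<le> K * nrm v" "0 \<le> K"
    and u: "\<And>y. u y \<in> V" and sol: "\<And>y v. v \<in> V \<Longrightarrow> wform (ex y) (u y) v = f v"
    and b: "\<And>i j. \<bar>B i j\<bar> \<le> b j"
    and g: "bounded_functional g" and L: "\<And>v. v \<in> V \<Longrightarrow> \<bar>g v\<bar> \<le> L * nrm v" "0 \<le> L"
    and P: "\<And>v. v \<in> V \<Longrightarrow> bounded_functional (\<lambda>u. P u v)" "\<And>u. u \<in> V \<Longrightarrow> bounded_functional (P u)"
      "\<And>u v. \<lbrakk>u \<in> V; v \<in> V\<rbrakk> \<Longrightarrow> \<bar>P u v\<bar> \<le> \<kappa> * nrm u * nrm v" and \<kappa>: "0 \<le> \<kappa>"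
    and q: "\<And>y. q y \<in> V" and qsol: "\<And>y v. v \<in> V \<Longrightarrow> wform (ex y) (q y) v = P (u y) v - g v"
  shows "\<exists>w. partials q w"
    and "\<lbrakk>partials q w; 0 < am; \<And>v. v \<in> V \<Longrightarrow> am * (nrm v)\<^sup>2 \<le> wform (ex y) v v\<rbrakk>
      \<Longrightarrow> nrm (w \<nu> y) \<le> fact (card (slots \<nu>) + 1) / ln 2 ^ card (slots \<nu>) * slot_prod b (slots \<nu>)
            * (max 1 (\<kappa> / am) / am) * (K + L)"
proof -
  obtain wu where wu: "partials u wu" using state_partials(1)[OF f K u sol b] by blast
  have uV: "wu \<nu> y \<in> V" for \<nu> y using wu by (rule partials_in_V)
  let ?G = "\<lambda>\<nu> :: 's \<Rightarrow> nat. \<lambda>y :: real^'s. if \<nu> = (\<lambda>_. 0) then g else (\<lambda>v. 0)"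
  define F where "F \<nu> y v = P (wu \<nu> y) v - ?G \<nu> y v" for \<nu> y v
  have G: "functional_family ?G" by (rule functional_family_const[OF g])
  have F: "functional_family F"
    unfolding functional_family_def
  proof (intro conjI allI)
    show "bounded_functional (F \<nu> y)" for \<nu> y
      unfolding F_def[abs_def] using G P(2)[OF uV]
      by (intro bounded_functional_diff) (auto simp: functional_family_def)
    fix \<nu> j y
    have "has_vderiv (\<lambda>t. wu \<nu> (y + t *\<^sub>R axis j 1)) (wu (\<nu>(j := Suc (\<nu> j))) y)"
      using wu by (simp add: partials_def partial_def)
    from has_dderiv_pairing[OF this uV uV P(1,3)]
    show "has_dderiv (\<lambda>t. F \<nu> (y + t *\<^sub>R axis j 1)) (F (\<nu>(j := Suc (\<nu> j))) y)"
      unfolding F_def[abs_def] using G unfolding functional_family_def by (intro has_dderiv_diff) auto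
  qed
  have "wu (\<lambda>_. 0) = u" using wu by (simp add: partials_def)
  then obtain w0 where w0: "partials q w0" "leibniz_eq w0 F"
    using partials_exist[OF F, of q] q qsol by (auto simp: F_def)
  then show "\<exists>w. partials q w" by blast
  have V: "\<And>\<nu> y. w0 \<nu> y \<in> V" using w0(1) by (rule partials_in_V)
  assume w: "partials q w" and am: "0 < am" "\<And>v. v \<in> V \<Longrightarrow> am * (nrm v)\<^sup>2 \<le> wform (ex y) v v"
  have b0: "0 \<le> b j" for j using b[of undefined j] by linarith
  \<comment> \<open>A common constant for all orders: the source is bounded by
    \<open>\<kappa> / am * K + L\<close> at order zero and by \<open>\<kappa> / am * K\<close> times
    the factorial weight above. The maximum with 1 covers the part of \<open>g\<close>.\<close>
  define C where "C = max 1 (\<kappa> / am) * (K + L)"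
  have C0: "0 \<le> C" using K(2) L(2) by (simp add: C_def)
  have CK: "\<kappa> / am * K \<le> C" unfolding C_def
    using K(2) L(2) \<kappa> am(1) by (intro mult_mono) auto
  have CKL: "\<kappa> / am * K + L \<le> C"
  proof -
    have "\<kappa> / am * K \<le> max 1 (\<kappa> / am) * K" by (intro mult_right_mono K) auto
    moreover have "1 * L \<le> max 1 (\<kappa> / am) * L" by (intro mult_right_mono L) auto
    ultimately show ?thesis unfolding C_def distrib_left by linarith
  qed
  define \<rho> where "\<rho> n = C / sqrt am * (fact n / ln 2 ^ n)" for n :: nat
  define \<theta> where "\<theta> n = C / sqrt am * (fact (n + 1) / ln 2 ^ n)" for n :: nat
  have "wnorm (ex y) (w0 \<nu> y) \<le> \<theta> (card (slots \<nu>)) * slot_prod b (slots \<nu>)"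
  proof (rule multi_index_recursion_bound[OF b0, where \<kappa> = \<rho>])
    fix \<nu> :: "'s \<Rightarrow> nat"
    define c where "c = fact (card (slots \<nu>)) / ln 2 ^ card (slots \<nu>) * slot_prod b (slots \<nu>)"
    have c0: "0 \<le> c" unfolding c_def by (intro mult_nonneg_nonneg divide_nonneg_nonneg slot_prod_nonneg b0) auto
    have Fb: "F \<nu> y v \<le> C * c * nrm v" if v: "v \<in> V" for v
    proof -
      have "nrm (wu \<nu> y) \<le> c * (K / am)"
        unfolding c_def using state_partials(2)[OF f K u sol b wu am(1) am(2)] by simp
      then have "\<kappa> * nrm (wu \<nu> y) * nrm v \<le> \<kappa> * (c * (K / am)) * nrm v"
        using \<kappa> nrm_nonneg[OF v] by (intro mult_right_mono mult_left_mono)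
      then have 1: "\<bar>P (wu \<nu> y) v\<bar> \<le> (\<kappa> / am * K) * c * nrm v"
        using P(3)[OF uV v, of \<nu> y] by (simp add: algebra_simps)
      show ?thesis
      proof (cases "\<nu> = (\<lambda>_. 0)")
        case True
        then have "slots \<nu> = {}" by (simp add: slots_def)
        then have "c = 1" by (simp add: c_def slot_prod_def)
        then have "F \<nu> y v \<le> (\<kappa> / am * K + L) * nrm v"
          using 1 L(1)[OF v] True by (simp add: F_def distrib_right)
        also have "\<dots> \<le> C * nrm v" by (intro mult_right_mono CKL nrm_nonneg v)
        finally show ?thesis using \<open>c = 1\<close> by simp
      next
        case False
        then have "F \<nu> y v \<le> (\<kappa> / am * K) * c * nrm v" using 1 by (simp add: F_def)
        also have "\<dots> \<le> C * c * nrm v" by (intro mult_right_mono CK nrm_nonneg v c0)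
        finally show ?thesis .
      qed
    qed
    have eq: "\<rho> (card (slots \<nu>)) * slot_prod b (slots \<nu>) = C * c / sqrt am"
      by (simp add: \<rho>_def c_def mult_ac)
    show "wnorm (ex y) (w0 \<nu> y) \<le> (\<Sum>T\<in>Pow (slots \<nu>) - {slots \<nu>}. slot_prod b (slots \<nu> - T) * wnorm (ex y) (w0 (slot_mult T) y))
        + \<rho> (card (slots \<nu>)) * slot_prod b (slots \<nu>)"
      unfolding eq by (rule leibniz_recursion_bound[OF w0(2) V b am Fb]) (auto simp: C0 c0)
  next
    fix n
    have "(\<Sum>l<n. real (n choose l) * \<theta> l) + \<rho> n
        = C / sqrt am * ((\<Sum>l<n. real (n choose l) * (fact (l + 1) / ln 2 ^ l)) + fact n / ln 2 ^ n)"
      unfolding \<theta>_def \<rho>_def distrib_left sum_distrib_left by (simp add: mult_ac)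
    also have "\<dots> \<le> \<theta> n"
      unfolding \<theta>_def using C0 am(1) by (intro mult_left_mono shifted_ordered_Bell_bound) auto
    finally show "(\<Sum>l<n. real (n choose l) * \<theta> l) + \<rho> n \<le> \<theta> n" .
  qed
  then have "wnorm (ex y) (w0 \<nu> y) / sqrt am \<le> \<theta> (card (slots \<nu>)) * slot_prod b (slots \<nu>) / sqrt am"
    using am(1) by (intro divide_right_mono) auto
  with nrm_le_wnorm[of am y, OF am V[of \<nu> y]]
  have "nrm (w0 \<nu> y) \<le> \<theta> (card (slots \<nu>)) * slot_prod b (slots \<nu>) / sqrt am" by linarith
  also have "\<dots> = fact (card (slots \<nu>) + 1) / ln 2 ^ card (slots \<nu>) * slot_prod b (slots \<nu>) * (C / (sqrt am * sqrt am))"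
    unfolding \<theta>_def by (simp only: divide_inverse inverse_mult_distrib mult_ac)
  also have "sqrt am * sqrt am = am" using am(1) by simp
  also have "C / am = max 1 (\<kappa> / am) / am * (K + L)" by (simp add: C_def)
  finally show "nrm (w \<nu> y) \<le> fact (card (slots \<nu>) + 1) / ln 2 ^ card (slots \<nu>) * slot_prod b (slots \<nu>)
      * (max 1 (\<kappa> / am) / am) * (K + L)"
    using partials_unique[OF w w0(1)] by (simp add: mult.assoc)
qed

end

section \<open>Smooth bump functions on boxes\<close>

text \<open>With \<open>x = 1 / t\<close>, the chain rule sends \<open>p(x) exp(-x)\<close> to
  \<open>x^2 (p(x) - p'(x)) exp(-x)\<close>; \<open>[:0, 0, 1:]\<close> is the polynomial
  \<open>x^2\<close>.\<close>

fun flat_poly :: "nat \<Rightarrow> real poly" where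
  "flat_poly 0 = 1"
| "flat_poly (Suc n) = [:0, 0, 1:] * (flat_poly n - pderiv (flat_poly n))"

text \<open>The \<open>n\<close>-th derivative of \<open>exp (- 1 / t)\<close> for \<open>t > 0\<close>, extended by \<open>0\<close>.\<close>

definition flat :: "nat \<Rightarrow> real \<Rightarrow> real" where
  "flat n t = (if 0 < t then poly (flat_poly n) (1 / t) * exp (- (1 / t)) else 0)"

text \<open>The power \<open>x ^ k\<close> is carried along so that induction on the polynomial can
  absorb the factor \<open>x\<close> coming from \<open>pCons\<close>.\<close>

lemma power_poly_exp_tendsto_0: "((\<lambda>x::real. x ^ k * poly p x / exp x) \<longlongrightarrow> 0) at_top"
proof (induction p arbitrary: k)
  case (pCons a p)
  have "((\<lambda>x::real. a * (x ^ k / exp x) + x ^ Suc k * poly p x / exp x) \<longlongrightarrow> a * 0 + 0) at_top"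
    by (intro tendsto_intros tendsto_power_div_exp_0 pCons)
  moreover have "x ^ k * poly (pCons a p) x / exp x = a * (x ^ k / exp x) + x ^ Suc k * poly p x / exp x" for x :: real
    by (simp add: distrib_left add_divide_distrib mult_ac)
  ultimately show ?case by simp
qed simp

lemma poly_exp_at_right: "((\<lambda>t::real. poly p (1 / t) * exp (- (1 / t))) \<longlongrightarrow> 0) (at_right 0)"
proof -
  have "((\<lambda>x::real. poly p x * exp (- x)) \<longlongrightarrow> 0) at_top"
    using power_poly_exp_tendsto_0[of 0 p] by (simp add: exp_minus field_simps)
  from filterlim_compose[OF this filterlim_inverse_at_top_right]
  show ?thesis by (simp add: inverse_eq_divide)
qed

lemma flat_deriv: "(flat n has_field_derivative flat (Suc n) t) (at t)"
proof -
  consider "0 < t" | "t = 0" | "t < 0" by linarith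
  then show ?thesis
  proof cases
    case 1
    have "((\<lambda>t. poly (flat_poly n) (1 / t) * exp (- (1 / t))) has_field_derivative flat (Suc n) t) (at t)"
      using 1 by (auto intro!: derivative_eq_intros simp: flat_def field_simps power2_eq_square)
    then show ?thesis
      using 1 by (rule_tac has_field_derivative_transform_within_open[where S = "{0<..}"]) (auto simp: flat_def)
  next
    case 2
    have "((\<lambda>h. (flat n (0 + h) - flat n 0) / h) \<longlongrightarrow> 0) (at 0)"
    proof (rule filterlim_split_at)
      have "((\<lambda>h. (flat n (0 + h) - flat n 0) / h) \<longlongrightarrow> 0) (at_left 0) \<longleftrightarrow> ((\<lambda>h. 0) \<longlongrightarrow> (0::real)) (at_left (0::real))"
        by (rule tendsto_cong) (auto simp: flat_def eventually_at_left_field intro: exI[of _ "-1"])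
      then show "((\<lambda>h. (flat n (0 + h) - flat n 0) / h) \<longlongrightarrow> 0) (at_left 0)" by simp
      \<comment> \<open>Dividing by \<open>h\<close> multiplies the polynomial by its variable,
        which is \<open>pCons 0\<close>; the exponential still wins.\<close>
      have "((\<lambda>h. (flat n (0 + h) - flat n 0) / h) \<longlongrightarrow> 0) (at_right 0) \<longleftrightarrow>
          ((\<lambda>h. poly (pCons 0 (flat_poly n)) (1 / h) * exp (- (1 / h))) \<longlongrightarrow> (0::real)) (at_right (0::real))"
        by (rule tendsto_cong) (auto simp: flat_def eventually_at_right_field intro: exI[of _ 1])
      then show "((\<lambda>h. (flat n (0 + h) - flat n 0) / h) \<longlongrightarrow> 0) (at_right 0)"
        using poly_exp_at_right by blast
    qed
    moreover have "flat (Suc n) t = 0" using 2 by (simp add: flat_def)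
    ultimately show ?thesis using 2 by (simp add: DERIV_def)
  next
    case 3
    have "((\<lambda>t. 0) has_field_derivative flat (Suc n) t) (at t)" using 3 by (simp add: flat_def)
    then show ?thesis
      using 3 by (rule_tac has_field_derivative_transform_within_open[where S = "{..<0}"]) (auto simp: flat_def)
  qed
qed

lemma flat_0_bounds: "0 \<le> flat 0 t" "flat 0 t \<le> 1" "flat 0 t \<noteq> 0 \<longleftrightarrow> 0 < t"
  by (auto simp: flat_def)

lemma flat_scaled_tendsto: "(\<lambda>m. flat 0 (real (Suc m) * t)) \<longlonglongrightarrow> (if 0 < t then 1 else 0)"
proof (cases "0 < t")
  case True
  have "(\<lambda>m. exp (- (1 / t * (1 / real (Suc m))))) \<longlonglongrightarrow> exp (- (1 / t * 0))"
    by (intro tendsto_intros LIMSEQ_Suc[OF lim_1_over_n])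
  moreover have "flat 0 (real (Suc m) * t) = exp (- (1 / t * (1 / real (Suc m))))" for m
    using True by (simp add: flat_def mult.commute)
  ultimately show ?thesis using True by simp
qed (simp add: flat_def zero_less_mult_iff)

section \<open>Calculus of \<open>C_k\<close> functions\<close>

lemma grad_eq: "(f has_derivative f') (at x) \<Longrightarrow> grad f x = (\<chi> i. f' (axis i 1))"
  unfolding grad_def using frechet_derivative_at by metis

lemma C_k_Suc_D: "C_k (Suc k) f \<Longrightarrow> C_k k f"
proof (induction k arbitrary: f)
  case 0
  then show ?case by (simp add: differentiable_imp_continuous_on)
qed (auto simp del: C_k.simps(1))

lemma C_k_const: "C_k k (\<lambda>x::real^'n. c)"
proof (induction k arbitrary: c)
  case (Suc k)
  have "(\<lambda>x. grad (\<lambda>x. c) x $ i) = (\<lambda>x :: real^'n. 0)" for i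
    by (rule ext) (simp add: grad_eq[OF has_derivative_const])
  then show ?case using Suc by simp
qed simp

lemma C_k_differentiable: "C_k (Suc k) f \<Longrightarrow> (f has_derivative frechet_derivative f (at x)) (at x)"
  by (simp add: differentiable_on_def frechet_derivative_works[symmetric])

lemma C_k_lincomb: "\<lbrakk>C_k k f; C_k k g\<rbrakk> \<Longrightarrow> C_k k (\<lambda>x. c * f x + g x)"
proof (induction k arbitrary: f g)
  case (Suc k)
  note d = C_k_differentiable[OF Suc.prems(1)] C_k_differentiable[OF Suc.prems(2)]
  have *: "((\<lambda>x. c * f x + g x) has_derivative (\<lambda>h. c * frechet_derivative f (at x) h + frechet_derivative g (at x) h)) (at x)" for x
    by (intro derivative_intros d)
  have "(\<lambda>x. grad (\<lambda>x. c * f x + g x) x $ i) = (\<lambda>x. c * (grad f x $ i) + grad g x $ i)" for i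
    by (rule ext) (simp add: grad_eq[OF *] grad_def)
  moreover have "(\<lambda>x. c * f x + g x) differentiable_on UNIV"
    using * unfolding differentiable_on_def differentiable_def by auto
  ultimately show ?case using Suc by simp
qed (auto intro!: continuous_intros)

lemma C_k_mult: "\<lbrakk>C_k k f; C_k k g\<rbrakk> \<Longrightarrow> C_k k (\<lambda>x. f x * g x)"
proof (induction k arbitrary: f g)
  case (Suc k)
  note d = C_k_differentiable[OF Suc.prems(1)] C_k_differentiable[OF Suc.prems(2)]
  have *: "((\<lambda>x. f x * g x) has_derivative (\<lambda>h. f x * frechet_derivative g (at x) h + frechet_derivative f (at x) h * g x)) (at x)" for x
    by (rule has_derivative_mult[OF d])
  \<comment> \<open>The factor \<open>1\<close> gives the product rule the shape of
    \<open>C_k_lincomb\<close>.\<close>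
  have "(\<lambda>x. grad (\<lambda>x. f x * g x) x $ i) = (\<lambda>x. 1 * (f x * (grad g x $ i)) + (grad f x $ i) * g x)" for i
    by (rule ext) (simp add: grad_eq[OF *] grad_def)
  moreover have "C_k k (\<lambda>x. 1 * (f x * (grad g x $ i)) + (grad f x $ i) * g x)" for i
    using Suc.prems C_k_Suc_D[OF Suc.prems(1)] C_k_Suc_D[OF Suc.prems(2)]
    by (intro C_k_lincomb Suc.IH) auto
  moreover have "(\<lambda>x. f x * g x) differentiable_on UNIV"
    using * unfolding differentiable_on_def differentiable_def by auto
  ultimately show ?case by simp
qed (auto intro!: continuous_intros)

lemma C_k_prod: "(\<And>i. i \<in> I \<Longrightarrow> C_k k (f i)) \<Longrightarrow> C_k k (\<lambda>x. \<Prod>i\<in>I. f i x)"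
  by (induction I rule: infinite_finite_induct) (auto intro: C_k_const C_k_mult)

text \<open>The functions \<open>flat n\<close> are closed under differentiation, so the induction
  runs over every \<open>n\<close> at once.\<close>

lemma C_k_flat: "C_k k (\<lambda>x. flat n (c * x $ i + d))"
proof (induction k arbitrary: n)
  case 0
  have "continuous_on UNIV (flat n)"
    by (rule DERIV_continuous_on) (rule flat_deriv[THEN DERIV_subset], simp)
  then show ?case
    by (auto intro!: continuous_on_compose2[of UNIV "flat n"] continuous_intros)
next
  case (Suc k)
  have *: "((\<lambda>x. flat n (c * x $ i + d)) has_derivative (\<lambda>h. flat (Suc n) (c * x $ i + d) * (c * h $ i))) (at x)" for x
  proof -
    have "(flat n has_derivative (*) (flat (Suc n) (c * x $ i + d))) (at (c * x $ i + d))"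
      using flat_deriv by (simp add: has_field_derivative_def)
    moreover have "((\<lambda>x. c * x $ i + d) has_derivative (\<lambda>h. c * h $ i)) (at x)"
      by (auto intro!: derivative_eq_intros bounded_linear_imp_has_derivative)
    ultimately show ?thesis by (rule_tac has_derivative_compose)
  qed
  have "(\<lambda>x. grad (\<lambda>x. flat n (c * x $ i + d)) x $ l) = (\<lambda>x. flat (Suc n) (c * x $ i + d) * (if l = i then c else 0))" for l
    by (rule ext) (simp add: grad_eq[OF *] axis_def)
  then have "C_k k (\<lambda>x. grad (\<lambda>x. flat n (c * x $ i + d)) x $ l)" for l
    using Suc by (simp add: C_k_mult C_k_const)
  moreover have "(\<lambda>x. flat n (c * x $ i + d)) differentiable_on UNIV"
    using * unfolding differentiable_on_def differentiable_def by auto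
  ultimately show ?case by simp
qed

text \<open>The box where the bump is nonzero does not depend on \<open>m\<close>; the dilation by
  \<open>Suc m\<close> only steepens the flanks. The bumps thus approximate the indicator of the
  open box pointwise, without any convolution.\<close>

definition bump :: "nat \<Rightarrow> real^'n \<Rightarrow> real^'n \<Rightarrow> real^'n \<Rightarrow> real" where
  "bump m a b x = (\<Prod>i\<in>UNIV. flat 0 (real (Suc m) * (x $ i - a $ i)) * flat 0 (real (Suc m) * (b $ i - x $ i)))"

lemma bump_nonzero: "{x. bump m a b x \<noteq> 0} = box a b"
  by (auto simp: bump_def flat_0_bounds mem_box_cart zero_less_mult_iff)

lemma bump_bounds: "0 \<le> bump m a b x" "bump m a b x \<le> 1"
  unfolding bump_def by (auto intro!: prod_nonneg prod_le_1 mult_nonneg_nonneg mult_le_one flat_0_bounds(1,2))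

lemma C_k_bump: "C_k k (bump m a b)"
proof -
  have "bump m a b = (\<lambda>x. \<Prod>i\<in>UNIV. flat 0 (real (Suc m) * x $ i + - (real (Suc m) * a $ i)) *
      flat 0 ((- real (Suc m)) * x $ i + real (Suc m) * b $ i))"
    by (intro ext) (simp add: bump_def algebra_simps)
  then show ?thesis by (simp only:) (intro C_k_prod C_k_mult C_k_flat)
qed

lemma bump_test_function:
  assumes "cbox a b \<subseteq> D"
  shows "bump m a b \<in> test_functions D"
proof -
  have "closure {x. bump m a b x \<noteq> 0} \<subseteq> cbox a b"
    unfolding bump_nonzero by (intro closure_minimal box_subset_cbox closed_cbox)
  then show ?thesis
    using assms C_k_bump bounded_subset[OF bounded_cbox box_subset_cbox]
    by (auto simp: test_functions_def compact_closure bump_nonzero)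
qed

lemma bump_tendsto: "(\<lambda>m. bump m a b x) \<longlonglongrightarrow> indicator (box a b) x"
proof -
  have "(\<lambda>m. bump m a b x) \<longlonglongrightarrow> (\<Prod>i\<in>UNIV. (if 0 < x $ i - a $ i then 1 else 0) * (if 0 < b $ i - x $ i then 1 else 0))"
    unfolding bump_def by (intro tendsto_prod tendsto_mult flat_scaled_tendsto)
  also have "(\<Prod>i\<in>UNIV. (if 0 < x $ i - a $ i then 1 else 0) * (if 0 < b $ i - x $ i then 1 else 0)) = (indicator (box a b) x :: real)"
    by (auto simp: indicator_def mem_box_cart intro!: prod.neutral)
  finally show ?thesis .
qed

section \<open>Square-integrable functions on a bounded open set\<close>

lemma norm_add_square_le: "(norm (a + b))\<^sup>2 \<le> 2 * (norm a)\<^sup>2 + 2 * (norm (b :: 'a::real_normed_vector))\<^sup>2"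
proof -
  have "(norm (a + b))\<^sup>2 \<le> (norm a + norm b)\<^sup>2" by (intro power_mono norm_triangle_ineq) simp
  also have "\<dots> \<le> (norm a + norm b)\<^sup>2 + (norm a - norm b)\<^sup>2" by simp
  also have "\<dots> = 2 * (norm a)\<^sup>2 + 2 * (norm b)\<^sup>2" by (simp add: power2_eq_square algebra_simps)
  finally show ?thesis .
qed

locale bounded_open =
  fixes D :: "(real^'n) set"
  assumes open_D: "open D" and bounded_D: "bounded D"
begin

lemma D_lmeasurable: "D \<in> lmeasurable"
  using open_D bounded_D by (simp add: lmeasurable_open)

lemma D_lebesgue [measurable]: "D \<in> sets lebesgue"
  using D_lmeasurable by (rule fmeasurableD)

lemma finite_measure_D: "finite_measure (lebesgue_on D)"
  using D_lmeasurable by (rule finite_measure_lebesgue_on)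

lemma L2_measurable: "f \<in> L2_on D \<Longrightarrow> f \<in> borel_measurable (lebesgue_on D)"
  by (simp add: L2_on_def)

lemma L2_square_integrable: "f \<in> L2_on D \<Longrightarrow> integrable (lebesgue_on D) (\<lambda>x. (norm (f x))\<^sup>2)"
  by (simp add: L2_on_def)

lemma L2_I:
  assumes "f \<in> borel_measurable (lebesgue_on D)" "integrable (lebesgue_on D) g"
    "\<And>x. x \<in> D \<Longrightarrow> (norm (f x))\<^sup>2 \<le> g x"
  shows "f \<in> L2_on D"
proof -
  have "integrable (lebesgue_on D) (\<lambda>x. (norm (f x))\<^sup>2)"
  proof (rule Bochner_Integration.integrable_bound[OF assms(2)])
    show "(\<lambda>x. (norm (f x))\<^sup>2) \<in> borel_measurable (lebesgue_on D)" using assms(1) by measurable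
    show "AE x in lebesgue_on D. norm ((norm (f x))\<^sup>2) \<le> norm (g x)"
    proof (rule AE_I2)
      fix x assume "x \<in> space (lebesgue_on D)"
      then have "(norm (f x))\<^sup>2 \<le> g x" using assms(3) by simp
      then show "norm ((norm (f x))\<^sup>2) \<le> norm (g x)" by simp
    qed
  qed
  then show ?thesis using assms(1) by (simp add: L2_on_def)
qed

lemma L2_scaleR: "f \<in> L2_on D \<Longrightarrow> (\<lambda>x. c *\<^sub>R f x) \<in> L2_on D"
  by (rule L2_I[where g = "\<lambda>x. c\<^sup>2 * (norm (f x))\<^sup>2"])
    (auto intro: L2_square_integrable intro!: borel_measurable_const_scaleR[OF L2_measurable]
      simp: power_mult_distrib)

lemma L2_add: "\<lbrakk>f \<in> L2_on D; g \<in> L2_on D\<rbrakk> \<Longrightarrow> (\<lambda>x. f x + g x) \<in> L2_on D"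
  by (rule L2_I[where g = "\<lambda>x. 2 * (norm (f x))\<^sup>2 + 2 * (norm (g x))\<^sup>2"])
    (auto intro!: borel_measurable_add[OF L2_measurable L2_measurable] norm_add_square_le
      Bochner_Integration.integrable_add integrable_mult_right L2_square_integrable)

lemma L2_diff: "\<lbrakk>f \<in> L2_on D; g \<in> L2_on D\<rbrakk> \<Longrightarrow> (\<lambda>x. f x - g x) \<in> L2_on D"
  using L2_add[of f "\<lambda>x. (-1) *\<^sub>R g x"] L2_scaleR[of g "-1"] by simp

lemma L2_norm: "f \<in> L2_on D \<Longrightarrow> (\<lambda>x. norm (f x)) \<in> L2_on D"
  by (rule L2_I[where g = "\<lambda>x. (norm (f x))\<^sup>2"])
    (auto intro: L2_square_integrable intro!: measurable_compose[OF L2_measurable borel_measurable_norm])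

lemma l2norm_norm: "l2norm D (\<lambda>x. norm (f x)) = l2norm D f"
  by (simp add: l2norm_def)

lemma L2_bounded:
  assumes "f \<in> borel_measurable (lebesgue_on D)" "\<And>x. x \<in> D \<Longrightarrow> norm (f x) \<le> C"
  shows "f \<in> L2_on D"
proof (rule L2_I[where g = "\<lambda>x. C\<^sup>2"])
  show "integrable (lebesgue_on D) (\<lambda>x. C\<^sup>2)" using finite_measure_D by (rule finite_measure.integrable_const)
qed (use assms in \<open>auto intro!: power_mono\<close>)

lemma L2_continuous:
  fixes f :: "real^'n \<Rightarrow> 'a::euclidean_space"
  assumes "continuous_on UNIV f"
  shows "f \<in> L2_on D"
proof -
  have "compact (f ` closure D)"
    using bounded_D by (intro compact_continuous_image continuous_on_subset[OF assms]) (auto simp: compact_closure)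
  then obtain C where "\<And>x. x \<in> closure D \<Longrightarrow> norm (f x) \<le> C"
    using compact_imp_bounded bounded_iff by (metis imageI)
  moreover have "f \<in> borel_measurable (lebesgue_on D)"
    by (intro continuous_imp_measurable_on_sets_lebesgue continuous_on_subset[OF assms] D_lebesgue) auto
  ultimately show ?thesis using closure_subset by (intro L2_bounded) auto
qed

lemma L2_mult_inner_integrable:
  assumes f: "f \<in> L2_on D" and g: "g \<in> L2_on D" and W: "W \<in> borel_measurable (lebesgue_on D)"
    and C: "\<And>x. x \<in> D \<Longrightarrow> \<bar>W x\<bar> \<le> C"
  shows "integrable (lebesgue_on D) (\<lambda>x. W x * (f x \<bullet> g x))"
proof (rule Bochner_Integration.integrable_bound)
  show "integrable (lebesgue_on D) (\<lambda>x. C * ((norm (f x))\<^sup>2 + (norm (g x))\<^sup>2))"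
    using f g by (intro integrable_mult_right Bochner_Integration.integrable_add L2_square_integrable)
  show "(\<lambda>x. W x * (f x \<bullet> g x)) \<in> borel_measurable (lebesgue_on D)"
    using L2_measurable[OF f] L2_measurable[OF g] W by measurable
  show "AE x in lebesgue_on D. norm (W x * (f x \<bullet> g x)) \<le> norm (C * ((norm (f x))\<^sup>2 + (norm (g x))\<^sup>2))"
  proof (rule AE_I2)
    fix x assume "x \<in> space (lebesgue_on D)"
    then have W: "\<bar>W x\<bar> \<le> C" using C by simp
    have "\<bar>f x \<bullet> g x\<bar> \<le> norm (f x) * norm (g x)" by (rule Cauchy_Schwarz_ineq2)
    also have "\<dots> \<le> (norm (f x))\<^sup>2 + (norm (g x))\<^sup>2"
      using sum_squares_bound[of "norm (f x)" "norm (g x)"] mult_nonneg_nonneg[OF norm_ge_zero norm_ge_zero, of "f x" "g x"]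
      by linarith
    finally have "\<bar>W x\<bar> * \<bar>f x \<bullet> g x\<bar> \<le> C * ((norm (f x))\<^sup>2 + (norm (g x))\<^sup>2)"
      using W by (intro mult_mono) auto
    moreover have "0 \<le> C" using W by linarith
    ultimately show "norm (W x * (f x \<bullet> g x)) \<le> norm (C * ((norm (f x))\<^sup>2 + (norm (g x))\<^sup>2))"
      by (simp add: abs_mult)
  qed
qed

lemma L2_inner_integrable: "\<lbrakk>f \<in> L2_on D; g \<in> L2_on D\<rbrakk> \<Longrightarrow> integrable (lebesgue_on D) (\<lambda>x. f x \<bullet> g x)"
  using L2_mult_inner_integrable[of f g "\<lambda>_. 1" 1] by simp

lemma L2_mult_integrable:
  "\<lbrakk>f \<in> L2_on D; g \<in> L2_on D\<rbrakk> \<Longrightarrow> integrable (lebesgue_on D) (\<lambda>x. f x * g x :: real)"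
  using L2_inner_integrable[of f g] by simp

lemma L2_scaleR_integrable:
  assumes f: "f \<in> L2_on D" and g: "g \<in> L2_on D"
  shows "integrable (lebesgue_on D) (\<lambda>x. f x *\<^sub>R g x)"
proof (rule Bochner_Integration.integrable_bound)
  show "integrable (lebesgue_on D) (\<lambda>x. norm (f x) * norm (g x))"
    by (intro L2_mult_integrable L2_norm f g)
  show "(\<lambda>x. f x *\<^sub>R g x) \<in> borel_measurable (lebesgue_on D)"
    using L2_measurable[OF f] L2_measurable[OF g] by measurable
qed auto

lemma const_L2: "(\<lambda>x. c) \<in> L2_on D"
  by (rule L2_continuous) simp

lemma L2_integrable: "f \<in> L2_on D \<Longrightarrow> integrable (lebesgue_on D) f"
  using L2_scaleR_integrable[OF const_L2, of f 1] by simp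

lemma l2norm_nonneg: "0 \<le> l2norm D f"
  by (simp add: l2norm_def)

lemma l2norm_square: "(l2norm D f)\<^sup>2 = (LINT x|lebesgue_on D. f x \<bullet> f x)"
  by (simp add: l2norm_def power2_norm_eq_inner)

lemma l2norm_cong_AE:
  assumes "AE x in lebesgue_on D. f x = g x" "f \<in> L2_on D" "g \<in> L2_on D"
  shows "l2norm D f = l2norm D g"
  unfolding l2norm_def
  by (intro arg_cong[of _ _ sqrt] integral_cong_AE)
    (use assms in \<open>auto intro!: borel_measurable_power measurable_compose[OF L2_measurable borel_measurable_norm]\<close>)

lemma l2norm_scaleR: "l2norm D (\<lambda>x. c *\<^sub>R f x) = \<bar>c\<bar> * l2norm D f"
  by (simp add: l2norm_def power_mult_distrib real_sqrt_mult)

lemma l2_Cauchy_Schwarz: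
  assumes f: "f \<in> L2_on D" and g: "g \<in> L2_on D"
  shows "\<bar>LINT x|lebesgue_on D. f x \<bullet> g x\<bar> \<le> l2norm D f * l2norm D g"
proof -
  note int = L2_inner_integrable[OF f f] L2_inner_integrable[OF f g] L2_inner_integrable[OF g g]
  have "0 \<le> (l2norm D f)\<^sup>2 - 2 * t * (LINT x|lebesgue_on D. f x \<bullet> g x) + t\<^sup>2 * (l2norm D g)\<^sup>2" for t
  proof -
    have "0 \<le> (LINT x|lebesgue_on D. (f x - t *\<^sub>R g x) \<bullet> (f x - t *\<^sub>R g x))" by simp
    also have "\<dots> = (LINT x|lebesgue_on D. f x \<bullet> f x - 2 * t * (f x \<bullet> g x) + t\<^sup>2 * (g x \<bullet> g x))"
      by (intro Bochner_Integration.integral_cong refl)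
        (simp add: algebra_simps inner_diff_left inner_diff_right inner_commute power2_eq_square)
    also have "\<dots> = (l2norm D f)\<^sup>2 - 2 * t * (LINT x|lebesgue_on D. f x \<bullet> g x) + t\<^sup>2 * (l2norm D g)\<^sup>2"
      unfolding l2norm_square using int by simp
    finally show ?thesis .
  qed
  then have "(LINT x|lebesgue_on D. f x \<bullet> g x)\<^sup>2 \<le> (l2norm D f)\<^sup>2 * (l2norm D g)\<^sup>2"
    by (rule quadratic_nonneg_imp_square_le) simp
  then have "(LINT x|lebesgue_on D. f x \<bullet> g x)\<^sup>2 \<le> (l2norm D f * l2norm D g)\<^sup>2"
    by (simp add: power_mult_distrib)
  then have "\<bar>LINT x|lebesgue_on D. f x \<bullet> g x\<bar> \<le> \<bar>l2norm D f * l2norm D g\<bar>"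
    by (simp only: abs_le_square_iff)
  then show ?thesis by (simp add: l2norm_nonneg)
qed

lemma l2norm_triangle:
  assumes f: "f \<in> L2_on D" and g: "g \<in> L2_on D"
  shows "l2norm D (\<lambda>x. f x + g x) \<le> l2norm D f + l2norm D g"
proof -
  note int = L2_inner_integrable[OF f f] L2_inner_integrable[OF f g] L2_inner_integrable[OF g g]
  have "(l2norm D (\<lambda>x. f x + g x))\<^sup>2
      = (LINT x|lebesgue_on D. f x \<bullet> f x + 2 * (f x \<bullet> g x) + g x \<bullet> g x)"
    unfolding l2norm_square
    by (intro Bochner_Integration.integral_cong refl) (simp add: inner_add_left inner_add_right inner_commute)
  also have "\<dots> = (l2norm D f)\<^sup>2 + 2 * (LINT x|lebesgue_on D. f x \<bullet> g x) + (l2norm D g)\<^sup>2"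
    unfolding l2norm_square using int by simp
  also have "\<dots> \<le> (l2norm D f + l2norm D g)\<^sup>2"
    using l2_Cauchy_Schwarz[OF f g] by (simp add: power2_sum)
  finally show ?thesis by (rule power2_le_imp_le) (simp add: l2norm_nonneg)
qed

lemma norm_integral_scaleR_le:
  assumes f: "f \<in> L2_on D" and g: "g \<in> L2_on D"
  shows "norm (LINT x|lebesgue_on D. f x *\<^sub>R g x) \<le> l2norm D f * l2norm D g"
proof -
  have "norm (LINT x|lebesgue_on D. f x *\<^sub>R g x) \<le> (LINT x|lebesgue_on D. norm (f x) \<bullet> norm (g x))"
    using integral_norm_bound[of "lebesgue_on D" "\<lambda>x. f x *\<^sub>R g x"] by simp
  also have "\<dots> \<le> l2norm D (\<lambda>x. norm (f x)) * l2norm D (\<lambda>x. norm (g x))"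
    using l2_Cauchy_Schwarz[OF L2_norm[OF f] L2_norm[OF g]] by linarith
  finally show ?thesis by (simp only: l2norm_norm)
qed

text \<open>Riesz-Fischer. The increments of a rapidly Cauchy subsequence are summable in L1,
  because \<open>D\<close> has finite measure, so the subsequence converges almost everywhere.
  Fatou's lemma then gives norm convergence of the full sequence.\<close>

theorem L2_complete:
  fixes f :: "nat \<Rightarrow> real^'n \<Rightarrow> 'a::euclidean_space"
  assumes f: "\<And>k. f k \<in> L2_on D"
    and Cauchy: "\<And>e. 0 < e \<Longrightarrow> \<exists>K. \<forall>m\<ge>K. \<forall>n\<ge>K. l2norm D (\<lambda>x. f m x - f n x) < e"
  shows "\<exists>l\<in>L2_on D. (\<lambda>k. l2norm D (\<lambda>x. f k x - l x)) \<longlonglongrightarrow> 0"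
proof -
  let ?M = "lebesgue_on D"
  have "\<exists>K. \<forall>m\<ge>K. \<forall>n\<ge>K. l2norm D (\<lambda>x. f m x - f n x) < (1/2) ^ k" for k :: nat
    by (rule Cauchy) simp
  then obtain K where K: "\<And>k m n. \<lbrakk>m \<ge> K k; n \<ge> K k\<rbrakk> \<Longrightarrow> l2norm D (\<lambda>x. f m x - f n x) < (1/2) ^ k"
    by metis
  \<comment> \<open>Summing the thresholds makes both \<open>r k\<close> and
    \<open>r (Suc k)\<close> at least \<open>K k\<close>; the added \<open>k\<close> moves the
    subsequence arbitrarily far out.\<close>
  define r where "r k = (\<Sum>i\<le>k. K i) + k" for k
  have "K k \<le> (\<Sum>i\<le>n. K i)" if "k \<le> n" for k n by (rule member_le_sum) (use that in auto)
  then have rK: "r k \<ge> K k" "r k \<ge> k" "r (Suc k) \<ge> K k" for k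
    unfolding r_def by (meson le_add1 le_add2 le_SucI order_refl order_trans)+
  define g where "g k = f (r k)" for k
  have g: "g k \<in> L2_on D" for k by (simp add: g_def f)
  have gm [measurable]: "g k \<in> borel_measurable ?M" for k using g by (rule L2_measurable)
  define h where "h k x = norm (g (Suc k) x - g k x)" for k x
  have h_L2: "h k \<in> L2_on D" for k unfolding h_def[abs_def] by (intro L2_norm L2_diff g)
  have h_int: "(\<integral>\<^sup>+x. ennreal (h k x) \<partial>?M) \<le> ennreal (l2norm D (\<lambda>x. 1 :: real) * (1/2) ^ k)" for k
  proof -
    have "(\<integral>\<^sup>+x. ennreal (h k x) \<partial>?M) = ennreal (LINT x|?M. h k x)"
      by (intro nn_integral_eq_integral L2_integrable h_L2) (simp add: h_def)
    also have "(LINT x|?M. h k x) \<le> l2norm D (\<lambda>x. 1 :: real) * l2norm D (h k)"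
      using norm_integral_scaleR_le[OF const_L2 h_L2, of "1" k] by simp
    also have "\<dots> \<le> l2norm D (\<lambda>x. 1 :: real) * (1/2) ^ k"
      using K[OF rK(3) rK(1), of k] unfolding h_def[abs_def] l2norm_norm g_def
      by (intro mult_left_mono less_imp_le l2norm_nonneg)
    finally show ?thesis by (simp add: ennreal_leI)
  qed
  have [measurable]: "h k \<in> borel_measurable ?M" for k using h_L2 by (rule L2_measurable)
  have "(\<integral>\<^sup>+x. (\<Sum>k. ennreal (h k x)) \<partial>?M) = (\<Sum>k. \<integral>\<^sup>+x. ennreal (h k x) \<partial>?M)"
    by (rule nn_integral_suminf) measurable
  also have "\<dots> \<le> (\<Sum>k. ennreal (l2norm D (\<lambda>x. 1 :: real) * (1/2) ^ k))"
    by (intro suminf_le h_int) auto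
  also have "\<dots> = ennreal (\<Sum>k. l2norm D (\<lambda>x. 1 :: real) * (1/2) ^ k)"
    by (intro suminf_ennreal2 summable_mult) (auto simp: l2norm_nonneg)
  also have "\<dots> < top" by simp
  finally have "(\<integral>\<^sup>+x. (\<Sum>k. ennreal (h k x)) \<partial>?M) \<noteq> \<infinity>" by simp
  then have "AE x in ?M. (\<Sum>k. ennreal (h k x)) \<noteq> \<infinity>"
    by (rule nn_integral_PInf_AE[rotated]) measurable
  then have conv: "AE x in ?M. (\<lambda>k. g k x) \<longlonglongrightarrow> lim (\<lambda>k. g k x)"
  proof eventually_elim
    case (elim x)
    then have "summable (\<lambda>k. h k x)"
      by (intro summable_suminf_not_top) (auto simp: h_def)
    then have "summable (\<lambda>k. g (Suc k) x - g k x)"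
      unfolding h_def by (rule summable_norm_cancel)
    then have "convergent (\<lambda>n. \<Sum>k<n. g (Suc k) x - g k x)"
      by (simp add: summable_iff_convergent)
    then have "convergent (\<lambda>n. (\<Sum>k<n. g (Suc k) x - g k x) + g 0 x)"
      by (intro convergent_add convergent_const)
    then have "convergent (\<lambda>n. g n x)"
      by (simp add: sum_lessThan_telescope[of "\<lambda>k. g k x"])
    then show ?case by (simp add: convergent_LIMSEQ_iff)
  qed
  define l where "l x = lim (\<lambda>k. g k x)" for x
  have lm [measurable]: "l \<in> borel_measurable ?M"
    unfolding l_def[abs_def] by (rule borel_measurable_lim_metric) (rule gm)
  have fm [measurable]: "f k \<in> borel_measurable ?M" for k using f by (rule L2_measurable)
  have Fatou: "(\<integral>\<^sup>+x. ennreal ((norm (f n x - l x))\<^sup>2) \<partial>?M) \<le> ennreal (e\<^sup>2)"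
    if e: "0 < e" "\<And>m. m \<ge> N \<Longrightarrow> l2norm D (\<lambda>x. f n x - f m x) < e" for n N e
  proof -
    have "(\<integral>\<^sup>+x. ennreal ((norm (f n x - l x))\<^sup>2) \<partial>?M)
        = (\<integral>\<^sup>+x. liminf (\<lambda>k. ennreal ((norm (f n x - g k x))\<^sup>2)) \<partial>?M)"
      using conv
    proof (intro nn_integral_cong_AE, eventually_elim)
      case (elim x)
      then have "(\<lambda>k. ennreal ((norm (f n x - g k x))\<^sup>2)) \<longlonglongrightarrow> ennreal ((norm (f n x - l x))\<^sup>2)"
        unfolding l_def by (intro tendsto_intros)
      from lim_imp_Liminf[OF _ this] show ?case by simp
    qed
    also have "\<dots> \<le> liminf (\<lambda>k. \<integral>\<^sup>+x. ennreal ((norm (f n x - g k x))\<^sup>2) \<partial>?M)"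
      by (rule nn_integral_liminf) measurable
    also have "\<dots> \<le> ennreal (e\<^sup>2)"
    proof (rule Liminf_le)
      show "\<forall>\<^sub>F k in sequentially. (\<integral>\<^sup>+x. ennreal ((norm (f n x - g k x))\<^sup>2) \<partial>?M) \<le> ennreal (e\<^sup>2)"
      proof (rule eventually_sequentiallyI[of N])
        fix k assume "N \<le> k"
        then have "l2norm D (\<lambda>x. f n x - g k x) < e" unfolding g_def using e(2) rK(2)[of k] by simp
        then have "(l2norm D (\<lambda>x. f n x - g k x))\<^sup>2 \<le> e\<^sup>2"
          by (intro power_mono l2norm_nonneg) simp
        moreover have "(\<integral>\<^sup>+x. ennreal ((norm (f n x - g k x))\<^sup>2) \<partial>?M) = ennreal ((l2norm D (\<lambda>x. f n x - g k x))\<^sup>2)"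
          using L2_square_integrable[OF L2_diff[OF f g]]
          by (subst nn_integral_eq_integral) (auto simp: l2norm_def)
        ultimately show "(\<integral>\<^sup>+x. ennreal ((norm (f n x - g k x))\<^sup>2) \<partial>?M) \<le> ennreal (e\<^sup>2)"
          by (simp add: ennreal_leI)
      qed
    qed simp
    finally show ?thesis .
  qed
  have fl: "(\<lambda>x. f n x - l x) \<in> L2_on D \<and> l2norm D (\<lambda>x. f n x - l x) \<le> e"
    if e: "0 < e" "\<And>m. m \<ge> N \<Longrightarrow> l2norm D (\<lambda>x. f n x - f m x) < e" for n N e
  proof -
    have F: "(\<integral>\<^sup>+x. ennreal ((norm (f n x - l x))\<^sup>2) \<partial>?M) \<le> ennreal (e\<^sup>2)"
      by (rule Fatou[OF e])
    then have "(\<integral>\<^sup>+x. ennreal (norm ((norm (f n x - l x))\<^sup>2)) \<partial>?M) < \<infinity>"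
      by (simp add: le_less_trans[OF _ ennreal_less_top])
    then have int: "integrable ?M (\<lambda>x. (norm (f n x - l x))\<^sup>2)"
      by (intro integrableI_bounded) measurable
    then have "ennreal ((l2norm D (\<lambda>x. f n x - l x))\<^sup>2) \<le> ennreal (e\<^sup>2)"
      using F by (subst (asm) nn_integral_eq_integral) (auto simp: l2norm_def)
    then have "(l2norm D (\<lambda>x. f n x - l x))\<^sup>2 \<le> e\<^sup>2" by (simp add: ennreal_le_iff)
    then have "l2norm D (\<lambda>x. f n x - l x) \<le> e" by (rule power2_le_imp_le) (use e(1) in simp)
    then show ?thesis using int by (simp add: L2_on_def)
  qed
  obtain K0 where K0: "\<And>m n. \<lbrakk>m \<ge> K0; n \<ge> K0\<rbrakk> \<Longrightarrow> l2norm D (\<lambda>x. f m x - f n x) < 1"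
    using Cauchy[of 1] by auto
  \<comment> \<open>Membership of \<open>l\<close> follows by subtracting this difference from
    \<open>f K0\<close>.\<close>
  have "(\<lambda>x. f K0 x - l x) \<in> L2_on D" using fl[of 1 K0 K0] K0 by simp
  from L2_diff[OF f[of K0] this] have l: "l \<in> L2_on D" by simp
  have "(\<lambda>k. l2norm D (\<lambda>x. f k x - l x)) \<longlonglongrightarrow> 0"
  proof (rule LIMSEQ_I)
    fix e :: real assume "0 < e"
    then obtain N where N: "\<And>m n. \<lbrakk>m \<ge> N; n \<ge> N\<rbrakk> \<Longrightarrow> l2norm D (\<lambda>x. f m x - f n x) < e / 2"
      using Cauchy[of "e / 2"] by auto
    have "norm (l2norm D (\<lambda>x. f n x - l x) - 0) < e" if "n \<ge> N" for n
    proof -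
      have "l2norm D (\<lambda>x. f n x - l x) \<le> e / 2" using fl[of "e / 2" N n] N that \<open>0 < e\<close> by auto
      then show ?thesis using \<open>0 < e\<close> by (simp add: l2norm_nonneg)
    qed
    then show "\<exists>no. \<forall>n\<ge>no. norm (l2norm D (\<lambda>x. f n x - l x) - 0) < e" by blast
  qed
  then show ?thesis using l by blast
qed

end

section \<open>Weak gradients and the space \<open>H\<^sub>0\<^sup>1(D)\<close>\<close>

lemma cube_in_open:
  fixes x :: "'a::euclidean_space"
  assumes "open S" "x \<in> S"
  obtains d where "0 < d" "\<And>h. \<lbrakk>0 \<le> h; h < d\<rbrakk> \<Longrightarrow> cbox x (x + h *\<^sub>R One) \<subseteq> S"
proof -
  obtain a b where ab: "cbox a b \<subseteq> S" "x \<in> box a b"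
    using assms open_contains_cbox by metis
  define d where "d = Min ((\<lambda>i. (b - x) \<bullet> i) ` Basis)"
  have "0 < d" unfolding d_def using ab(2) by (auto simp: mem_box inner_diff_left)
  moreover have "cbox x (x + h *\<^sub>R One) \<subseteq> S" if h: "0 \<le> h" "h < d" for h
  proof -
    have "h \<le> (b - x) \<bullet> i" if "i \<in> Basis" for i
      using h(2) that unfolding d_def by (meson Min_le finite_Basis finite_imageI imageI less_imp_le order_trans)
    then have "x \<bullet> i + h \<le> b \<bullet> i" if "i \<in> Basis" for i
      using that by (simp add: inner_diff_left algebra_simps)
    then have "cbox x (x + h *\<^sub>R One) \<subseteq> cbox a b"
      using ab(2) by (intro subset_box_imp) (auto simp: mem_box inner_add_left less_imp_le)
    then show ?thesis using ab(1) by simp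
  qed
  ultimately show ?thesis using that by blast
qed

text \<open>By the Lebesgue differentiation theorem for cubes.\<close>

lemma integral_boxes_zero_imp_AE_zero:
  fixes f :: "'a::euclidean_space \<Rightarrow> 'b::euclidean_space"
  assumes S: "open S" and f: "f absolutely_integrable_on UNIV"
    and zero: "\<And>a b. cbox a b \<subseteq> S \<Longrightarrow> integral (cbox a b) f = 0"
  shows "AE x in lebesgue. x \<in> S \<longrightarrow> f x = 0"
proof -
  have "f integrable_on cbox a b" for a b
    using f by (meson integrable_on_subcbox set_lebesgue_integral_eq_integral(1) subset_UNIV)
  from integrable_ccontinuous_explicit[of f, OF this]
  obtain N where N: "negligible N" "\<And>x e. \<lbrakk>x \<notin> N; 0 < e\<rbrakk> \<Longrightarrow>
     \<exists>d>0. \<forall>h. 0 < h \<and> h < d \<longrightarrow> norm (integral (cbox x (x + h *\<^sub>R One)) f /\<^sub>R h ^ DIM('a) - f x) < e"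
    by blast
  have "f x = 0" if x: "x \<in> S" "x \<notin> N" for x
  proof (rule ccontr)
    assume "f x \<noteq> 0"
    then obtain d where d: "0 < d" "\<And>h. \<lbrakk>0 < h; h < d\<rbrakk> \<Longrightarrow>
        norm (integral (cbox x (x + h *\<^sub>R One)) f /\<^sub>R h ^ DIM('a) - f x) < norm (f x)"
      using N(2)[OF x(2), of "norm (f x)"] by auto
    obtain d' where d': "0 < d'" "\<And>h. \<lbrakk>0 \<le> h; h < d'\<rbrakk> \<Longrightarrow> cbox x (x + h *\<^sub>R One) \<subseteq> S"
      using cube_in_open[OF S x(1)] by blast
    define h where "h = min d d' / 2"
    have "0 < h" "h < d" "h < d'" using d(1) d'(1) by (auto simp: h_def)
    then have "norm (integral (cbox x (x + h *\<^sub>R One)) f /\<^sub>R h ^ DIM('a) - f x) < norm (f x)"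
      "integral (cbox x (x + h *\<^sub>R One)) f = 0"
      using d(2) d'(2)[of h] by (auto intro: zero)
    then show False by simp
  qed
  moreover have "AE x in lebesgue. x \<notin> N"
    using N(1) by (simp add: AE_not_in negligible_iff_null_sets)
  ultimately show ?thesis by auto
qed

lemma test_functions_lincomb:
  assumes "\<phi> \<in> test_functions D" "\<psi> \<in> test_functions D"
  shows "(\<lambda>x. c * \<phi> x + \<psi> x) \<in> test_functions D"
proof -
  have "closure {x. c * \<phi> x + \<psi> x \<noteq> 0} \<subseteq> closure ({x. \<phi> x \<noteq> 0} \<union> {x. \<psi> x \<noteq> 0})"
    by (rule closure_mono) auto
  then have *: "closure {x. c * \<phi> x + \<psi> x \<noteq> 0} \<subseteq> closure {x. \<phi> x \<noteq> 0} \<union> closure {x. \<psi> x \<noteq> 0}"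
    by (simp add: closure_Un)
  moreover have "compact (closure {x. c * \<phi> x + \<psi> x \<noteq> 0})"
  proof -
    have "bounded ({x. \<phi> x \<noteq> 0} \<union> {x. \<psi> x \<noteq> 0})"
      using assms by (simp add: test_functions_def compact_closure)
    then have "bounded {x. c * \<phi> x + \<psi> x \<noteq> 0}" by (rule bounded_subset) auto
    then show ?thesis by (simp add: compact_closure)
  qed
  ultimately show ?thesis using assms by (auto simp: test_functions_def intro!: C_k_lincomb)
qed

lemma test_functions_zero: "(\<lambda>x. 0) \<in> test_functions D"
  by (simp add: test_functions_def C_k_const)

lemma grad_lincomb:
  assumes "C_k (Suc k) f" "C_k (Suc k) g"
  shows "grad (\<lambda>x. c * f x + g x) x = c *\<^sub>R grad f x + grad g x"
proof -
  note d = C_k_differentiable[OF assms(1)] C_k_differentiable[OF assms(2)]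
  have "((\<lambda>x. c * f x + g x) has_derivative (\<lambda>h. c * frechet_derivative f (at x) h + frechet_derivative g (at x) h)) (at x)"
    by (intro derivative_intros d)
  from grad_eq[OF this] show ?thesis by (simp add: grad_def vec_eq_iff)
qed

lemma grad_zero: "grad (\<lambda>x. 0) x = 0"
  by (simp add: grad_eq[OF has_derivative_const] vec_eq_iff)

context bounded_open
begin

lemma test_function_L2: "\<phi> \<in> test_functions D \<Longrightarrow> \<phi> \<in> L2_on D"
proof (rule L2_continuous)
  assume "\<phi> \<in> test_functions D"
  then have "C_k 0 \<phi>" unfolding test_functions_def by blast
  then show "continuous_on UNIV \<phi>" by simp
qed

lemma grad_test_function_L2: "\<phi> \<in> test_functions D \<Longrightarrow> grad \<phi> \<in> L2_on D"
proof (rule L2_continuous)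
  assume "\<phi> \<in> test_functions D"
  then have "C_k (Suc 0) \<phi>" unfolding test_functions_def by blast
  then have "continuous_on UNIV (\<lambda>x. \<chi> i. grad \<phi> x $ i)" by (intro continuous_on_vec_lambda) simp
  then show "continuous_on UNIV (grad \<phi>)" by simp
qed

text \<open>Fundamental lemma of the calculus of variations: bumps converge boundedly to indicators
  of boxes, so \<open>G\<close> integrates to zero over every closed box inside \<open>D\<close>,
  and Lebesgue differentiation gives the pointwise conclusion.\<close>

lemma test_functions_separate:
  fixes G :: "real^'n \<Rightarrow> 'a::euclidean_space"
  assumes G: "G \<in> L2_on D" and zero: "\<And>\<phi>. \<phi> \<in> test_functions D \<Longrightarrow> (LINT x|lebesgue_on D. \<phi> x *\<^sub>R G x) = 0"
  shows "AE x in lebesgue_on D. G x = 0"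
proof -
  \<comment> \<open>Extension by zero gives an absolutely integrable function on the whole space, as
    \<open>integral_boxes_zero_imp_AE_zero\<close> requires.\<close>
  let ?f = "\<lambda>x. indicator D x *\<^sub>R G x"
  have f: "?f absolutely_integrable_on UNIV"
    using L2_integrable[OF G] by (simp add: set_integrable_def integrable_restrict_space)
  have "integral (cbox a b) ?f = 0" if ab: "cbox a b \<subseteq> D" for a b
  proof -
    have "(\<lambda>m. LINT x|lebesgue_on D. bump m a b x *\<^sub>R G x) \<longlonglongrightarrow> (LINT x|lebesgue_on D. indicator (box a b) x *\<^sub>R G x)"
    proof (rule integral_dominated_convergence[where w = "\<lambda>x. norm (G x)"])
      show "(\<lambda>x. indicator (box a b) x *\<^sub>R G x) \<in> borel_measurable (lebesgue_on D)"
        by (intro borel_measurable_scaleR L2_measurable[OF G] borel_measurable_indicator)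
          (use ab box_subset_cbox[of a b] in \<open>simp add: sets_restrict_space_iff\<close>)
      show "(\<lambda>x. bump m a b x *\<^sub>R G x) \<in> borel_measurable (lebesgue_on D)" for m
        by (intro borel_measurable_scaleR L2_measurable[OF G] L2_measurable[OF test_function_L2] bump_test_function ab)
      show "integrable (lebesgue_on D) (\<lambda>x. norm (G x))" using L2_integrable[OF G] by (rule integrable_norm)
      show "AE x in lebesgue_on D. (\<lambda>m. bump m a b x *\<^sub>R G x) \<longlonglongrightarrow> indicator (box a b) x *\<^sub>R G x"
        by (intro AE_I2 tendsto_scaleR bump_tendsto tendsto_const)
      show "AE x in lebesgue_on D. norm (bump m a b x *\<^sub>R G x) \<le> norm (G x)" for m
        by (intro AE_I2) (simp add: mult_left_le_one_le bump_bounds)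
    qed
    then have "(LINT x|lebesgue_on D. indicator (box a b) x *\<^sub>R G x) = 0"
      using zero[OF bump_test_function[OF ab]] by (simp add: LIMSEQ_const_iff)
    moreover have "(LINT x|lebesgue_on D. indicator (box a b) x *\<^sub>R G x) = (LINT x:box a b|lebesgue. ?f x)"
      unfolding set_lebesgue_integral_def
      by (subst integral_restrict_space) (auto simp: mult.commute intro!: Bochner_Integration.integral_cong)
    moreover have "(LINT x:box a b|lebesgue. ?f x) = integral (box a b) ?f"
      by (rule set_lebesgue_integral_eq_integral(2)) (rule set_integrable_subset[OF f], auto)
    ultimately show ?thesis by (simp add: integral_open_interval)
  qed
  then have "AE x in lebesgue. x \<in> D \<longrightarrow> ?f x = 0" by (rule integral_boxes_zero_imp_AE_zero[OF open_D f])
  then have "AE x in lebesgue. x \<in> D \<longrightarrow> G x = 0" by eventually_elim auto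
  then show ?thesis by (simp add: AE_restrict_space_iff)
qed

lemma weak_gradient_L2: "has_weak_gradient D u G \<Longrightarrow> u \<in> L2_on D" "has_weak_gradient D u G \<Longrightarrow> G \<in> L2_on D"
  by (simp_all add: has_weak_gradient_def)

lemma weak_gradient_unique:
  assumes G: "has_weak_gradient D u G" and H: "has_weak_gradient D u H"
  shows "AE x in lebesgue_on D. G x = H x"
proof -
  note L2 = weak_gradient_L2(2)[OF G] weak_gradient_L2(2)[OF H]
  have "AE x in lebesgue_on D. G x - H x = 0"
  proof (rule test_functions_separate[OF L2_diff[OF L2]])
    fix \<phi> assume \<phi>: "\<phi> \<in> test_functions D"
    then show "(LINT x|lebesgue_on D. \<phi> x *\<^sub>R (G x - H x)) = 0"
      using G H L2_scaleR_integrable[OF test_function_L2[OF \<phi>] L2(1)]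
        L2_scaleR_integrable[OF test_function_L2[OF \<phi>] L2(2)]
      by (simp add: has_weak_gradient_def scaleR_diff_right)
  qed
  then show ?thesis by simp
qed

lemma weak_gradient_lincomb:
  assumes u: "has_weak_gradient D u G" and v: "has_weak_gradient D v H"
  shows "has_weak_gradient D (\<lambda>x. c * u x + v x) (\<lambda>x. c *\<^sub>R G x + H x)"
  unfolding has_weak_gradient_def
proof (intro conjI ballI)
  note L2 = weak_gradient_L2[OF u] weak_gradient_L2[OF v]
  show "(\<lambda>x. c * u x + v x) \<in> L2_on D" using L2_add[OF L2_scaleR[OF L2(1)] L2(3)] by simp
  show "(\<lambda>x. c *\<^sub>R G x + H x) \<in> L2_on D" using L2_add[OF L2_scaleR[OF L2(2)] L2(4)] .
  fix \<phi> assume \<phi>: "\<phi> \<in> test_functions D"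
  note int = L2_scaleR_integrable[OF L2(1) grad_test_function_L2[OF \<phi>]]
    L2_scaleR_integrable[OF L2(3) grad_test_function_L2[OF \<phi>]]
    L2_scaleR_integrable[OF test_function_L2[OF \<phi>] L2(2)] L2_scaleR_integrable[OF test_function_L2[OF \<phi>] L2(4)]
  have "(LINT x|lebesgue_on D. (c * u x + v x) *\<^sub>R grad \<phi> x)
      = (LINT x|lebesgue_on D. c *\<^sub>R (u x *\<^sub>R grad \<phi> x) + v x *\<^sub>R grad \<phi> x)"
    by (simp add: scaleR_add_left)
  also have "\<dots> = c *\<^sub>R (LINT x|lebesgue_on D. u x *\<^sub>R grad \<phi> x) + (LINT x|lebesgue_on D. v x *\<^sub>R grad \<phi> x)"
    using int by (subst Bochner_Integration.integral_add) (auto simp del: scaleR_scaleR)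
  also have "\<dots> = - (c *\<^sub>R (LINT x|lebesgue_on D. \<phi> x *\<^sub>R G x) + (LINT x|lebesgue_on D. \<phi> x *\<^sub>R H x))"
    using u v \<phi> by (simp add: has_weak_gradient_def)
  also have "c *\<^sub>R (LINT x|lebesgue_on D. \<phi> x *\<^sub>R G x) + (LINT x|lebesgue_on D. \<phi> x *\<^sub>R H x)
      = (LINT x|lebesgue_on D. c *\<^sub>R (\<phi> x *\<^sub>R G x) + \<phi> x *\<^sub>R H x)"
    using int by (subst Bochner_Integration.integral_add) (auto simp del: scaleR_scaleR)
  also have "\<dots> = (LINT x|lebesgue_on D. \<phi> x *\<^sub>R (c *\<^sub>R G x + H x))"
    by (simp add: scaleR_add_right mult.commute)
  finally show "(LINT x|lebesgue_on D. (c * u x + v x) *\<^sub>R grad \<phi> x)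
      = - (LINT x|lebesgue_on D. \<phi> x *\<^sub>R (c *\<^sub>R G x + H x))" .
qed

text \<open>For a fixed test function both sides of the defining identity are continuous in the L2
  norm, by Cauchy-Schwarz.\<close>

lemma weak_gradient_limit:
  assumes w: "\<And>k. has_weak_gradient D (u k) (G k)" and L2: "v \<in> L2_on D" "H \<in> L2_on D"
    and lim: "(\<lambda>k. l2norm D (\<lambda>x. u k x - v x)) \<longlonglongrightarrow> 0" "(\<lambda>k. l2norm D (\<lambda>x. G k x - H x)) \<longlonglongrightarrow> 0"
  shows "has_weak_gradient D v H"
  unfolding has_weak_gradient_def
proof (intro conjI L2 ballI)
  fix \<phi> assume \<phi>: "\<phi> \<in> test_functions D"
  note \<phi>L = test_function_L2[OF \<phi>] grad_test_function_L2[OF \<phi>]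
  have uL: "u k \<in> L2_on D" and GL: "G k \<in> L2_on D" for k using weak_gradient_L2[OF w] by auto
  have "(\<lambda>k. (LINT x|lebesgue_on D. u k x *\<^sub>R grad \<phi> x) - (LINT x|lebesgue_on D. v x *\<^sub>R grad \<phi> x)) \<longlonglongrightarrow> 0"
  proof (rule Lim_null_comparison)
    show "(\<lambda>k. l2norm D (\<lambda>x. u k x - v x) * l2norm D (grad \<phi>)) \<longlonglongrightarrow> 0"
      using tendsto_mult_left_zero[OF lim(1)] .
    have "norm ((LINT x|lebesgue_on D. u k x *\<^sub>R grad \<phi> x) - (LINT x|lebesgue_on D. v x *\<^sub>R grad \<phi> x))
        \<le> l2norm D (\<lambda>x. u k x - v x) * l2norm D (grad \<phi>)" for k
      using norm_integral_scaleR_le[OF L2_diff[OF uL L2(1)] \<phi>L(2), of k]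
        L2_scaleR_integrable[OF uL \<phi>L(2), of k] L2_scaleR_integrable[OF L2(1) \<phi>L(2)]
      by (simp add: scaleR_diff_left)
    then show "\<forall>\<^sub>F k in sequentially. norm ((LINT x|lebesgue_on D. u k x *\<^sub>R grad \<phi> x) - (LINT x|lebesgue_on D. v x *\<^sub>R grad \<phi> x))
        \<le> l2norm D (\<lambda>x. u k x - v x) * l2norm D (grad \<phi>)" by simp
  qed
  then have 1: "(\<lambda>k. LINT x|lebesgue_on D. u k x *\<^sub>R grad \<phi> x) \<longlonglongrightarrow> (LINT x|lebesgue_on D. v x *\<^sub>R grad \<phi> x)"
    by (rule LIM_zero_cancel)
  have "(\<lambda>k. (LINT x|lebesgue_on D. \<phi> x *\<^sub>R G k x) - (LINT x|lebesgue_on D. \<phi> x *\<^sub>R H x)) \<longlonglongrightarrow> 0"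
  proof (rule Lim_null_comparison)
    show "(\<lambda>k. l2norm D \<phi> * l2norm D (\<lambda>x. G k x - H x)) \<longlonglongrightarrow> 0"
      using tendsto_mult_right_zero[OF lim(2)] .
    have "norm ((LINT x|lebesgue_on D. \<phi> x *\<^sub>R G k x) - (LINT x|lebesgue_on D. \<phi> x *\<^sub>R H x))
        \<le> l2norm D \<phi> * l2norm D (\<lambda>x. G k x - H x)" for k
      using norm_integral_scaleR_le[OF \<phi>L(1) L2_diff[OF GL L2(2)], of k]
        L2_scaleR_integrable[OF \<phi>L(1) GL, of k] L2_scaleR_integrable[OF \<phi>L(1) L2(2)]
      by (simp add: scaleR_diff_right)
    then show "\<forall>\<^sub>F k in sequentially. norm ((LINT x|lebesgue_on D. \<phi> x *\<^sub>R G k x) - (LINT x|lebesgue_on D. \<phi> x *\<^sub>R H x))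
        \<le> l2norm D \<phi> * l2norm D (\<lambda>x. G k x - H x)" by simp
  qed
  then have "(\<lambda>k. LINT x|lebesgue_on D. \<phi> x *\<^sub>R G k x) \<longlonglongrightarrow> (LINT x|lebesgue_on D. \<phi> x *\<^sub>R H x)"
    by (rule LIM_zero_cancel)
  from tendsto_minus[OF this]
  have "(\<lambda>k. LINT x|lebesgue_on D. u k x *\<^sub>R grad \<phi> x) \<longlonglongrightarrow> - (LINT x|lebesgue_on D. \<phi> x *\<^sub>R H x)"
    using w \<phi> by (simp add: has_weak_gradient_def)
  then show "(LINT x|lebesgue_on D. v x *\<^sub>R grad \<phi> x) = - (LINT x|lebesgue_on D. \<phi> x *\<^sub>R H x)"
    by (rule LIMSEQ_unique[OF 1])
qed

text \<open>The approximation by test functions is phrased with a tolerance, which makes limits a matter of the triangle inequality.\<close>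

definition H01_pair :: "(real^'n \<Rightarrow> real) \<Rightarrow> (real^'n \<Rightarrow> real^'n) \<Rightarrow> bool" where
  "H01_pair u G \<longleftrightarrow> has_weak_gradient D u G \<and> (\<forall>e>0. \<exists>\<phi>\<in>test_functions D.
     l2norm D (\<lambda>x. \<phi> x - u x) < e \<and> l2norm D (\<lambda>x. grad \<phi> x - G x) < e)"

lemma H01_iff_pair: "u \<in> H01 D \<longleftrightarrow> (\<exists>G. H01_pair u G)"
proof
  assume "u \<in> H01 D"
  then obtain G \<phi> where G: "has_weak_gradient D u G" and \<phi>: "\<And>k. \<phi> k \<in> test_functions D"
    and lim: "(\<lambda>k. l2norm D (\<lambda>x. \<phi> k x - u x)) \<longlonglongrightarrow> 0" "(\<lambda>k. l2norm D (\<lambda>x. grad (\<phi> k) x - G x)) \<longlonglongrightarrow> 0"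
    unfolding H01_def by blast
  have "\<exists>\<psi>\<in>test_functions D. l2norm D (\<lambda>x. \<psi> x - u x) < e \<and> l2norm D (\<lambda>x. grad \<psi> x - G x) < e"
    if "0 < e" for e
  proof -
    have "\<forall>\<^sub>F k in sequentially. l2norm D (\<lambda>x. \<phi> k x - u x) < e \<and> l2norm D (\<lambda>x. grad (\<phi> k) x - G x) < e"
      by (intro eventually_conj order_tendstoD(2)[OF lim(1) that] order_tendstoD(2)[OF lim(2) that])
    from eventually_happens'[OF sequentially_bot this] show ?thesis using \<phi> by blast
  qed
  then show "\<exists>G. H01_pair u G" using G by (auto simp: H01_pair_def)
next
  assume "\<exists>G. H01_pair u G"
  then obtain G where G: "has_weak_gradient D u G"
    and "\<And>e. 0 < e \<Longrightarrow> \<exists>\<phi>\<in>test_functions D. l2norm D (\<lambda>x. \<phi> x - u x) < e \<and> l2norm D (\<lambda>x. grad \<phi> x - G x) < e"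
    unfolding H01_pair_def by blast
  then have "\<exists>\<phi>\<in>test_functions D. l2norm D (\<lambda>x. \<phi> x - u x) < 1 / Suc k \<and> l2norm D (\<lambda>x. grad \<phi> x - G x) < 1 / Suc k" for k
    by simp
  then obtain \<phi> where \<phi>: "\<And>k. \<phi> k \<in> test_functions D"
    "\<And>k. l2norm D (\<lambda>x. \<phi> k x - u x) < 1 / Suc k" "\<And>k. l2norm D (\<lambda>x. grad (\<phi> k) x - G x) < 1 / Suc k"
    by metis
  note * = tendsto_sandwich[OF always_eventually always_eventually tendsto_const LIMSEQ_Suc[OF lim_1_over_n]]
  have "(\<lambda>k. l2norm D (\<lambda>x. \<phi> k x - u x)) \<longlonglongrightarrow> 0" "(\<lambda>k. l2norm D (\<lambda>x. grad (\<phi> k) x - G x)) \<longlonglongrightarrow> 0"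
    by (rule *; use \<phi>(2,3) in \<open>auto simp: l2norm_nonneg less_imp_le simp del: of_nat_Suc\<close>)+
  then show "u \<in> H01 D" unfolding H01_def using G \<phi>(1) by blast
qed

lemma H01_pair_lincomb:
  assumes u: "H01_pair u G" and v: "H01_pair v H"
  shows "H01_pair (\<lambda>x. c * u x + v x) (\<lambda>x. c *\<^sub>R G x + H x)"
  unfolding H01_pair_def
proof (intro conjI allI impI)
  have w: "has_weak_gradient D u G" "has_weak_gradient D v H" using u v by (auto simp: H01_pair_def)
  then show "has_weak_gradient D (\<lambda>x. c * u x + v x) (\<lambda>x. c *\<^sub>R G x + H x)" by (rule weak_gradient_lincomb)
  note L2 = weak_gradient_L2[OF w(1)] weak_gradient_L2[OF w(2)]
  fix e :: real assume e: "0 < e"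
  define d where "d = e / (\<bar>c\<bar> + 1)"
  have "(\<bar>c\<bar> + 1) * d = e" by (simp add: d_def)
  then have d: "\<bar>c\<bar> * d + d = e" "0 < d" using e by (simp add: distrib_right, simp add: d_def)
  obtain \<phi> \<psi> where \<phi>: "\<phi> \<in> test_functions D" "l2norm D (\<lambda>x. \<phi> x - u x) < d" "l2norm D (\<lambda>x. grad \<phi> x - G x) < d"
    and \<psi>: "\<psi> \<in> test_functions D" "l2norm D (\<lambda>x. \<psi> x - v x) < d" "l2norm D (\<lambda>x. grad \<psi> x - H x) < d"
    using u v d(2) unfolding H01_pair_def by meson
  have C1: "C_k (Suc 0) \<phi>" "C_k (Suc 0) \<psi>" using \<phi>(1) \<psi>(1) unfolding test_functions_def by blast+
  have lt: "\<bar>c\<bar> * s + t < e" if "s < d" "t < d" for s t :: real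
    using mult_left_mono[of s d "\<bar>c\<bar>"] that d(1) by auto
  have "l2norm D (\<lambda>x. c *\<^sub>R (\<phi> x - u x) + (\<psi> x - v x)) \<le> \<bar>c\<bar> * l2norm D (\<lambda>x. \<phi> x - u x) + l2norm D (\<lambda>x. \<psi> x - v x)"
    unfolding l2norm_scaleR[symmetric]
    by (intro l2norm_triangle L2_scaleR L2_diff L2 test_function_L2 \<phi>(1) \<psi>(1))
  then have 1: "l2norm D (\<lambda>x. (c * \<phi> x + \<psi> x) - (c * u x + v x)) < e"
    using lt[OF \<phi>(2) \<psi>(2)] by (simp add: algebra_simps)
  have "l2norm D (\<lambda>x. c *\<^sub>R (grad \<phi> x - G x) + (grad \<psi> x - H x)) \<le> \<bar>c\<bar> * l2norm D (\<lambda>x. grad \<phi> x - G x) + l2norm D (\<lambda>x. grad \<psi> x - H x)"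
    unfolding l2norm_scaleR[symmetric]
    by (intro l2norm_triangle L2_scaleR L2_diff L2 grad_test_function_L2 \<phi>(1) \<psi>(1))
  then have 2: "l2norm D (\<lambda>x. grad (\<lambda>x. c * \<phi> x + \<psi> x) x - (c *\<^sub>R G x + H x)) < e"
    using lt[OF \<phi>(3) \<psi>(3)] unfolding grad_lincomb[OF C1] by (simp add: algebra_simps)
  show "\<exists>\<phi>\<in>test_functions D. l2norm D (\<lambda>x. \<phi> x - (c * u x + v x)) < e \<and>
      l2norm D (\<lambda>x. grad \<phi> x - (c *\<^sub>R G x + H x)) < e"
    using 1 2 by (intro bexI[of _ "\<lambda>x. c * \<phi> x + \<psi> x"] test_functions_lincomb \<phi>(1) \<psi>(1)) simp
qed

lemma H01_pair_zero: "H01_pair (\<lambda>x. 0) (\<lambda>x. 0)"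
proof -
  have "has_weak_gradient D (\<lambda>x. 0) (\<lambda>x. 0)"
    by (simp add: has_weak_gradient_def const_L2)
  moreover have "l2norm D (\<lambda>x. 0 :: 'a::euclidean_space) = 0" by (simp add: l2norm_def)
  ultimately show ?thesis
    unfolding H01_pair_def using test_functions_zero
    by (auto simp: grad_zero l2norm_def intro!: bexI[of _ "\<lambda>x. 0"])
qed

lemma H01_pair_limit:
  assumes w: "\<And>k. H01_pair (u k) (G k)" and L2: "v \<in> L2_on D" "H \<in> L2_on D"
    and lim: "(\<lambda>k. l2norm D (\<lambda>x. u k x - v x)) \<longlonglongrightarrow> 0" "(\<lambda>k. l2norm D (\<lambda>x. G k x - H x)) \<longlonglongrightarrow> 0"
  shows "H01_pair v H"
  unfolding H01_pair_def
proof (intro conjI allI impI)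
  have wg: "has_weak_gradient D (u k) (G k)" for k using w by (simp add: H01_pair_def)
  then show "has_weak_gradient D v H" by (rule weak_gradient_limit[OF _ L2 lim])
  fix e :: real assume e: "0 < e"
  then have "\<forall>\<^sub>F k in sequentially. l2norm D (\<lambda>x. u k x - v x) < e / 2 \<and> l2norm D (\<lambda>x. G k x - H x) < e / 2"
    by (intro eventually_conj order_tendstoD(2)[OF lim(1)] order_tendstoD(2)[OF lim(2)]) auto
  then obtain k where k: "l2norm D (\<lambda>x. u k x - v x) < e / 2" "l2norm D (\<lambda>x. G k x - H x) < e / 2"
    using eventually_happens'[OF sequentially_bot] by blast
  obtain \<phi> where \<phi>: "\<phi> \<in> test_functions D" "l2norm D (\<lambda>x. \<phi> x - u k x) < e / 2" "l2norm D (\<lambda>x. grad \<phi> x - G k x) < e / 2"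
    using w[of k] e unfolding H01_pair_def by (meson half_gt_zero)
  note kL2 = weak_gradient_L2[OF wg[of k]]
  have "l2norm D (\<lambda>x. (\<phi> x - u k x) + (u k x - v x)) \<le> l2norm D (\<lambda>x. \<phi> x - u k x) + l2norm D (\<lambda>x. u k x - v x)"
    by (intro l2norm_triangle L2_diff kL2 L2 test_function_L2 \<phi>)
  moreover have "l2norm D (\<lambda>x. (grad \<phi> x - G k x) + (G k x - H x)) \<le> l2norm D (\<lambda>x. grad \<phi> x - G k x) + l2norm D (\<lambda>x. G k x - H x)"
    by (intro l2norm_triangle L2_diff kL2 L2 grad_test_function_L2 \<phi>)
  ultimately show "\<exists>\<phi>\<in>test_functions D. l2norm D (\<lambda>x. \<phi> x - v x) < e \<and> l2norm D (\<lambda>x. grad \<phi> x - H x) < e"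
    using \<phi> k by (intro bexI[of _ \<phi>]) auto
qed

lemma has_weak_gradient_wgrad: "has_weak_gradient D u G \<Longrightarrow> has_weak_gradient D u (wgrad D u)"
  unfolding wgrad_def by (rule someI[of "has_weak_gradient D u"])

lemma wgrad_pair: "u \<in> H01 D \<Longrightarrow> has_weak_gradient D u (wgrad D u)"
  unfolding H01_iff_pair H01_pair_def using has_weak_gradient_wgrad by blast

lemma wgrad_AE: "has_weak_gradient D u G \<Longrightarrow> AE x in lebesgue_on D. wgrad D u x = G x"
  using weak_gradient_unique has_weak_gradient_wgrad by blast

lemma H01_L2: "u \<in> H01 D \<Longrightarrow> u \<in> L2_on D"
  using wgrad_pair weak_gradient_L2(1) by blast

lemma wgrad_L2: "u \<in> H01 D \<Longrightarrow> wgrad D u \<in> L2_on D"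
  using wgrad_pair weak_gradient_L2(2) by blast

text \<open>\<open>wgrad\<close> is chosen among all weak gradients and may differ on a null set
  from the one approximated by gradients of test functions; L2 norms do not see the
  difference.\<close>

lemma H01_wgrad_pair:
  assumes "u \<in> H01 D"
  shows "H01_pair u (wgrad D u)"
proof -
  obtain G where G: "H01_pair u G" using assms H01_iff_pair by blast
  have wG: "has_weak_gradient D u G" using G by (simp add: H01_pair_def)
  have "l2norm D (\<lambda>x. grad \<phi> x - wgrad D u x) = l2norm D (\<lambda>x. grad \<phi> x - G x)" if "\<phi> \<in> test_functions D" for \<phi>
    using wgrad_AE[OF wG] that
    by (intro l2norm_cong_AE L2_diff grad_test_function_L2 wgrad_L2[OF assms] weak_gradient_L2(2)[OF wG]) auto
  then show ?thesis using G wgrad_pair[OF assms] by (simp add: H01_pair_def cong: bex_cong)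
qed

lemma H01_lincomb:
  assumes "u \<in> H01 D" "v \<in> H01 D"
  shows "(\<lambda>x. c * u x + v x) \<in> H01 D"
    and "AE x in lebesgue_on D. wgrad D (\<lambda>x. c * u x + v x) x = c *\<^sub>R wgrad D u x + wgrad D v x"
proof -
  have *: "H01_pair (\<lambda>x. c * u x + v x) (\<lambda>x. c *\<^sub>R wgrad D u x + wgrad D v x)"
    by (intro H01_pair_lincomb H01_wgrad_pair assms)
  then show "(\<lambda>x. c * u x + v x) \<in> H01 D" using H01_iff_pair by blast
  show "AE x in lebesgue_on D. wgrad D (\<lambda>x. c * u x + v x) x = c *\<^sub>R wgrad D u x + wgrad D v x"
    using * by (intro wgrad_AE) (simp add: H01_pair_def)
qed

lemma H01_zero: "(\<lambda>x. 0) \<in> H01 D"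
  using H01_pair_zero H01_iff_pair by blast

lemma H01_norm_diff:
  assumes "u \<in> H01 D" "v \<in> H01 D"
  shows "H01_norm D (\<lambda>x. u x - v x) = l2norm D (\<lambda>x. wgrad D u x - wgrad D v x)"
proof -
  have eq: "(\<lambda>x. (-1) * v x + u x) = (\<lambda>x. u x - v x)" by auto
  note * = H01_lincomb[OF assms(2,1), of "-1", unfolded eq]
  show ?thesis unfolding H01_norm_def
    using *(2) by (intro l2norm_cong_AE wgrad_L2 *(1) L2_diff assms) auto
qed

text \<open>The Poincare inequality makes the functions Cauchy in L2 along with their gradients, and
  \<open>H01_pair_limit\<close> shows that the two limits belong together.\<close>

theorem H01_complete:
  assumes Poincare: "\<And>v. v \<in> H01 D \<Longrightarrow> l2norm D v \<le> c * H01_norm D v"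
    and f: "\<And>k. f k \<in> H01 D"
    and Cauchy: "\<And>e. 0 < e \<Longrightarrow> \<exists>K. \<forall>m\<ge>K. \<forall>n\<ge>K. H01_norm D (\<lambda>x. f m x - f n x) < e"
  shows "\<exists>l\<in>H01 D. (\<lambda>k. H01_norm D (\<lambda>x. f k x - l x)) \<longlonglongrightarrow> 0"
proof -
  have diff: "(\<lambda>x. f m x - f n x) \<in> H01 D" for m n
    using H01_lincomb(1)[OF f[of n] f[of m], of "-1"] by simp
  have "\<exists>G\<in>L2_on D. (\<lambda>k. l2norm D (\<lambda>x. wgrad D (f k) x - G x)) \<longlonglongrightarrow> 0"
    using Cauchy by (intro L2_complete wgrad_L2 f) (simp add: H01_norm_diff f)
  then obtain G where G: "G \<in> L2_on D" "(\<lambda>k. l2norm D (\<lambda>x. wgrad D (f k) x - G x)) \<longlonglongrightarrow> 0" by blast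
  have "\<exists>l\<in>L2_on D. (\<lambda>k. l2norm D (\<lambda>x. f k x - l x)) \<longlonglongrightarrow> 0"
  proof (intro L2_complete H01_L2 f)
    fix e :: real assume e: "0 < e"
    \<comment> \<open>The absolute value is taken because no sign of \<open>c\<close> is assumed;
      the added 1 keeps the denominator positive.\<close>
    define d where "d = e / (\<bar>c\<bar> + 1)"
    have d: "0 < d" "\<bar>c\<bar> * d < e" using e by (auto simp: d_def field_simps)
    obtain K where K: "\<And>m n. \<lbrakk>m \<ge> K; n \<ge> K\<rbrakk> \<Longrightarrow> H01_norm D (\<lambda>x. f m x - f n x) < d"
      using Cauchy[OF d(1)] by blast
    have "l2norm D (\<lambda>x. f m x - f n x) < e" if "m \<ge> K" "n \<ge> K" for m n
    proof -
      have "l2norm D (\<lambda>x. f m x - f n x) \<le> c * H01_norm D (\<lambda>x. f m x - f n x)" by (rule Poincare[OF diff])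
      also have "\<dots> \<le> \<bar>c\<bar> * d"
        using K[OF that] by (intro mult_mono) (auto simp: H01_norm_def l2norm_nonneg)
      finally show ?thesis using d(2) by simp
    qed
    then show "\<exists>K. \<forall>m\<ge>K. \<forall>n\<ge>K. l2norm D (\<lambda>x. f m x - f n x) < e" by blast
  qed
  then obtain l where l: "l \<in> L2_on D" "(\<lambda>k. l2norm D (\<lambda>x. f k x - l x)) \<longlonglongrightarrow> 0" by blast
  have pair: "H01_pair l G"
    by (rule H01_pair_limit[OF H01_wgrad_pair[OF f] l(1) G(1) l(2) G(2)])
  then have lH: "l \<in> H01 D" and wl: "has_weak_gradient D l G" using H01_iff_pair by (auto simp: H01_pair_def)
  have "H01_norm D (\<lambda>x. f k x - l x) = l2norm D (\<lambda>x. wgrad D (f k) x - G x)" for k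
    unfolding H01_norm_diff[OF f lH] using wgrad_AE[OF wl]
    by (intro l2norm_cong_AE L2_diff wgrad_L2 f lH G(1)) auto
  then show ?thesis using lH G(2) by (intro bexI[of _ l]) simp_all
qed

end

section \<open>Energy forms on \<open>H\<^sub>0\<^sup>1(D)\<close>\<close>

text \<open>The pointwise vector space structure makes \<open>H01 D\<close> a subspace of a real
  vector space, as \<open>energy_space\<close> demands of its carrier.\<close>

instantiation "fun" :: (type, scaleR) scaleR
begin

definition scaleR_fun_def: "c *\<^sub>R f = (\<lambda>x. c *\<^sub>R f x)"

instance ..

end

instance "fun" :: (type, real_vector) real_vector
  by standard (simp_all add: scaleR_fun_def fun_eq_iff scaleR_add_left scaleR_add_right)

text \<open>The weights form a partition of unity, so the nodal energies add up to the Dirichlet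
  integral and the abstract seminorm coincides with \<open>H01_norm\<close> on
  \<open>H01 D\<close>.\<close>

locale weighted_H01 = bounded_open D for D :: "(real^'n) set" +
  fixes W :: "'m::finite \<Rightarrow> real^'n \<Rightarrow> real" and c2 :: real
  assumes W_measurable: "W i \<in> borel_measurable (lebesgue_on D)"
    and W_nonneg: "x \<in> D \<Longrightarrow> 0 \<le> W i x"
    and W_sum: "x \<in> D \<Longrightarrow> (\<Sum>i\<in>UNIV. W i x) = 1"
    and Poincare: "v \<in> H01 D \<Longrightarrow> l2norm D v \<le> c2 * H01_norm D v"
begin

definition energy :: "'m \<Rightarrow> (real^'n \<Rightarrow> real) \<Rightarrow> (real^'n \<Rightarrow> real) \<Rightarrow> real" where
  "energy i u v = (LINT x|lebesgue_on D. W i x * (wgrad D u x \<bullet> wgrad D v x))"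

lemma W_le_1: "x \<in> D \<Longrightarrow> \<bar>W i x\<bar> \<le> 1"
  using W_sum[of x] member_le_sum[of i UNIV "\<lambda>i. W i x"] by (simp add: W_nonneg)

lemma energy_integrable:
  "\<lbrakk>u \<in> H01 D; v \<in> H01 D\<rbrakk> \<Longrightarrow> integrable (lebesgue_on D) (\<lambda>x. W i x * (wgrad D u x \<bullet> wgrad D v x))"
  by (rule L2_mult_inner_integrable[where C = 1]) (auto intro: wgrad_L2 W_measurable W_le_1)

lemma weighted_sum_energy:
  assumes "u \<in> H01 D" "v \<in> H01 D"
  shows "(\<Sum>i\<in>UNIV. c i * energy i u v)
    = (LINT x|lebesgue_on D. (\<Sum>i\<in>UNIV. W i x * c i) * (wgrad D u x \<bullet> wgrad D v x))"
proof -
  have "(LINT x|lebesgue_on D. (\<Sum>i\<in>UNIV. W i x * c i) * (wgrad D u x \<bullet> wgrad D v x))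
      = (LINT x|lebesgue_on D. (\<Sum>i\<in>UNIV. c i * (W i x * (wgrad D u x \<bullet> wgrad D v x))))"
    by (simp add: sum_distrib_right mult_ac)
  also have "\<dots> = (\<Sum>i\<in>UNIV. c i * energy i u v)"
    unfolding energy_def using energy_integrable[OF assms]
    by (subst Bochner_Integration.integral_sum) auto
  finally show ?thesis ..
qed

lemma energy_norm_eq: "v \<in> H01 D \<Longrightarrow> energy_norm energy v = H01_norm D v"
proof -
  assume v: "v \<in> H01 D"
  have "(\<Sum>i\<in>UNIV. energy i v v) = (\<Sum>i\<in>UNIV. 1 * energy i v v)" by simp
  also have "\<dots> = (LINT x|lebesgue_on D. (\<Sum>i\<in>UNIV. W i x * 1) * (wgrad D v x \<bullet> wgrad D v x))"
    by (rule weighted_sum_energy[OF v v])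
  also have "\<dots> = (LINT x|lebesgue_on D. (norm (wgrad D v x))\<^sup>2)"
    by (intro Bochner_Integration.integral_cong) (simp_all add: W_sum power2_norm_eq_inner)
  finally show ?thesis by (simp add: energy_norm_def H01_norm_def l2norm_def)
qed

lemma H01_subspace: "subspace (H01 D)"
proof (rule subspaceI)
  show "0 \<in> H01 D" using H01_zero by (simp add: zero_fun_def)
  show "u + v \<in> H01 D" if "u \<in> H01 D" "v \<in> H01 D" for u v
    using H01_lincomb(1)[OF that, of 1] by (simp add: plus_fun_def)
  show "c *\<^sub>R u \<in> H01 D" if "u \<in> H01 D" for c u
    using H01_lincomb(1)[OF that H01_zero, of c] by (simp add: scaleR_fun_def)
qed

lemma energy_lincomb:
  assumes u: "u \<in> H01 D" and v: "v \<in> H01 D" and w: "w \<in> H01 D"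
  shows "energy i (\<lambda>x. c * u x + v x) w = c * energy i u w + energy i v w"
proof -
  note int = energy_integrable[OF u w, of i] energy_integrable[OF v w, of i]
  have "energy i (\<lambda>x. c * u x + v x) w
      = (LINT x|lebesgue_on D. c * (W i x * (wgrad D u x \<bullet> wgrad D w x)) + W i x * (wgrad D v x \<bullet> wgrad D w x))"
    unfolding energy_def
  \<comment> \<open>\<open>wgrad\<close> is linear only almost everywhere, since it picks an
    arbitrary representative.\<close>
  proof (rule integral_cong_AE)
    show "(\<lambda>x. W i x * (wgrad D (\<lambda>x. c * u x + v x) x \<bullet> wgrad D w x)) \<in> borel_measurable (lebesgue_on D)"
      using energy_integrable[OF H01_lincomb(1)[OF u v] w] by (rule borel_measurable_integrable)
    show "(\<lambda>x. c * (W i x * (wgrad D u x \<bullet> wgrad D w x)) + W i x * (wgrad D v x \<bullet> wgrad D w x)) \<in> borel_measurable (lebesgue_on D)"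
      using int by (intro borel_measurable_integrable) auto
    show "AE x in lebesgue_on D. W i x * (wgrad D (\<lambda>x. c * u x + v x) x \<bullet> wgrad D w x)
        = c * (W i x * (wgrad D u x \<bullet> wgrad D w x)) + W i x * (wgrad D v x \<bullet> wgrad D w x)"
      using H01_lincomb(2)[OF u v, of c] by eventually_elim (simp add: inner_add_left algebra_simps)
  qed
  also have "\<dots> = c * energy i u w + energy i v w" unfolding energy_def using int by simp
  finally show ?thesis .
qed

lemma energy_zero: "w \<in> H01 D \<Longrightarrow> energy i (\<lambda>x. 0) w = 0"
  using energy_lincomb[OF H01_zero H01_zero, of w i 1] by simp

sublocale energy_space "H01 D" energy
proof
  show "subspace (H01 D)" by (rule H01_subspace)
  show "energy i (u + v) w = energy i u w + energy i v w" if "u \<in> H01 D" "v \<in> H01 D" "w \<in> H01 D" for i u v w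
    using energy_lincomb[OF that, of i 1] by (simp add: plus_fun_def)
  show "energy i (c *\<^sub>R u) w = c * energy i u w" if "u \<in> H01 D" "w \<in> H01 D" for i c u w
    using energy_lincomb[OF that(1) H01_zero that(2), of i c] that(2) by (simp add: scaleR_fun_def energy_zero)
  show "energy i u v = energy i v u" for i u v by (simp add: energy_def inner_commute)
  show "0 \<le> energy i u u" for i u
    unfolding energy_def by (intro integral_nonneg_AE AE_I2) (simp add: W_nonneg)
  fix f :: "nat \<Rightarrow> real^'n \<Rightarrow> real"
  assume f: "\<And>k. f k \<in> H01 D"
    and Cauchy: "\<And>e. 0 < e \<Longrightarrow> \<exists>K. \<forall>m\<ge>K. \<forall>n\<ge>K. energy_norm energy (f m - f n) < e"
  have eq: "energy_norm energy (f k - v) = H01_norm D (\<lambda>x. f k x - v x)" if "v \<in> H01 D" for k v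
    using energy_norm_eq[OF subspace_diff[OF H01_subspace f that]] by (simp add: fun_diff_def)
  have "\<exists>l\<in>H01 D. (\<lambda>k. H01_norm D (\<lambda>x. f k x - l x)) \<longlonglongrightarrow> 0"
    by (rule H01_complete[OF Poincare f]) (use Cauchy eq[OF f] in simp_all)
  then show "\<exists>l\<in>H01 D. (\<lambda>k. energy_norm energy (f k - l)) \<longlonglongrightarrow> 0" using eq by auto
qed

section \<open>The dual norm of square-integrable data\<close>

lemma H01_norm_nonneg: "0 \<le> H01_norm D v"
  by (simp add: H01_norm_def l2norm_nonneg)

lemma L2_pairing_bound:
  assumes z: "z \<in> L2_on D" and v: "v \<in> H01 D"
  shows "\<bar>LINT x|lebesgue_on D. z x * v x\<bar> \<le> l2norm D z * (c2 * H01_norm D v)"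
  using l2_Cauchy_Schwarz[OF z H01_L2[OF v]] mult_left_mono[OF Poincare[OF v] l2norm_nonneg[of z]] by simp

text \<open>A real supremum dominates its members only if the set is bounded above; the Poincare
  inequality provides that bound.\<close>

lemma Hm1_upper:
  assumes z: "z \<in> L2_on D" and v: "v \<in> H01 D" "H01_norm D v \<le> 1"
  shows "\<bar>LINT x|lebesgue_on D. z x * v x\<bar> \<le> Hm1_norm D z"
  unfolding Hm1_norm_def dual_norm_def
proof (rule cSUP_upper)
  show "bdd_above ((\<lambda>v. \<bar>LINT x|lebesgue_on D. z x * v x\<bar>) ` {v \<in> H01 D. H01_norm D v \<le> 1})"
  proof (rule bdd_aboveI2)
    fix v assume v: "v \<in> {v \<in> H01 D. H01_norm D v \<le> 1}"
    have "c2 * H01_norm D v \<le> \<bar>c2\<bar> * 1" using v H01_norm_nonneg by (intro mult_mono) auto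
    then show "\<bar>LINT x|lebesgue_on D. z x * v x\<bar> \<le> l2norm D z * \<bar>c2\<bar>"
      using L2_pairing_bound[OF z, of v] v mult_left_mono[OF _ l2norm_nonneg[of z], of "c2 * H01_norm D v" "\<bar>c2\<bar>"]
      by auto
  qed
qed (use v in simp)

lemma Hm1_bound:
  assumes z: "z \<in> L2_on D" and v: "v \<in> H01 D"
  shows "\<bar>LINT x|lebesgue_on D. z x * v x\<bar> \<le> Hm1_norm D z * H01_norm D v"
proof (cases "H01_norm D v = 0")
  case True
  \<comment> \<open>Normalising \<open>v\<close> is impossible here, but the Poincare inequality
    already forces the pairing to vanish.\<close>
  then show ?thesis using L2_pairing_bound[OF z v] by simp
next
  case False
  let ?I = "\<lambda>v. LINT x|lebesgue_on D. z x * v x"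
  define t where "t = 1 / H01_norm D v"
  have pos: "0 < H01_norm D v" using False H01_norm_nonneg[of v] by linarith
  then have t: "0 < t" by (simp add: t_def)
  have tv: "t *\<^sub>R v \<in> H01 D" by (rule subspace_scale[OF H01_subspace v])
  have "H01_norm D (t *\<^sub>R v) = t * H01_norm D v"
    using nrm_scale[OF v, of t] t by (simp add: energy_norm_eq v tv)
  then have "H01_norm D (t *\<^sub>R v) \<le> 1" using pos by (simp add: t_def)
  then have "\<bar>?I (t *\<^sub>R v)\<bar> \<le> Hm1_norm D z" by (rule Hm1_upper[OF z tv])
  moreover have "?I (t *\<^sub>R v) = t * ?I v"
  proof -
    have "?I (t *\<^sub>R v) = (LINT x|lebesgue_on D. t * (z x * v x))" by (simp add: scaleR_fun_def mult_ac)
    then show ?thesis by simp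
  qed
  ultimately have "t * \<bar>?I v\<bar> \<le> Hm1_norm D z" using t by (simp add: abs_mult)
  then show ?thesis using pos by (simp add: t_def field_simps)
qed

lemma Hm1_nonneg:
  assumes z: "z \<in> L2_on D"
  shows "0 \<le> Hm1_norm D z"
proof -
  have "energy_norm energy 0 = 0" using nrm_scale[of 0 0] V_closed(4) by simp
  then have "H01_norm D 0 \<le> 1" using energy_norm_eq[OF V_closed(4)] by simp
  from Hm1_upper[OF z V_closed(4) this] show ?thesis by linarith
qed

lemma bounded_functional_L2:
  assumes z: "z \<in> L2_on D"
  shows "bounded_functional (\<lambda>v. LINT x|lebesgue_on D. z x * v x)"
proof (rule bounded_functionalI)
  show "(LINT x|lebesgue_on D. z x * (u + v) x) = (LINT x|lebesgue_on D. z x * u x) + (LINT x|lebesgue_on D. z x * v x)"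
    if "u \<in> H01 D" "v \<in> H01 D" for u v
    using L2_mult_integrable[OF z H01_L2[OF that(1)]] L2_mult_integrable[OF z H01_L2[OF that(2)]]
    by (simp add: distrib_left)
  show "(LINT x|lebesgue_on D. z x * (c *\<^sub>R u) x) = c * (LINT x|lebesgue_on D. z x * u x)" for u c
  proof -
    have "(LINT x|lebesgue_on D. z x * (c *\<^sub>R u) x) = (LINT x|lebesgue_on D. c * (z x * u x))"
      by (simp add: scaleR_fun_def mult_ac)
    then show ?thesis by simp
  qed
  show "\<bar>LINT x|lebesgue_on D. z x * v x\<bar> \<le> Hm1_norm D z * nrm v" if "v \<in> H01 D" for v
    using Hm1_bound[OF z that] energy_norm_eq[OF that] by simp
qed

end

locale log_affine_problem = weighted_H01 D W c2 + affine_exponential "H01 D" energy B z0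
  for D :: "(real^'n) set" and W :: "'m::finite \<Rightarrow> real^'n \<Rightarrow> real" and c2 :: real
    and B :: "'m \<Rightarrow> 's::finite \<Rightarrow> real" and z0 :: "'m \<Rightarrow> real"
begin

lemma partial_iff:
  assumes f: "\<And>y. f y \<in> H01 D"
  shows "partial j f f' \<longleftrightarrow> (\<forall>y. has_H01_partial D j f (f' y) y)"
proof -
  have "has_vderiv (\<lambda>t. f (y + t *\<^sub>R axis j 1)) g \<longleftrightarrow>
      ((\<lambda>t. H01_norm D (\<lambda>x. (f (y + t *\<^sub>R axis j 1) x - f y x) / t - g x)) \<longlongrightarrow> 0) (at 0)"
    if g: "g \<in> H01 D" for y g
  proof -
    have "(1 / t) *\<^sub>R (f (y + t *\<^sub>R axis j 1) - f (y + 0 *\<^sub>R axis j 1)) - g \<in> H01 D" for t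
      by (intro V_closed f g)
    from energy_norm_eq[OF this] show ?thesis
      unfolding has_vderiv_def by (simp add: scaleR_fun_def fun_diff_def divide_inverse mult.commute)
  qed
  then show ?thesis unfolding partial_def has_H01_partial_def by blast
qed

lemma partials_iff: "partials f w \<longleftrightarrow> H01_partials D f w"
proof
  assume w: "partials f w"
  then have "partial j (w \<nu>) (w (\<nu>(j := Suc (\<nu> j))))" for \<nu> j
    by (simp add: partials_def)
  then have "has_H01_partial D j (w \<nu>) (w (\<nu>(j := Suc (\<nu> j))) y) y" for \<nu> j y
    using partial_iff[of "w \<nu>" j] partials_in_V[OF w] by blast
  then show "H01_partials D f w" using w by (simp add: partials_def H01_partials_def)
next
  assume w: "H01_partials D f w"
  have "w \<nu> y \<in> H01 D" for \<nu> y
    by (cases \<nu> rule: multi_index_cases) (use w in \<open>auto simp: H01_partials_def has_H01_partial_def\<close>)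
  then have "partial j (w \<nu>) (w (\<nu>(j := Suc (\<nu> j))))" for \<nu> j
    using w by (simp add: partial_iff H01_partials_def)
  then show "partials f w" using w by (simp add: partials_def H01_partials_def)
qed

lemma partials_pderiv: "\<exists>w. partials f w \<Longrightarrow> partials f (\<lambda>\<nu>. H01_pderiv D \<nu> f)"
  unfolding partials_iff H01_pderiv_def by (metis someI_ex)

lemma wform_eq_integral:
  "\<lbrakk>u \<in> H01 D; v \<in> H01 D\<rbrakk> \<Longrightarrow> wform (ex y) u v
    = (LINT x|lebesgue_on D. (\<Sum>i\<in>UNIV. W i x * ex y i) * (wgrad D u x \<bullet> wgrad D v x))"
  unfolding wform_def by (rule weighted_sum_energy)

lemma coercive_lower_bound:
  assumes am: "\<And>x. x \<in> D \<Longrightarrow> am \<le> (\<Sum>i\<in>UNIV. W i x * ex y i)" and v: "v \<in> H01 D"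
  shows "am * (nrm v)\<^sup>2 \<le> wform (ex y) v v"
proof -
  have "am * (nrm v)\<^sup>2 = (LINT x|lebesgue_on D. am * (wgrad D v x \<bullet> wgrad D v x))"
    using v by (simp add: energy_norm_eq H01_norm_def l2norm_square)
  also have "\<dots> \<le> (LINT x|lebesgue_on D. (\<Sum>i\<in>UNIV. W i x * ex y i) * (wgrad D v x \<bullet> wgrad D v x))"
  proof (rule integral_mono)
    show "integrable (lebesgue_on D) (\<lambda>x. am * (wgrad D v x \<bullet> wgrad D v x))"
      using L2_inner_integrable[OF wgrad_L2[OF v] wgrad_L2[OF v]] by simp
    have "integrable (lebesgue_on D) (\<lambda>x. \<Sum>i\<in>UNIV. ex y i * (W i x * (wgrad D v x \<bullet> wgrad D v x)))"
      by (intro Bochner_Integration.integrable_sum integrable_mult_right energy_integrable v)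
    moreover have "(\<Sum>i\<in>UNIV. ex y i * (W i x * (wgrad D v x \<bullet> wgrad D v x)))
        = (\<Sum>i\<in>UNIV. W i x * ex y i) * (wgrad D v x \<bullet> wgrad D v x)" for x
      unfolding sum_distrib_right by (intro sum.cong refl) simp
    ultimately show "integrable (lebesgue_on D) (\<lambda>x. (\<Sum>i\<in>UNIV. W i x * ex y i) * (wgrad D v x \<bullet> wgrad D v x))"
      by simp
    show "am * (wgrad D v x \<bullet> wgrad D v x) \<le> (\<Sum>i\<in>UNIV. W i x * ex y i) * (wgrad D v x \<bullet> wgrad D v x)"
      if "x \<in> space (lebesgue_on D)" for x
      using am that by (intro mult_right_mono) simp_all
  qed
  finally show ?thesis unfolding wform_eq_integral[OF v v] .
qed

end

section \<open>Multilinear interpolation as a convex combination of nodal values\<close>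

text \<open>The multilinear nodal basis function of node \<open>i\<close>. Grouping the
  interpolation by nodes rather than by vertices of the current cell separates the dependence on
  \<open>x\<close> from that on the parameter.\<close>

definition node_weight ::
    "real^'n \<Rightarrow> real^'n \<Rightarrow> ('n \<Rightarrow> nat) \<Rightarrow> ('m::finite \<Rightarrow> real^'n) \<Rightarrow> 'm \<Rightarrow> real^'n \<Rightarrow> real" where
  "node_weight p0 h N pts i x =
     (\<Sum>e\<in>UNIV. cell_weight p0 h N x e * (if inv pts (cell_vertex p0 h N x e) = i then 1 else 0))"

lemma multilinear_interp_eq_node_weight:
  "multilinear_interp p0 h N pts f x = (\<Sum>i\<in>UNIV. node_weight p0 h N pts i x * f i)"
proof -
  have "(\<Sum>i\<in>UNIV. node_weight p0 h N pts i x * f i)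
      = (\<Sum>i\<in>UNIV. \<Sum>e\<in>UNIV. cell_weight p0 h N x e * (if inv pts (cell_vertex p0 h N x e) = i then f i else 0))"
    unfolding node_weight_def sum_distrib_right by (intro sum.cong refl) simp
  also have "\<dots> = (\<Sum>e\<in>UNIV. \<Sum>i\<in>UNIV. cell_weight p0 h N x e * (if inv pts (cell_vertex p0 h N x e) = i then f i else 0))"
    by (rule sum.swap)
  also have "\<dots> = multilinear_interp p0 h N pts f x"
    unfolding multilinear_interp_def sum_distrib_left[symmetric] by simp
  finally show ?thesis ..
qed

lemma node_weight_sum: "(\<Sum>i\<in>UNIV. node_weight p0 h N pts i x) = 1"
  using multilinear_interp_eq_node_weight[of p0 h N pts "\<lambda>_. 1" x] cell_weight_sum[of p0 h N x]
  by (simp add: multilinear_interp_def)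

lemma node_weight_nonneg:
  "\<lbrakk>uniform_grid p0 h N pts; x \<in> grid_box p0 h N\<rbrakk> \<Longrightarrow> 0 \<le> node_weight p0 h N pts i x"
  unfolding node_weight_def by (intro sum_nonneg mult_nonneg_nonneg cell_weight_bounds(1)) auto

lemma cell_index_measurable [measurable]:
  "(\<lambda>x. cell_index p0 h N x l) \<in> measurable borel (count_space UNIV)"
  unfolding cell_index_def by measurable

text \<open>The vertices depend on \<open>x\<close> only through the vector of cell indices. That
  vector takes countably many values and has measurable level sets, so every function of it is
  measurable.\<close>

lemma node_weight_measurable: "node_weight p0 h N pts i \<in> borel_measurable borel"
proof -
  have "(\<lambda>x l. cell_index p0 h N x l) \<in> measurable borel (count_space UNIV)"
  proof (subst measurable_count_space_eq2_countable, intro conjI ballI)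
    fix k :: "'a \<Rightarrow> nat"
    have "(\<lambda>x l. cell_index p0 h N x l) -` {k} \<inter> space borel = {x \<in> space borel. \<forall>l\<in>UNIV. cell_index p0 h N x l = k l}"
      by auto
    also have "\<dots> \<in> sets borel" by measurable
    finally show "(\<lambda>x l. cell_index p0 h N x l) -` {k} \<inter> space borel \<in> sets borel" .
  qed auto
  from measurable_compose[OF this, of _ borel]
  have 1: "(\<lambda>x. \<psi> (\<lambda>l. cell_index p0 h N x l)) \<in> borel_measurable borel" for \<psi> :: "('a \<Rightarrow> nat) \<Rightarrow> real"
    by simp
  have 2: "(\<lambda>x. cell_weight p0 h N x e) \<in> borel_measurable borel" for e
    unfolding cell_weight_def Let_def
  proof (intro borel_measurable_prod)
    fix l
    have "(\<lambda>x. (x $ l - p0 $ l) / h $ l - real (cell_index p0 h N x l)) \<in> borel_measurable borel" by measurable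
    then show "(\<lambda>x. if l \<in> e then (x $ l - p0 $ l) / h $ l - real (cell_index p0 h N x l)
        else 1 - ((x $ l - p0 $ l) / h $ l - real (cell_index p0 h N x l))) \<in> borel_measurable borel"
      by simp
  qed
  show ?thesis
    unfolding node_weight_def[abs_def] cell_vertex_def
    by (intro borel_measurable_sum borel_measurable_times 2)
      (rule 1[of "\<lambda>k. if inv pts (grid_node p0 h (\<lambda>l. k l + (if l \<in> _ then 1 else 0))) = i then 1 else 0"])
qed

text \<open>On a bounded set the Hoelder condition bounds \<open>Z\<close> from below by its value
  at one point minus a multiple of a power of the diameter.\<close>

lemma a_min_pos:
  assumes "bounded D" "D \<noteq> {}" "0 < \<beta>" and holder: "holder_on \<beta> (closure D) (\<lambda>x. Z x \<omega>)"
  shows "0 < a_min D Z \<omega>"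
proof -
  obtain C where C: "\<And>x x'. \<lbrakk>x \<in> closure D; x' \<in> closure D\<rbrakk> \<Longrightarrow> \<bar>Z x \<omega> - Z x' \<omega>\<bar> \<le> C * dist x x' powr \<beta>"
    using holder unfolding holder_on_def by blast
  obtain x0 where x0: "x0 \<in> closure D" using assms(2) closure_subset by blast
  define d where "d = diameter (closure D)"
  have "bounded (closure D)" using assms(1) by (rule bounded_closure)
  then have dist: "dist x x0 \<le> d" if "x \<in> closure D" for x
    unfolding d_def using that x0 by (intro diameter_bounded_bound)
  have "exp (Z x0 \<omega> - \<bar>C\<bar> * d powr \<beta>) \<le> exp (Z x \<omega>)" if x: "x \<in> closure D" for x
  proof -
    have "\<bar>Z x \<omega> - Z x0 \<omega>\<bar> \<le> C * dist x x0 powr \<beta>" by (rule C[OF x x0])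
    also have "\<dots> \<le> \<bar>C\<bar> * d powr \<beta>"
      using dist[OF x] assms(3) by (intro mult_mono powr_mono2) auto
    finally show ?thesis by simp
  qed
  then have "exp (Z x0 \<omega> - \<bar>C\<bar> * d powr \<beta>) \<le> a_min D Z \<omega>"
    unfolding a_min_def using x0 by (intro cINF_greatest) auto
  then show ?thesis by (rule less_le_trans[rotated]) simp
qed

text \<open>State and adjoint are given at every parameter because differentiation compares
  neighbouring parameters, whereas the coefficient bounds refer to the realised
  \<open>y\<close>.\<close>

theorem lemma5p4:
  fixes D :: "(real^'n) set"
    and M :: "'w measure" and Z :: "real^'n \<Rightarrow> 'w \<Rightarrow> real" and \<beta> :: real
    and p0 h :: "real^'n" and N :: "'n \<Rightarrow> nat" and pts :: "'m::finite \<Rightarrow> real^'n"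
    and B :: "real^'s^'m" and Zbar :: "real^'m"
    and Y :: "'w \<Rightarrow> real^'s" and \<omega> :: 'w and y :: "real^'s"
    and c1 c2 :: real and z g :: "real^'n \<Rightarrow> real"
    and u q :: "real^'s \<Rightarrow> real^'n \<Rightarrow> real"
  assumes dim: "CARD('n) \<in> {1, 2, 3}"
    and dom: "bounded_lipschitz_domain D"
    and c1: "0 < c1" "\<forall>v\<in>L2_on D. Hm1_norm D v \<le> c1 * l2norm D v"
    and c2: "0 < c2" "\<forall>v\<in>H01 D. l2norm D v \<le> c2 * H01_norm D v"
    and prob: "prob_space M"
    and grid: "uniform_grid p0 h N pts" "closure D \<subseteq> grid_box p0 h N"
    and field: "gaussian_field M (closure D \<union> range pts) Z"
    and beta: "0 < \<beta>" "\<beta> \<le> 1"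
    and holder: "AE \<omega>' in M. holder_on \<beta> (closure D) (\<lambda>x. Z x \<omega>')"
    and Zbar: "\<forall>i. Zbar $ i = (\<integral>\<omega>'. Z (pts i) \<omega>' \<partial>M)"
    and factor: "covariance_matrix M pts Z = B ** transpose B"
    and size: "CARD('m) \<le> CARD('s)"
    and Y: "std_normal_vec M Y"
    and sampling: "AE \<omega>' in M. \<forall>i. Z (pts i) \<omega>' = (B *v Y \<omega>' + Zbar) $ i"
    and realization: "\<omega> \<in> space M" "y = Y \<omega>"
      "holder_on \<beta> (closure D) (\<lambda>x. Z x \<omega>)"
      "\<forall>i. Z (pts i) \<omega> = (B *v y + Zbar) $ i"
    and bounds: "\<forall>x\<in>closure D. a_min D Z \<omega> \<le> a_s p0 h N pts B Zbar y x \<and>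
                               a_s p0 h N pts B Zbar y x \<le> a_max D Z \<omega>"
    and data: "z \<in> L2_on D" "g \<in> L2_on D"
    and state: "\<forall>y'. weak_solution D (a_s p0 h N pts B Zbar y') z (u y')"
    and adjoint: "\<forall>y'. weak_solution D (a_s p0 h N pts B Zbar y') (\<lambda>x. u y' x - g x) (q y')"
  shows "H01_smooth D u \<and> H01_smooth D q \<and>
    (\<forall>\<nu> :: 's \<Rightarrow> nat.
       H01_norm D (H01_pderiv D \<nu> u y)
         \<le> fact (\<Sum>j\<in>UNIV. \<nu> j) * ((\<Prod>j\<in>UNIV. b_vec B j ^ \<nu> j) / ln 2 ^ (\<Sum>j\<in>UNIV. \<nu> j))
             * (Hm1_norm D z / a_min D Z \<omega>) \<and>
       H01_norm D (H01_pderiv D \<nu> q y)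
         \<le> fact ((\<Sum>j\<in>UNIV. \<nu> j) + 1) * ((\<Prod>j\<in>UNIV. b_vec B j ^ \<nu> j) / ln 2 ^ (\<Sum>j\<in>UNIV. \<nu> j))
             * (C_q c1 c2 (a_min D Z \<omega>) / a_min D Z \<omega>) * (Hm1_norm D z + Hm1_norm D g))"
proof -
  have open_D: "open D" and bounded_D: "bounded D" and "D \<noteq> {}"
    using dom by (auto simp: bounded_lipschitz_domain_def)
  let ?W = "node_weight p0 h N pts" and ?am = "a_min D Z \<omega>"
  have D: "x \<in> closure D \<and> x \<in> grid_box p0 h N" if "x \<in> D" for x
    using grid(2) closure_subset that by blast
  interpret weighted_H01 D ?W c2
  proof
    show "open D" "bounded D" by fact+
    have "?W i \<in> borel_measurable lebesgue" for i
      by (intro measurable_completion) (simp add: node_weight_measurable)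
    then show "?W i \<in> borel_measurable (lebesgue_on D)" for i by (rule measurable_restrict_space1)
    show "0 \<le> ?W i x" if "x \<in> D" for i x using node_weight_nonneg[OF grid(1)] D[OF that] by blast
    show "(\<Sum>i\<in>UNIV. ?W i x) = 1" for x by (rule node_weight_sum)
    show "l2norm D v \<le> c2 * H01_norm D v" if "v \<in> H01 D" for v using c2(2) that by blast
  qed
  interpret log_affine_problem D ?W c2 "\<lambda>i j. B $ i $ j" "\<lambda>i. Zbar $ i" ..
  have a_s: "a_s p0 h N pts B Zbar y' x = (\<Sum>i\<in>UNIV. ?W i x * ex y' i)" for y' x
    by (simp add: a_s_def multilinear_interp_eq_node_weight ex_def)
  have am: "0 < ?am"
    using bounded_D \<open>D \<noteq> {}\<close> beta(1) realization(3) by (rule a_min_pos)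
  \<comment> \<open>The lower bound for \<open>a_s\<close> at the realised parameter makes
    \<open>a_min D Z \<omega>\<close> the coercivity constant there.\<close>
  have coercive: "?am * (nrm v)\<^sup>2 \<le> wform (ex y) v v" if "v \<in> H01 D" for v
    using bounds D that by (intro coercive_lower_bound) (simp_all flip: a_s)
  have b: "\<bar>B $ i $ j\<bar> \<le> b_vec B j" for i j
    unfolding b_vec_def by (intro Max_ge) auto
  let ?F = "\<lambda>z v. LINT x|lebesgue_on D. z x * v x"
  have u: "u y' \<in> H01 D" and q: "q y' \<in> H01 D" for y'
    using state adjoint by (auto simp: weak_solution_def)
  have usol: "wform (ex y') (u y') v = ?F z v" if "v \<in> H01 D" for y' v
    using state that u by (simp add: wform_eq_integral weak_solution_def flip: a_s)
  have qsol: "wform (ex y') (q y') v = ?F (u y') v - ?F g v" if v: "v \<in> H01 D" for y' v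
  proof -
    have "wform (ex y') (q y') v = (LINT x|lebesgue_on D. (u y' x - g x) * v x)"
      using adjoint v q by (simp add: wform_eq_integral weak_solution_def flip: a_s)
    also have "\<dots> = ?F (u y') v - ?F g v"
      using L2_mult_integrable[OF H01_L2[OF u] H01_L2[OF v]] L2_mult_integrable[OF data(2) H01_L2[OF v]]
      by (simp add: left_diff_distrib)
    finally show ?thesis .
  qed
  have Fbound: "\<bar>?F f v\<bar> \<le> Hm1_norm D f * nrm v" if "f \<in> L2_on D" "v \<in> H01 D" for f v
    using Hm1_bound[OF that] energy_norm_eq[OF that(2)] by simp
  \<comment> \<open>The two embeddings are chained: the dual norm of \<open>w\<close> is at most
    \<open>c1\<close> times its L2 norm, hence at most \<open>c1 * c2\<close> times its gradient
    norm. This product is the \<open>\<kappa>\<close> of the adjoint estimate and reappears inside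
    \<open>C_q\<close>.\<close>
  have pairing: "\<bar>?F w v\<bar> \<le> c1 * c2 * nrm w * nrm v" if w: "w \<in> H01 D" and v: "v \<in> H01 D" for w v
  proof -
    have "Hm1_norm D w \<le> c1 * l2norm D w" using c1(2) H01_L2[OF w] by blast
    also have "\<dots> \<le> c1 * (c2 * nrm w)"
      using c1(1) c2(2) w by (intro mult_left_mono) (auto simp: energy_norm_eq)
    finally have "Hm1_norm D w * nrm v \<le> c1 * (c2 * nrm w) * nrm v"
      using nrm_nonneg[OF v] by (rule mult_right_mono)
    then have "Hm1_norm D w * nrm v \<le> c1 * c2 * nrm w * nrm v" by (simp only: mult.assoc)
    then show ?thesis using Fbound[OF H01_L2[OF w] v] by linarith
  qed
  have swap: "bounded_functional (\<lambda>w. ?F w v)" if "v \<in> H01 D" for v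
    using bounded_functional_L2[OF H01_L2[OF that]] by (simp add: mult.commute)
  have \<kappa>: "0 \<le> c1 * c2" using c1(1) c2(1) by simp
  note z_facts = bounded_functional_L2[OF data(1)] Fbound[of z, OF data(1)] Hm1_nonneg[OF data(1)]
    and g_facts = bounded_functional_L2[OF data(2)] Fbound[of g, OF data(2)] Hm1_nonneg[OF data(2)]
  have P: "bounded_functional (?F w)" if "w \<in> H01 D" for w
    by (rule bounded_functional_L2[OF H01_L2[OF that]])
  have ex_u: "\<exists>w. partials u w"
    by (rule state_partials(1)[where f = "?F z" and K = "Hm1_norm D z" and b = "b_vec B"])
      (fact z_facts u usol b)+
  have ex_q: "\<exists>w. partials q w"
    by (rule adjoint_partials(1)[where f = "?F z" and K = "Hm1_norm D z" and u = u and b = "b_vec B"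
          and g = "?F g" and L = "Hm1_norm D g" and P = "\<lambda>w. ?F w" and \<kappa> = "c1 * c2"])
      (fact z_facts u usol b g_facts swap P pairing \<kappa> q qsol)+
  have "H01_smooth D u" "H01_smooth D q"
    using ex_u ex_q by (simp_all add: H01_smooth_def partials_iff)
  moreover have "H01_norm D (H01_pderiv D \<nu> u y)
      \<le> fact (\<Sum>j\<in>UNIV. \<nu> j) * ((\<Prod>j\<in>UNIV. b_vec B j ^ \<nu> j) / ln 2 ^ (\<Sum>j\<in>UNIV. \<nu> j))
          * (Hm1_norm D z / ?am)"
    and "H01_norm D (H01_pderiv D \<nu> q y)
      \<le> fact ((\<Sum>j\<in>UNIV. \<nu> j) + 1) * ((\<Prod>j\<in>UNIV. b_vec B j ^ \<nu> j) / ln 2 ^ (\<Sum>j\<in>UNIV. \<nu> j))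
          * (C_q c1 c2 ?am / ?am) * (Hm1_norm D z + Hm1_norm D g)" for \<nu>
  proof -
    note pu = partials_pderiv[OF ex_u] and pq = partials_pderiv[OF ex_q]
    have card: "card (slots \<nu>) = (\<Sum>j\<in>UNIV. \<nu> j)" by (simp add: card_eq_sum_slot_mult)
    have bp: "slot_prod (b_vec B) (slots \<nu>) = (\<Prod>j\<in>UNIV. b_vec B j ^ \<nu> j)" by (simp add: slot_prod_eq)
    have "nrm (H01_pderiv D \<nu> u y) \<le> fact (card (slots \<nu>)) / ln 2 ^ card (slots \<nu>)
        * slot_prod (b_vec B) (slots \<nu>) * (Hm1_norm D z / ?am)"
      by (rule state_partials(2)[where f = "?F z" and u = u]) (fact z_facts u usol b pu am coercive)+
    then show "H01_norm D (H01_pderiv D \<nu> u y)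
      \<le> fact (\<Sum>j\<in>UNIV. \<nu> j) * ((\<Prod>j\<in>UNIV. b_vec B j ^ \<nu> j) / ln 2 ^ (\<Sum>j\<in>UNIV. \<nu> j))
          * (Hm1_norm D z / ?am)"
      unfolding energy_norm_eq[OF partials_in_V[OF pu]] card bp by simp
    have "nrm (H01_pderiv D \<nu> q y) \<le> fact (card (slots \<nu>) + 1) / ln 2 ^ card (slots \<nu>)
        * slot_prod (b_vec B) (slots \<nu>) * (max 1 (c1 * c2 / ?am) / ?am) * (Hm1_norm D z + Hm1_norm D g)"
      by (rule adjoint_partials(2)[where f = "?F z" and u = u and g = "?F g" and P = "\<lambda>w. ?F w" and q = q])
        (fact z_facts u usol b g_facts swap P pairing \<kappa> q qsol pq am coercive)+
    then show "H01_norm D (H01_pderiv D \<nu> q y)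
      \<le> fact ((\<Sum>j\<in>UNIV. \<nu> j) + 1) * ((\<Prod>j\<in>UNIV. b_vec B j ^ \<nu> j) / ln 2 ^ (\<Sum>j\<in>UNIV. \<nu> j))
          * (C_q c1 c2 ?am / ?am) * (Hm1_norm D z + Hm1_norm D g)"
      unfolding energy_norm_eq[OF partials_in_V[OF pq]] card bp C_q_def by simp
  qed
  ultimately show ?thesis by blast
qed

end
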